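(* Let $\chi$ be a class function of $Z_k\wr S_n$ given by a color rule $F$ with value function $p$ and weight function $\rho$. Then for every $\vec\gamma\vdash_k n$, \[ \langle \chi,\chi^{\vec\gamma}\rangle=\sum_{T\in \mathrm{SSYT}_k(\vec\gamma,F)}\rho(T). \]
   Context: Fix $k,n\ge1$, $u_j=e^{2\pi i j/k}$, $Z_k=\{u_0,\dots,u_{k-1}\}$. $Z_k\wr S_n$ is the group of $n\times n$ matrices with exactly one nonzero entry per row and column, entries in $Z_k$. For $\sigma\in Z_k\wr S_n$ let $\sigma_i$ be the column of the nonzero entry of row $i$ and $u(\sigma,i)$ that entry; the cycles of $\sigma$ are those of the permutation $i\mapsto\sigma_i$. The C-type of a cycle $(i_1,\dots,i_m)$ ($i_{l+1}=\sigma_{i_l}$) is $\prod_l u(\sigma,i_l)$; it is a $C_j$-cycle if this product is $u_j$. $\vec\lambda\vdash_k n$ means $\vec\lambda=(\lambda^0,\dots,\lambda^{k-1})$ is a $k$-tuple of (possibly empty) partitions with $\sum|\lambda^j|=n$. Irreducible characters: for $\vec\gamma\vdash_k n$, $\chi^{\vec\gamma}$ is the irreducible character given by the wreath Murnaghan–Nakayama rule: if $\sigma$ has cycles with lengths $\alpha_1,\dots,\alpha_l$ and C-types $a_1,\dots,a_l$ (in any fixed order), then $\chi^{\vec\gamma}(\sigma)=\sum\prod_{s=1}^l a_s^{j_s}(-1)^{\mathrm{ht}(\zeta_s)}$, summed over all sequences in which, for $s=1,\dots,l$, a border strip (rim hook: connected skew shape containing no $2\times2$ square whose removal leaves a partition)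 $\zeta_s$ of size $\alpha_s$ is removed from a single component $j_s$ of what remains of $\vec\gamma$, ending with all components empty; $\mathrm{ht}(\zeta)$ is the number of rows of $\zeta$ minus one. The inner product is $\langle \chi,\psi\rangle=\frac{1}{n!k^n}\sum_{\sigma}\chi(\sigma)\overline{\psi(\sigma)}$. Color rules: a color rule is a multiset of colors $F=[f_1^{m_1},f_2^{m_2},\dots]$. A coloring of $\sigma$ is $f=(f_{r_1},\dots,f_{r_n})$ (a color for each index) with $[f_{r_1},\dots,f_{r_n}]$ contained in $F$ with multiplicities and $f_{r_i}=f_{r_j}$ whenever $i,j$ are in the same cycle. A class function $\chi:Z_k\wr S_n\to R$ ($R$ a ring such as $\mathbb{C}((t_1,t_2,\dots))$) is given by $F$ with value $p:F\to\mathbb{Z}$ and weight $\rho:F\to R$ if $\chi(\sigma)=\sum_{f}\prod_{i=1}^n u(\sigma,i)^{p(f_{r_i})}\rho(f_{r_i})$, the sum over all colorings $f$ of $\sigma$. $\mathrm{SSYT}_k(\vec\gamma,F)$: fix a total order on the distinct colors; let $F_r$ be the submultiset of colors $f$ with $p(f)\equiv r\pmod k$. It is the set of tuples $(T^0,\dots,T^{k-1})$ where $T^r$ is a filling of the cells of $\gamma^r$ with colors, rows weakly increasing left to right, columns strictly increasing bottom to top (French convention), and the multiset of entries of $T^r$ contained (with multiplicities) in $F_r$. For such $T$, $\rho(T)=\prod_f\rho(f)^{a_f}$, $a_f$ the number of occurrences of $f$ in $T$. *)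

theory Defs
  imports
    "HOL-Analysis.Infinite_Sum"
    "HOL-Library.Extended_Nat"
    "HOL-Library.Multiset"
    "HOL-Combinatorics.Orbits"
    "Jordan_Normal_Form.Matrix"
begin

section \<open>The group \<open>Z\<^sub>k \<wr> S\<^sub>n\<close>\<close>

text \<open>Row and column indices run over \<open>{..<n}\<close>.\<close>

definition root_u :: "nat \<Rightarrow> nat \<Rightarrow> complex" where
  "root_u k j = exp (2 * of_real pi * \<i> * of_nat j / of_nat k)"

definition wreath :: "nat \<Rightarrow> nat \<Rightarrow> complex mat set" where
  "wreath k n = {\<sigma> \<in> carrier_mat n n.
     (\<forall>i<n. \<exists>!j. j < n \<and> \<sigma> $$ (i, j) \<noteq> 0) \<and>
     (\<forall>j<n. \<exists>!i. i < n \<and> \<sigma> $$ (i, j) \<noteq> 0) \<and>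
     (\<forall>i<n. \<forall>j<n. \<sigma> $$ (i, j) \<noteq> 0 \<longrightarrow> \<sigma> $$ (i, j) \<in> root_u k ` {..<k})}"

definition col_of :: "complex mat \<Rightarrow> nat \<Rightarrow> nat" where
  "col_of \<sigma> i = (THE j. j < dim_col \<sigma> \<and> \<sigma> $$ (i, j) \<noteq> 0)"

definition entry_of :: "complex mat \<Rightarrow> nat \<Rightarrow> complex" where
  "entry_of \<sigma> i = \<sigma> $$ (i, col_of \<sigma> i)"

text \<open>A cycle is recorded by its set of indices, which determines it (as the orbits of \<open>col_of \<sigma>\<close>)
  together with its length and its C-type.\<close>

definition cycles_of :: "complex mat \<Rightarrow> nat set set" where
  "cycles_of \<sigma> = orbit (col_of \<sigma>) ` {..<dim_row \<sigma>}"

definition C_type :: "complex mat \<Rightarrow> nat set \<Rightarrow> complex" where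
  "C_type \<sigma> c = (\<Prod>i\<in>c. entry_of \<sigma> i)"

definition cycle_enumeration :: "nat \<Rightarrow> nat \<Rightarrow> (complex mat \<Rightarrow> nat set list) \<Rightarrow> bool" where
  "cycle_enumeration k n cs \<longleftrightarrow>
     (\<forall>\<sigma>\<in>wreath k n. distinct (cs \<sigma>) \<and> set (cs \<sigma>) = cycles_of \<sigma>)"

section \<open>Partitions, border strips and the wreath Murnaghan--Nakayama rule\<close>

definition is_partition :: "nat list \<Rightarrow> bool" where
  "is_partition l \<longleftrightarrow> sorted_wrt (\<ge>) l \<and> 0 \<notin> set l"

definition is_multipartition :: "nat \<Rightarrow> nat \<Rightarrow> nat list list \<Rightarrow> bool" where
  "is_multipartition k n \<gamma> \<longleftrightarrow>
     length \<gamma> = k \<and> (\<forall>l\<in>set \<gamma>. is_partition l) \<and> (\<Sum>l\<leftarrow>\<gamma>. sum_list l) = n"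

text \<open>Cells are pairs (row, column); in the French convention row 0 is the bottom row.\<close>

definition diagram :: "nat list \<Rightarrow> (nat \<times> nat) set" where
  "diagram l = {(r, c). r < length l \<and> c < l ! r}"

definition adjacent :: "nat \<times> nat \<Rightarrow> nat \<times> nat \<Rightarrow> bool" where
  "adjacent x y \<longleftrightarrow>
     (fst x = fst y \<and> (snd y = Suc (snd x) \<or> snd x = Suc (snd y))) \<or>
     (snd x = snd y \<and> (fst y = Suc (fst x) \<or> fst x = Suc (fst y)))"

definition connected_cells :: "(nat \<times> nat) set \<Rightarrow> bool" where
  "connected_cells S \<longleftrightarrow> S \<noteq> {} \<and>
     (\<forall>x\<in>S. \<forall>y\<in>S. (x, y) \<in> {(a, b). a \<in> S \<and> b \<in> S \<and> adjacent a b}\<^sup>*)"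

definition border_strip :: "nat list \<Rightarrow> nat list \<Rightarrow> (nat \<times> nat) set \<Rightarrow> bool" where
  "border_strip l m z \<longleftrightarrow>
     is_partition m \<and> diagram m \<subseteq> diagram l \<and> z = diagram l - diagram m \<and>
     connected_cells z \<and>
     (\<nexists>r c. {(r, c), (Suc r, c), (r, Suc c), (Suc r, Suc c)} \<subseteq> z)"

definition ht :: "(nat \<times> nat) set \<Rightarrow> nat" where
  "ht z = card (fst ` z) - 1"

text \<open>All sequences \<open>(j\<^sub>1, \<zeta>\<^sub>1), \<dots>, (j\<^sub>l, \<zeta>\<^sub>l)\<close> of removals of border strips of the prescribed
  sizes that empty the multipartition.\<close>

fun removal_seqs :: "nat list list \<Rightarrow> nat list \<Rightarrow> (nat \<times> (nat \<times> nat) set) list set" where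
  "removal_seqs \<gamma> [] = (if \<forall>l\<in>set \<gamma>. l = [] then {[]} else {})"
| "removal_seqs \<gamma> (a # as) =
     {(j, z) # zs | j z zs. \<exists>m. j < length \<gamma> \<and> border_strip (\<gamma> ! j) m z \<and> card z = a \<and>
        zs \<in> removal_seqs (\<gamma>[j := m]) as}"

definition wreath_char ::
  "(complex mat \<Rightarrow> nat set list) \<Rightarrow> nat list list \<Rightarrow> complex mat \<Rightarrow> complex" where
  "wreath_char cs \<gamma> \<sigma> =
     (\<Sum>zs\<in>removal_seqs \<gamma> (map card (cs \<sigma>)).
        \<Prod>s<length (cs \<sigma>). C_type \<sigma> (cs \<sigma> ! s) ^ fst (zs ! s) * (-1) ^ ht (snd (zs ! s)))"

section \<open>Class functions with values in a complex algebra\<close>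

text \<open>The target ring \<open>R\<close> is a commutative algebra over the complex numbers via \<open>\<iota>\<close>. Since a color
  rule may have infinitely many colors, \<open>R\<close> carries a topology in which such sums are taken
  (e.g. coefficientwise for formal series); only addition and multiplication by scalars, not
  multiplication of \<open>R\<close> itself, need to be continuous.\<close>

definition complex_algebra ::
  "(complex \<Rightarrow> 'r::{comm_ring_1, topological_ab_group_add, t2_space}) \<Rightarrow> bool" where
  "complex_algebra \<iota> \<longleftrightarrow>
     \<iota> 1 = 1 \<and> (\<forall>a b. \<iota> (a + b) = \<iota> a + \<iota> b) \<and> (\<forall>a b. \<iota> (a * b) = \<iota> a * \<iota> b) \<and>
     (\<forall>a. continuous_on UNIV (\<lambda>x. \<iota> a * x))"

definition class_function :: "nat \<Rightarrow> nat \<Rightarrow> (complex mat \<Rightarrow> 'r) \<Rightarrow> bool" where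
  "class_function k n \<chi> \<longleftrightarrow>
     (\<forall>\<sigma>\<in>wreath k n. \<forall>\<tau>\<in>wreath k n. \<forall>\<tau>'\<in>wreath k n.
        \<tau> * \<tau>' = 1\<^sub>m n \<longrightarrow> \<chi> (\<tau> * \<sigma> * \<tau>') = \<chi> \<sigma>)"

definition char_inner ::
  "nat \<Rightarrow> nat \<Rightarrow> (complex \<Rightarrow> 'r::comm_ring_1) \<Rightarrow>
     (complex mat \<Rightarrow> 'r) \<Rightarrow> (complex mat \<Rightarrow> complex) \<Rightarrow> 'r" where
  "char_inner k n \<iota> \<chi> \<psi> =
     \<iota> (1 / (fact n * of_nat k ^ n)) * (\<Sum>\<sigma>\<in>wreath k n. \<chi> \<sigma> * \<iota> (cnj (\<psi> \<sigma>)))"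

section \<open>Color rules\<close>

text \<open>A color rule is given by its multiplicity function \<open>F\<close>; the colors are those of nonzero
  multiplicity. Infinitely many colors and infinite multiplicities are allowed.\<close>

definition contained_in :: "'c multiset \<Rightarrow> ('c \<Rightarrow> enat) \<Rightarrow> bool" where
  "contained_in M F \<longleftrightarrow> (\<forall>c. enat (count M c) \<le> F c)"

definition colorings :: "nat \<Rightarrow> ('c \<Rightarrow> enat) \<Rightarrow> complex mat \<Rightarrow> 'c list set" where
  "colorings n F \<sigma> = {f. length f = n \<and> contained_in (mset f) F \<and>
     (\<forall>c\<in>cycles_of \<sigma>. \<forall>i\<in>c. \<forall>j\<in>c. f ! i = f ! j)}"

definition given_by_color_rule ::
  "nat \<Rightarrow> nat \<Rightarrow> (complex \<Rightarrow> 'r::{comm_ring_1, topological_ab_group_add, t2_space}) \<Rightarrow>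
     ('c \<Rightarrow> enat) \<Rightarrow> ('c \<Rightarrow> int) \<Rightarrow> ('c \<Rightarrow> 'r) \<Rightarrow> (complex mat \<Rightarrow> 'r) \<Rightarrow> bool" where
  "given_by_color_rule k n \<iota> F p \<rho> \<chi> \<longleftrightarrow>
     (\<forall>\<sigma>\<in>wreath k n.
        ((\<lambda>f. \<Prod>i<n. \<iota> (entry_of \<sigma> i powi p (f ! i)) * \<rho> (f ! i)) has_sum \<chi> \<sigma>)
          (colorings n F \<sigma>))"

section \<open>Semistandard tableaux\<close>

definition residue_colors :: "nat \<Rightarrow> ('c \<Rightarrow> enat) \<Rightarrow> ('c \<Rightarrow> int) \<Rightarrow> nat \<Rightarrow> 'c \<Rightarrow> enat" where
  "residue_colors k F p r c = (if p c mod int k = int r then F c else 0)"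

text \<open>A filling is the list of its rows, read from bottom to top.\<close>

definition semistandard :: "nat list \<Rightarrow> 'c::linorder list list \<Rightarrow> bool" where
  "semistandard l T \<longleftrightarrow>
     map length T = l \<and> (\<forall>row\<in>set T. sorted row) \<and>
     (\<forall>r c. Suc r < length T \<and> c < length (T ! Suc r) \<longrightarrow> T ! r ! c < T ! Suc r ! c)"

definition SSYT ::
  "nat \<Rightarrow> nat list list \<Rightarrow> ('c::linorder \<Rightarrow> enat) \<Rightarrow> ('c \<Rightarrow> int) \<Rightarrow> 'c list list list set" where
  "SSYT k \<gamma> F p = {T. length T = k \<and>
     (\<forall>r<k. semistandard (\<gamma> ! r) (T ! r) \<and>
            contained_in (mset (concat (T ! r))) (residue_colors k F p r))}"

definition tableau_weight :: "('c \<Rightarrow> 'r::comm_ring_1) \<Rightarrow> 'c list list list \<Rightarrow> 'r" where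
  "tableau_weight \<rho> T =
     (let w = concat (concat T) in \<Prod>f\<in>set w. \<rho> f ^ count (mset w) f)"

end

theory Submission
  imports Defs
begin

text \<open>
  Shift a partition \<open>\<nu>\<close> to the strictly decreasing sequence \<open>\<nu>\<^sub>i - 1 - i\<close>. For functionals that are
  alternating in this sequence, removing a border strip of size \<open>a\<close> with its sign is the same as
  lowering one entry by \<open>a\<close>, summed over all entries: illegal results vanish, and a legal one is
  sorted by a cycle whose length is the height of the strip. Iterating gives Frobenius' formula:
  \<open>\<chi>\<^sup>\<gamma>(\<sigma>)\<close> is a sum over all labelings of the indices by pairs (component, row) that are constant on
  the cycles of \<open>\<sigma>\<close>, in particular independent of the order of the cycles. Hence both factors of the
  inner product are sums over colorings. Summing over the entries of \<open>\<sigma>\<close> matches the component of a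
  row with the residue of \<open>p\<close> at its color, and summing over the permutations counts every multiset
  of (color, row) pairs once. This remaining sum is evaluated color by color with the Pieri rule,
  whose horizontal strips build up the semistandard tableaux.

  For the infinite sums over colors the identity element gives summability over all words, and the
  two sides differ by finitely many scalar multiples whose sum over each class of rearrangements is 0.
\<close>

section \<open>Alternating functionals and the Pieri rule\<close>

text \<open>The argument never passes to polynomials. In the language of symmetric functions,
  lowering one entry by \<open>a\<close>, summed over the rows, is the adjoint of multiplication by
  a power sum, lowering the entries by \<open>m\<close> in total is the adjoint of multiplication by
  a complete homogeneous function, \<open>eps\<close> reads off the coefficient of the empty
  partition, and \<open>colored_sum\<close> is a product of Kostka numbers.

  All partitions are cut off at \<open>N\<close> rows. The empty partition then has the entries -1,
  ..., -N, and an entry below -N would mean a negative length in whichever of the \<open>N\<close>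
  rows it is sorted into. The second clause of \<open>alternating\<close> records this; it takes the
  place of the missing row \<open>N\<close> wherever a row is compared with the next one.

  The target ring carries neither a norm nor completeness, and only multiplication by a fixed scalar
  is assumed continuous, so a sum over words cannot be split into subsums. This is why tableaux are
  realised as words and compared with the colorings inside one family.\<close>

definition alternating :: "nat \<Rightarrow> ((nat \<Rightarrow> int) \<Rightarrow> complex) \<Rightarrow> bool" where
  "alternating N \<Phi> \<longleftrightarrow>
     (\<forall>v i j. i < N \<longrightarrow> j < N \<longrightarrow> i \<noteq> j \<longrightarrow> \<Phi> (v \<circ> transpose i j) = - \<Phi> v) \<and>
     (\<forall>v i. i < N \<longrightarrow> v i < - int N \<longrightarrow> \<Phi> v = 0)"

lemma alternating_transpose:
  "alternating N \<Phi> \<Longrightarrow> i < N \<Longrightarrow> j < N \<Longrightarrow> i \<noteq> j \<Longrightarrow> \<Phi> (v \<circ> transpose i j) = - \<Phi> v"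
  by (auto simp: alternating_def)

lemma alternating_low: "alternating N \<Phi> \<Longrightarrow> i < N \<Longrightarrow> v i < - int N \<Longrightarrow> \<Phi> v = 0"
  by (auto simp: alternating_def)

lemma alternating_eq:
  assumes "alternating N \<Phi>" "i < N" "j < N" "i \<noteq> j" "v i = v j"
  shows "\<Phi> v = 0"
proof -
  have "v \<circ> transpose i j = v"
    using assms(5) by (auto simp: fun_eq_iff transpose_def)
  then show ?thesis using alternating_transpose[OF assms(1-4), of v] by simp
qed

lemma alternating_sum:
  assumes "\<And>x. x \<in> X \<Longrightarrow> alternating N (\<Phi> x)"
  shows "alternating N (\<lambda>v. \<Sum>x\<in>X. \<Phi> x v)"
  using assms unfolding alternating_def
  by (auto simp: sum_negf[symmetric] intro!: sum.cong sum.neutral)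

lemma alternating_scale: "alternating N \<Phi> \<Longrightarrow> alternating N (\<lambda>v. c * \<Phi> v)"
  unfolding alternating_def by auto

text \<open>Since all rows are lowered in turn, a transposition of the entries merely renames the
  row being lowered; a row below the cutoff stays there.\<close>

lemma alternating_shift:
  assumes "alternating N \<Phi>"
  shows "alternating N (\<lambda>v. \<Sum>i<N. \<Phi> (v(i := v i - int a)))"
  unfolding alternating_def
proof (intro conjI allI impI)
  fix v :: "nat \<Rightarrow> int" and i j assume ij: "i < N" "j < N" "i \<noteq> j"
  let ?t = "transpose i j"
  have t: "?t permutes {..<N}" using ij by (intro permutes_swap_id) auto
  have "(\<Sum>x<N. \<Phi> ((v \<circ> ?t)(x := (v \<circ> ?t) x - int a)))
      = (\<Sum>x<N. \<Phi> (v(?t x := v (?t x) - int a) \<circ> ?t))"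
    by (intro sum.cong refl arg_cong[where f = \<Phi>]) (auto simp: fun_eq_iff transpose_eq_iff)
  also have "\<dots> = (\<Sum>x<N. - \<Phi> (v(?t x := v (?t x) - int a)))"
    using alternating_transpose[OF assms ij] by simp
  also have "\<dots> = (\<Sum>x<N. - \<Phi> (v(x := v x - int a)))"
    using sum.permute[OF t, of "\<lambda>x. - \<Phi> (v(x := v x - int a))"] by (simp add: o_def)
  finally show "(\<Sum>x<N. \<Phi> ((v \<circ> ?t)(x := (v \<circ> ?t) x - int a)))
      = - (\<Sum>x<N. \<Phi> (v(x := v x - int a)))"
    by (simp add: sum_negf)
next
  fix v :: "nat \<Rightarrow> int" and i assume i: "i < N" "v i < - int N"
  show "(\<Sum>x<N. \<Phi> (v(x := v x - int a))) = 0"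
    by (rule sum.neutral, rule ballI, rule alternating_low[OF assms i(1)]) (use i in auto)
qed

text \<open>The sign of the permutation that rearranges the entries of the empty partition into
  those of \<open>v\<close>, and 0 if there is none. The Leibniz form makes alternation a reindexing
  of the sum.\<close>

definition eps :: "nat \<Rightarrow> (nat \<Rightarrow> int) \<Rightarrow> complex" where
  "eps N v = (\<Sum>\<pi> | \<pi> permutes {..<N}.
     of_int (sign \<pi>) * (if \<forall>i<N. v i = - 1 - int (\<pi> i) then 1 else 0))"

lemma alternating_eps: "alternating N (eps N)"
  unfolding alternating_def
proof (intro conjI allI impI)
  fix v :: "nat \<Rightarrow> int" and i j assume ij: "i < N" "j < N" "i \<noteq> j"
  let ?t = "transpose i j"
  have t: "?t permutes {..<N}" using ij by (intro permutes_swap_id) auto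
  have iff: "(\<forall>x<N. v (?t x) = - 1 - int (\<pi> (?t x))) \<longleftrightarrow> (\<forall>x<N. v x = - 1 - int (\<pi> x))" for \<pi>
    using permutes_in_image[OF t] by (metis lessThan_iff transpose_involutory)
  have "eps N (v \<circ> ?t) = (\<Sum>\<pi> | \<pi> permutes {..<N}.
      of_int (sign (\<pi> \<circ> ?t)) * (if \<forall>x<N. v (?t x) = - 1 - int (\<pi> (?t x)) then 1 else 0))"
    unfolding eps_def
    by (rule sum.reindex_bij_witness[where i = "\<lambda>\<pi>. \<pi> \<circ> ?t" and j = "\<lambda>\<pi>. \<pi> \<circ> ?t"])
      (use permutes_compose[OF t] in \<open>auto simp: o_assoc[symmetric]\<close>)
  also have "\<dots> = (\<Sum>\<pi> | \<pi> permutes {..<N}.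
      - (of_int (sign \<pi>) * (if \<forall>x<N. v x = - 1 - int (\<pi> x) then 1 else 0)))"
    using ij(3) by (intro sum.cong refl)
      (auto simp: iff sign_compose sign_swap_id permutation_swap_id
        permutes_imp_permutation[OF finite_lessThan])
  finally show "eps N (v \<circ> ?t) = - eps N v" by (simp add: eps_def sum_negf)
next
  fix v :: "nat \<Rightarrow> int" and i assume i: "i < N" "v i < - int N"
  have "\<not> (\<forall>i<N. v i = - 1 - int (\<pi> i))" if "\<pi> permutes {..<N}" for \<pi>
    using i permutes_in_image[OF that, of i] by auto
  then show "eps N v = 0" unfolding eps_def by (intro sum.neutral ballI) auto
qed

section \<open>Shifted partitions and horizontal strips\<close>

definition shape :: "nat \<Rightarrow> (nat \<Rightarrow> nat) \<Rightarrow> bool" where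
  "shape N \<nu> \<longleftrightarrow> antimono \<nu> \<and> (\<forall>i\<ge>N. \<nu> i = 0)"

definition beta :: "(nat \<Rightarrow> nat) \<Rightarrow> nat \<Rightarrow> int" where
  "beta \<nu> i = int (\<nu> i) - 1 - int i"

lemma beta_strict: "antimono \<nu> \<Longrightarrow> i < j \<Longrightarrow> beta \<nu> j < beta \<nu> i"
  using antimonoD[of \<nu> i j] by (auto simp: beta_def)

lemma beta_inj: "beta \<nu> = beta \<mu> \<longleftrightarrow> \<nu> = \<mu>"
  by (auto simp: beta_def fun_eq_iff)

text \<open>A summand survives only if \<open>\<pi> i = i - \<nu> i\<close> in all rows, hence
  \<open>\<pi> i \<le> i\<close>, and the identity is the only such permutation of an initial
  segment.\<close>

lemma eps_beta:
  assumes "shape N \<nu>"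
  shows "eps N (beta \<nu>) = (if \<nu> = (\<lambda>_. 0) then 1 else 0)"
proof -
  have *: "(\<forall>i<N. beta \<nu> i = - 1 - int (\<pi> i)) \<longleftrightarrow> \<pi> = id \<and> \<nu> = (\<lambda>_. 0)"
    if \<pi>: "\<pi> permutes {..<N}" for \<pi>
  proof
    assume eq: "\<forall>i<N. beta \<nu> i = - 1 - int (\<pi> i)"
    have "\<pi> i \<le> i" if "i < N" for i using eq that by (auto simp: beta_def)
    then have "\<pi> = id" using permutes_natset_le[OF \<pi>] by auto
    moreover have "\<nu> i = 0" for i
      using eq \<open>\<pi> = id\<close> assms by (cases "i < N") (auto simp: beta_def shape_def)
    ultimately show "\<pi> = id \<and> \<nu> = (\<lambda>_. 0)" by auto
  qed (auto simp: beta_def)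
  have "eps N (beta \<nu>) = (\<Sum>\<pi> | \<pi> permutes {..<N}.
      if \<pi> = id then (if \<nu> = (\<lambda>_. 0) then 1 else 0) else 0)"
    unfolding eps_def by (intro sum.cong refl) (auto simp: * sign_id)
  also have "\<dots> = (if \<nu> = (\<lambda>_. 0) then 1 else 0)"
    by (subst sum.delta) (auto simp: finite_permutations permutes_id)
  finally show ?thesis .
qed

text \<open>The rows lose \<open>m\<close> cells in total in every conceivable way, even if the
  result is no partition. Under an alternating functional only the horizontal strips survive, which
  is \<open>pieri\<close>.\<close>

definition lower :: "nat \<Rightarrow> (nat \<Rightarrow> int) \<Rightarrow> nat \<Rightarrow> (nat \<Rightarrow> int) set" where
  "lower N v m =
     {w. (\<forall>i. w i \<le> v i) \<and> (\<forall>i\<ge>N. w i = v i) \<and> (\<Sum>i<N. v i) = int m + (\<Sum>i<N. w i)}"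

definition hstrips :: "nat \<Rightarrow> (nat \<Rightarrow> nat) \<Rightarrow> nat \<Rightarrow> (nat \<Rightarrow> nat) set" where
  "hstrips N \<nu> m =
     {\<mu>. (\<forall>i. \<nu> (Suc i) \<le> \<mu> i \<and> \<mu> i \<le> \<nu> i) \<and> (\<Sum>i<N. \<nu> i) = m + (\<Sum>i<N. \<mu> i)}"

lemma finite_lower: "finite (lower N v m)"
proof (rule finite_subset)
  show "lower N v m \<subseteq>
      (\<lambda>g i. if i < N then g i else v i) ` PiE {..<N} (\<lambda>i. {v i - int m..v i})"
  proof
    fix w assume w: "w \<in> lower N v m"
    have "v i - int m \<le> w i" if i: "i < N" for i
    proof -
      have "v i - w i \<le> (\<Sum>i<N. v i - w i)"
        using w i by (intro member_le_sum) (auto simp: lower_def)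
      also have "\<dots> = int m" using w by (simp add: lower_def sum_subtractf)
      finally show ?thesis by simp
    qed
    then have "restrict w {..<N} \<in> PiE {..<N} (\<lambda>i. {v i - int m..v i})"
      using w by (auto simp: lower_def)
    moreover have "w = (\<lambda>i. if i < N then restrict w {..<N} i else v i)"
      using w by (auto simp: lower_def fun_eq_iff)
    ultimately show "w \<in> (\<lambda>g i. if i < N then g i else v i) `
        PiE {..<N} (\<lambda>i. {v i - int m..v i})" by blast
  qed
qed (intro finite_imageI finite_PiE, auto)

text \<open>Swapping the entries at the first row where the horizontal strip condition fails cancels
  all terms outside the right-hand side.\<close>

lemma pieri:
  assumes alt: "alternating N \<Phi>" and \<nu>: "shape N \<nu>"
  shows "(\<Sum>w\<in>lower N (beta \<nu>) m. \<Phi> w) = (\<Sum>\<mu>\<in>hstrips N \<nu> m. \<Phi> (beta \<mu>))"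
proof -
  define v where "v = beta \<nu>"
  define L where "L = lower N v m"
  define bad where
    "bad i = {w \<in> L. w i \<le> v (Suc i) \<and> (\<forall>j<i. v (Suc j) < w j)}" for i
  define good where "good = {w \<in> L. \<forall>i<N. v (Suc i) < w i}"
  have anti: "antimono \<nu>" and zero: "\<And>i. i \<ge> N \<Longrightarrow> \<nu> i = 0" using \<nu> by (auto simp: shape_def)
  have fin: "finite L" by (simp add: L_def finite_lower)
  have v_Suc: "v (Suc i) < v i" for i using beta_strict[OF anti] by (simp add: v_def)
  have bad0: "(\<Sum>w\<in>bad i. \<Phi> w) = 0" if i: "i < N" for i
  proof (cases "Suc i < N")
    case False
    \<comment> \<open>Row \<open>N - 1\<close> has no next row to swap with. Here
      \<open>v (Suc i)\<close> equals \<open>- 1 - N\<close>, just below the cutoff, so the terms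
      vanish one by one.\<close>
    then have "v (Suc i) < - int N" using zero i by (auto simp: v_def beta_def)
    then show ?thesis
      by (intro sum.neutral ballI alternating_low[OF alt i]) (auto simp: bad_def)
  next
    case True
    let ?t = "transpose i (Suc i)"
    have t: "?t permutes {..<N}" using True by (intro permutes_swap_id) auto
    have mem: "w \<circ> ?t \<in> bad i" if w: "w \<in> bad i" for w
    proof -
      have wL: "\<And>x. w x \<le> v x" "\<And>x. x \<ge> N \<Longrightarrow> w x = v x" "(\<Sum>x<N. v x) = int m + (\<Sum>x<N. w x)"
        using w by (auto simp: bad_def L_def lower_def)
      have "(\<Sum>x<N. (w \<circ> ?t) x) = (\<Sum>x<N. w x)"
        using sum.permute[OF t, of w] by simp
      \<comment> \<open>Badness is what lets the swap respect the bounds: both \<open>w i\<close>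
        and \<open>w (Suc i)\<close> are at most \<open>v (Suc i)\<close>, the smaller of the two
        bounds.\<close>
      moreover have "(w \<circ> ?t) x \<le> v x" for x
        using wL(1)[of x] wL(1)[of "Suc i"] v_Suc[of i] w
        by (auto simp: transpose_def bad_def)
      moreover have "(w \<circ> ?t) x = v x" if "x \<ge> N" for x
        using wL(2)[OF that] that True by (auto simp: transpose_def)
      ultimately have "w \<circ> ?t \<in> L" using wL(3) by (auto simp: L_def lower_def)
      then show ?thesis using w wL(1)[of "Suc i"] by (auto simp: bad_def transpose_def)
    qed
    have "(\<Sum>w\<in>bad i. \<Phi> w) = (\<Sum>w\<in>bad i. \<Phi> (w \<circ> ?t))"
      by (rule sum.reindex_bij_witness[where i = "\<lambda>w. w \<circ> ?t" and j = "\<lambda>w. w \<circ> ?t"])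
        (use mem in \<open>auto simp: o_assoc[symmetric]\<close>)
    also have "\<dots> = - (\<Sum>w\<in>bad i. \<Phi> w)"
      using alternating_transpose[OF alt, of i "Suc i"] True by (simp add: sum_negf)
    finally show ?thesis by simp
  qed
  have "L = good \<union> (\<Union>i<N. bad i)"
  proof (intro equalityI subsetI)
    fix w assume w: "w \<in> L"
    show "w \<in> good \<union> (\<Union>i<N. bad i)"
    proof (cases "w \<in> good")
      case False
      then obtain i where i: "i < N" "w i \<le> v (Suc i)" using w by (auto simp: good_def not_less)
      let ?P = "\<lambda>i. i < N \<and> w i \<le> v (Suc i)"
      have P: "?P (LEAST i. ?P i)" using i by (intro LeastI[of ?P i]) auto
      moreover have "v (Suc j) < w j" if "j < (LEAST i. ?P i)" for j
        using not_less_Least[OF that] P that by auto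
      ultimately have "w \<in> bad (LEAST i. ?P i)" using w by (auto simp: bad_def)
      then show ?thesis using P by auto
    qed simp
  qed (auto simp: good_def bad_def)
  then have "sum \<Phi> L = sum \<Phi> (good \<union> (\<Union>i<N. bad i))" by simp
  also have "\<dots> = sum \<Phi> good + sum \<Phi> (\<Union>i<N. bad i)"
    using fin by (intro sum.union_disjoint) (auto simp: good_def bad_def not_le[symmetric])
  also have "sum \<Phi> (\<Union>i<N. bad i) = (\<Sum>i<N. sum \<Phi> (bad i))"
  proof (intro sum.UNION_disjoint ballI impI)
    fix i j :: nat assume "i \<noteq> j"
    then show "bad i \<inter> bad j = {}" by (cases i j rule: linorder_cases) (auto simp: bad_def not_le[symmetric])
  qed (use fin in \<open>auto simp: bad_def\<close>)
  also have "\<dots> = 0" using bad0 by simp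
  also have "sum \<Phi> good = (\<Sum>\<mu>\<in>hstrips N \<nu> m. \<Phi> (beta \<mu>))"
  proof (rule sum.reindex_bij_witness[where i = beta and j = "\<lambda>w i. nat (w i + 1 + int i)"])
    fix w assume w: "w \<in> good"
    \<comment> \<open>Neighbouring shifts differ by 1, so the strict \<open>v (Suc i) < w i\<close>
      becomes the weak interlacing of the row lengths.\<close>
    have pos: "w i + 1 + int i \<ge> int (\<nu> (Suc i))" for i
    proof (cases "i < N")
      case True
      then have "v (Suc i) < w i" using w by (simp add: good_def)
      then show ?thesis by (simp add: v_def beta_def)
    next
      case False
      then have "w i = v i" using w by (simp add: good_def L_def lower_def)
      then show ?thesis using zero[of i] zero[of "Suc i"] False by (simp add: v_def beta_def)
    qed
    then have pos': "w i + 1 + int i \<ge> 0" for i using order_trans[OF _ pos] by simp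
    show eq: "beta (\<lambda>i. nat (w i + 1 + int i)) = w"
      using pos' by (auto simp: fun_eq_iff beta_def)
    have "(\<Sum>i<N. int (\<nu> i) - 1 - int i) = int m + (\<Sum>i<N. w i)"
      using w by (auto simp: good_def L_def lower_def v_def beta_def)
    then have "int (\<Sum>i<N. \<nu> i) = int (m + (\<Sum>i<N. nat (w i + 1 + int i)))"
      using pos' by (simp add: sum.distrib sum_subtractf)
    then have "(\<Sum>i<N. \<nu> i) = m + (\<Sum>i<N. nat (w i + 1 + int i))"
      by (simp only: of_nat_eq_iff)
    moreover have "nat (w i + 1 + int i) \<le> \<nu> i" for i
      using w pos'[of i] by (auto simp: good_def L_def lower_def v_def beta_def nat_le_iff)
        (smt (verit, best))
    ultimately show "(\<lambda>i. nat (w i + 1 + int i)) \<in> hstrips N \<nu> m"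
      using pos unfolding hstrips_def by (auto simp: le_nat_iff pos')
    show "\<Phi> (beta (\<lambda>i. nat (w i + 1 + int i))) = \<Phi> w" by (simp only: eq)
  next
    fix \<mu> assume \<mu>: "\<mu> \<in> hstrips N \<nu> m"
    have "\<mu> i = \<nu> i" if "i \<ge> N" for i
      using \<mu> zero[OF that] by (auto simp: hstrips_def) (metis le_zero_eq)
    moreover have "(\<Sum>i<N. beta \<nu> i) = int m + (\<Sum>i<N. beta \<mu> i)"
      using \<mu> by (simp add: hstrips_def beta_def sum_subtractf flip: of_nat_sum)
    ultimately show "beta \<mu> \<in> good"
      using \<mu> by (auto simp: good_def L_def lower_def hstrips_def v_def beta_def)
        (smt (verit, best) of_nat_mono)
  qed (auto simp: beta_def)
  finally show ?thesis by (simp add: L_def v_def)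
qed

section \<open>Border strips and the Murnaghan--Nakayama rule\<close>

text \<open>The strip occupies the rows \<open>p\<close> to \<open>q\<close>; connectedness and the absence of squares force each of
  them but row \<open>q\<close> to overlap the next one in exactly one column.\<close>

definition strip :: "(nat \<Rightarrow> nat) \<Rightarrow> (nat \<Rightarrow> nat) \<Rightarrow> nat \<Rightarrow> nat \<Rightarrow> bool" where
  "strip \<nu> \<mu> p q \<longleftrightarrow> p \<le> q \<and> (\<forall>i. i < p \<or> q < i \<longrightarrow> \<mu> i = \<nu> i) \<and>
     (\<forall>i. p \<le> i \<and> i < q \<longrightarrow> Suc (\<mu> i) = \<nu> (Suc i)) \<and> \<mu> q < \<nu> q \<and> \<nu> (Suc q) \<le> \<mu> q"

lemma strip_antimono:
  assumes "strip \<nu> \<mu> p q" "antimono \<nu>"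
  shows "antimono \<mu>"
proof (intro iffD2[OF antimono_iff_le_Suc] allI)
  fix i
  have s: "\<mu> i = \<nu> i" if "i < p \<or> q < i" for i using assms(1) that by (auto simp: strip_def)
  have t: "Suc (\<mu> i) = \<nu> (Suc i)" if "p \<le> i" "i < q" for i using assms(1) that by (auto simp: strip_def)
  have u: "\<mu> q < \<nu> q" "\<nu> (Suc q) \<le> \<mu> q" "p \<le> q" using assms(1) by (auto simp: strip_def)
  have a: "\<nu> (Suc i) \<le> \<nu> i" for i using assms(2) by (auto simp: antimono_iff_le_Suc)
  consider "q < i" | "i = q" | "p \<le> i" "i < q" "Suc i = q" | "p \<le> i" "Suc i < q"
    | "i < p" "Suc i < p" | "i < p" "Suc i = p" "p = q" | "i < p" "Suc i = p" "p < q"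
    using u(3) by linarith
  then show "\<mu> (Suc i) \<le> \<mu> i"
  proof cases
    case 3
    then show ?thesis using t[of i] u(1) by simp
  next
    case 4
    then show ?thesis using t[of i] t[of "Suc i"] a[of "Suc i"] by simp
  next
    case 6
    then show ?thesis using s[of i] u(1) a[of i] by simp
  next
    case 7
    then show ?thesis using s[of i] t[of "Suc i"] a[of i] a[of "Suc i"] by simp
  qed (use s[of i] s[of "Suc i"] u a[of i] in auto)
qed

lemma strip_row:
  assumes "strip \<nu> \<mu> p q" "antimono \<nu>"
  shows "\<mu> i < \<nu> i \<longleftrightarrow> p \<le> i \<and> i \<le> q"
proof -
  have le: "\<nu> (Suc i) \<le> \<nu> i" using assms(2) by (auto simp: antimono_iff_le_Suc)
  have pq: "p \<le> q" using assms(1) by (simp add: strip_def)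
  consider "i < p \<or> q < i" | "p \<le> i" "i < q" | "i = q" by linarith
  then show ?thesis
  proof cases
    case 2
    then have "Suc (\<mu> i) = \<nu> (Suc i)" using assms(1) by (auto simp: strip_def)
    then show ?thesis using le 2 by simp
  qed (use assms(1) pq in \<open>auto simp: strip_def\<close>)
qed

lemma strip_le:
  assumes "strip \<nu> \<mu> p q" "antimono \<nu>"
  shows "\<mu> i \<le> \<nu> i"
proof (cases "p \<le> i \<and> i \<le> q")
  case True
  then show ?thesis using strip_row[OF assms, of i] by simp
next
  case False
  then show ?thesis using assms(1) by (auto simp: strip_def)
qed

text \<open>The new entry falls strictly between the old entries of rows \<open>Suc q\<close> and
  \<open>q\<close>; hence its value determines \<open>q\<close>.\<close>

lemma strip_beta_bounds:
  assumes "strip \<nu> \<mu> p q"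
  shows "beta \<nu> (Suc q) < beta \<mu> q" "beta \<mu> q < beta \<nu> q"
  using assms by (auto simp: strip_def beta_def)

text \<open>Moving entry \<open>p\<close> behind row \<open>q\<close> takes \<open>q - p\<close>
  adjacent transpositions, one per step of the induction on \<open>q\<close>.\<close>

lemma alternating_cycle:
  assumes "alternating N \<Phi>" "p \<le> q" "q < N"
  shows "\<Phi> (\<lambda>i. if p \<le> i \<and> i < q then v (Suc i) else if i = q then v p else v i)
    = (-1) ^ (q - p) * \<Phi> v"
  using assms(2,3)
proof (induction q rule: dec_induct)
  case base
  have "(\<lambda>i. if p \<le> i \<and> i < p then v (Suc i) else if i = p then v p else v i) = v" by auto
  then show ?case by simp
next
  case (step q)
  let ?c = "\<lambda>q i. if p \<le> i \<and> i < q then v (Suc i) else if i = q then v p else v i"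
  have "?c (Suc q) = ?c q \<circ> transpose q (Suc q)"
    using step.hyps by (auto simp: fun_eq_iff transpose_def)
  then have "\<Phi> (?c (Suc q)) = - \<Phi> (?c q)"
    using alternating_transpose[OF assms(1), of q "Suc q"] step.prems by simp
  then show ?case using step by (simp add: Suc_diff_le)
qed

text \<open>\<open>Suc (\<mu> i) = \<nu> (Suc i)\<close> says that the shifted entry of row
  \<open>i\<close> after the removal is the old one of row \<open>Suc i\<close>. So only the entry
  of row \<open>p\<close> is lost, the new one enters at row \<open>q\<close>, and the sorting is
  the cycle of \<open>alternating_cycle\<close>.\<close>

lemma alternating_strip:
  assumes "alternating N \<Phi>" "strip \<nu> \<mu> p q" "q < N"
  shows "\<Phi> ((beta \<nu>)(p := beta \<mu> q)) = (-1) ^ (q - p) * \<Phi> (beta \<mu>)"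
proof -
  let ?v = "(beta \<nu>)(p := beta \<mu> q)"
  have pq: "p \<le> q" using assms(2) by (simp add: strip_def)
  have "(\<lambda>i. if p \<le> i \<and> i < q then ?v (Suc i) else if i = q then ?v p else ?v i) = beta \<mu>"
  proof
    fix i
    consider "i < p \<or> q < i" | "p \<le> i" "i < q" | "i = q" by linarith
    then show "(if p \<le> i \<and> i < q then ?v (Suc i) else if i = q then ?v p else ?v i) = beta \<mu> i"
    proof cases
      case 1
      then show ?thesis using assms(2) pq by (auto simp: strip_def beta_def)
    next
      case 2
      then have "Suc (\<mu> i) = \<nu> (Suc i)" using assms(2) by (auto simp: strip_def)
      then have "int (\<nu> (Suc i)) = 1 + int (\<mu> i)" by simp
      then show ?thesis using 2 by (auto simp: beta_def)
    qed (use pq in auto)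
  qed
  then have "\<Phi> (beta \<mu>) = (-1) ^ (q - p) * \<Phi> ?v"
    using alternating_cycle[OF assms(1) pq assms(3), of ?v] by simp
  then show ?thesis by (simp flip: power_mult_distrib mult.assoc)
qed

text \<open>The number of removed cells telescopes to \<open>beta \<nu> p - beta \<mu> q\<close>, as
  \<open>strip_card\<close> shows, so the size condition can be stated without cells.\<close>

definition strips :: "nat \<Rightarrow> (nat \<Rightarrow> nat) \<Rightarrow> nat \<Rightarrow> ((nat \<Rightarrow> nat) \<times> nat \<times> nat) set" where
  "strips N \<nu> a = {(\<mu>, p, q). strip \<nu> \<mu> p q \<and> q < N \<and> beta \<nu> p - beta \<mu> q = int a}"

text \<open>The first row \<open>p\<close> and the size fix the new entry, the gap that contains it
  fixes \<open>q\<close>, and then every row of \<open>\<mu>\<close> is forced.\<close>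

lemma inj_on_strips:
  assumes "antimono \<nu>"
  shows "inj_on (\<lambda>(\<mu>, p, q). p) (strips N \<nu> a)"
proof -
  have le: "q' \<le> q" if "strip \<nu> \<mu> p q" "strip \<nu> \<mu>' p q'" "beta \<mu> q = beta \<mu>' q'" for \<mu> \<mu>' p q q'
  proof (rule ccontr)
    assume "\<not> q' \<le> q"
    then have "beta \<nu> q' \<le> beta \<nu> (Suc q)"
      using beta_strict[OF assms, of "Suc q" q'] by (cases "q' = Suc q") auto
    then show False
      using strip_beta_bounds[OF that(1)] strip_beta_bounds[OF that(2)] that(3) by simp
  qed
  show ?thesis
  proof (rule inj_onI, clarsimp simp: strips_def)
    fix \<mu> \<mu>' p q q'
    assume s: "strip \<nu> \<mu> p q" "strip \<nu> \<mu>' p q'"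
      and b: "beta \<nu> p - beta \<mu> q = int a" "beta \<nu> p - beta \<mu>' q' = int a"
    then have bb: "beta \<mu> q = beta \<mu>' q'" by simp
    then have q: "q = q'" using le[OF s] le[OF s(2,1)] by simp
    have "\<mu> i = \<mu>' i" for i
    proof -
      consider "i < p \<or> q < i" | "p \<le> i" "i < q" | "i = q" by linarith
      then show ?thesis
      proof cases
        case 2
        then have "Suc (\<mu> i) = Suc (\<mu>' i)" using s q by (auto simp: strip_def)
        then show ?thesis by simp
      qed (use s q bb in \<open>auto simp: strip_def beta_def\<close>)
    qed
    with q show "\<mu> = \<mu>' \<and> q = q'" by auto
  qed
qed

lemma finite_strips:
  assumes "antimono \<nu>"
  shows "finite (strips N \<nu> a)"
proof (rule finite_imageD[OF _ inj_on_strips[OF assms]])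
  have "(\<lambda>(\<mu>, p, q). p) ` strips N \<nu> a \<subseteq> {..<N}"
    by (auto simp: strips_def strip_def)
  then show "finite ((\<lambda>(\<mu>, p, q). p) ` strips N \<nu> a)" by (rule finite_subset) simp
qed

text \<open>Take for \<open>q\<close> the last row whose entry exceeds the target \<open>b\<close>.
  By \<open>free\<close> the target is not yet an entry, so it lies strictly in the gap after row
  \<open>q\<close> and has its place in the sorted sequence.\<close>

lemma ex_strip:
  assumes \<nu>: "shape N \<nu>" and "p < N" "a > 0" and b: "- int N \<le> beta \<nu> p - int a"
    and free: "\<And>j. j < N \<Longrightarrow> beta \<nu> j \<noteq> beta \<nu> p - int a"
  shows "\<exists>\<mu> q. (\<mu>, p, q) \<in> strips N \<nu> a"
proof -
  define b where "b = beta \<nu> p - int a"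
  have anti: "antimono \<nu>" and zero: "\<And>i. i \<ge> N \<Longrightarrow> \<nu> i = 0" using \<nu> by (auto simp: shape_def)
  \<comment> \<open>\<open>beta \<nu> N = - 1 - N\<close> is below the target, so a least row not
    exceeding \<open>b\<close> exists. It is not row 0, whose entry is at least
    \<open>beta \<nu> p\<close>.\<close>
  have "\<not> beta \<nu> N > b" using b zero by (simp add: b_def beta_def)
  then obtain q where q: "\<not> beta \<nu> (Suc q) > b" "\<forall>i\<le>q. beta \<nu> i > b" "Suc q \<le> N"
  proof -
    define s where "s = (LEAST i. \<not> beta \<nu> i > b)"
    have s: "\<not> beta \<nu> s > b" "s \<le> N" using \<open>\<not> beta \<nu> N > b\<close>
      unfolding s_def by (rule LeastI) (rule Least_le, fact)
    have lt: "beta \<nu> i > b" if "i < s" for i using not_less_Least that unfolding s_def by blast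
    have "beta \<nu> 0 > b" using beta_strict[OF anti, of 0 p] \<open>a > 0\<close> by (cases "p = 0") (auto simp: b_def)
    then obtain q where "s = Suc q" using s(1) by (cases s) auto
    then show thesis using s lt that by (auto simp: less_Suc_eq_le)
  qed
  have lt: "beta \<nu> (Suc q) < b"
  proof (cases "Suc q < N")
    case True
    then show ?thesis using q(1) free[of "Suc q"] by (auto simp: b_def)
  next
    case False
    then have "Suc q = N" using q by simp
    then show ?thesis using zero b by (simp add: beta_def b_def)
  qed
  have "p \<le> q"
  proof (rule ccontr)
    assume "\<not> p \<le> q"
    then have "beta \<nu> p \<le> beta \<nu> (Suc q)"
      using beta_strict[OF anti, of "Suc q" p] by (cases "p = Suc q") auto
    then show False using lt \<open>a > 0\<close> by (simp add: b_def)
  qed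
  \<comment> \<open>Rows \<open>p\<close> to \<open>q - 1\<close> inherit the shifted entry of the
    next row, and row \<open>q\<close> gets the length whose shifted entry is
    \<open>b\<close>.\<close>
  define \<mu> where "\<mu> i = (if p \<le> i \<and> i < q then \<nu> (Suc i) - 1
      else if i = q then nat (b + 1 + int q) else \<nu> i)" for i
  have bq: "b + 1 + int q \<ge> int (\<nu> (Suc q))" using lt by (simp add: beta_def)
  \<comment> \<open>Guards the truncated subtraction in \<open>\<mu>\<close>.\<close>
  have pos: "\<nu> (Suc i) > 0" if "i < q" for i
  proof -
    have "\<nu> q \<le> \<nu> (Suc i)" using anti that by (simp add: antimonoD)
    moreover have "\<nu> q > 0" using q(2) bq by (auto simp: beta_def dest!: spec[of _ q])
    ultimately show ?thesis by simp
  qed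
  have "beta \<mu> q = b" using bq by (simp add: \<mu>_def beta_def)
  moreover have "strip \<nu> \<mu> p q"
    using \<open>p \<le> q\<close> pos bq q(2) unfolding strip_def
    by (auto simp: \<mu>_def beta_def nat_less_iff le_nat_iff dest!: spec[of _ q])
  ultimately have "(\<mu>, p, q) \<in> strips N \<nu> a" using q(3) by (simp add: strips_def b_def)
  then show ?thesis by blast
qed

lemma murnaghan_nakayama_strips:
  assumes alt: "alternating N \<Phi>" and \<nu>: "shape N \<nu>" and a: "a > 0"
  shows "(\<Sum>i<N. \<Phi> ((beta \<nu>)(i := beta \<nu> i - int a)))
    = (\<Sum>(\<mu>, p, q)\<in>strips N \<nu> a. (-1) ^ (q - p) * \<Phi> (beta \<mu>))"
proof -
  let ?f = "\<lambda>p. \<Phi> ((beta \<nu>)(p := beta \<nu> p - int a))"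
  have anti: "antimono \<nu>" using \<nu> by (simp add: shape_def)
  \<comment> \<open>If no strip starts in row \<open>p\<close>, the lowered entry either passes the
    cutoff or collides with the entry of another row.\<close>
  have "?f p = 0" if p: "p < N" "p \<notin> (\<lambda>(\<mu>, p, q). p) ` strips N \<nu> a" for p
  proof (cases "- int N \<le> beta \<nu> p - int a")
    case False
    then show ?thesis by (intro alternating_low[OF alt p(1)]) simp
  next
    case True
    then obtain j where j: "j < N" "beta \<nu> j = beta \<nu> p - int a"
      using ex_strip[OF \<nu> p(1) a] p(2) by force
    then have "j \<noteq> p" using a by auto
    then show ?thesis using j p by (intro alternating_eq[OF alt, of j p]) auto
  qed
  then have "(\<Sum>i<N. ?f i) = (\<Sum>p\<in>(\<lambda>(\<mu>, p, q). p) ` strips N \<nu> a. ?f p)"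
    by (intro sum.mono_neutral_right) (auto simp: strips_def strip_def)
  also have "\<dots> = (\<Sum>x\<in>strips N \<nu> a. ?f (case x of (\<mu>, p, q) \<Rightarrow> p))"
    by (simp add: sum.reindex[OF inj_on_strips[OF anti]])
  also have "\<dots> = (\<Sum>(\<mu>, p, q)\<in>strips N \<nu> a. (-1) ^ (q - p) * \<Phi> (beta \<mu>))"
  proof (intro sum.cong refl, clarify)
    fix \<mu> p q assume s: "(\<mu>, p, q) \<in> strips N \<nu> a"
    then have "beta \<nu> p - int a = beta \<mu> q" by (auto simp: strips_def)
    then show "?f p = (-1) ^ (q - p) * \<Phi> (beta \<mu>)"
      using alternating_strip[OF alt] s by (simp add: strips_def)
  qed
  finally show ?thesis .
qed

section \<open>Border strips as sets of cells\<close>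

definition part :: "nat list \<Rightarrow> nat \<Rightarrow> nat" where
  "part l i = (if i < length l then l ! i else 0)"

lemma part_pos: "is_partition l \<Longrightarrow> part l i > 0 \<longleftrightarrow> i < length l"
  unfolding is_partition_def part_def by (metis bot_nat_0.not_eq_extremum nth_mem)

lemma part_antimono:
  assumes "is_partition l"
  shows "antimono (part l)"
proof (rule antimonoI)
  fix i j :: nat assume "i \<le> j"
  then show "part l j \<le> part l i"
    using assms sorted_wrt_nth_less[of "(\<ge>)" l i j]
    by (cases "i = j") (auto simp: part_def is_partition_def)
qed

lemma shape_part: "is_partition l \<Longrightarrow> length l \<le> N \<Longrightarrow> shape N (part l)"
  using part_antimono by (auto simp: shape_def part_def)

lemma part_inject:
  assumes "is_partition l" "is_partition m" "part l = part m"
  shows "l = m"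
proof (rule nth_equalityI)
  have "i < length l \<longleftrightarrow> i < length m" for i
    using part_pos[OF assms(1), of i] part_pos[OF assms(2), of i] assms(3) by simp
  then show len: "length l = length m" by (metis nat_neq_iff)
  show "l ! i = m ! i" if "i < length l" for i
    using fun_cong[OF assms(3), of i] that len by (simp add: part_def)
qed

lemma ex_part:
  assumes "shape N \<mu>"
  obtains m where "is_partition m" "part m = \<mu>" "length m \<le> N"
proof -
  define L where "L = (LEAST i. \<mu> i = 0)"
  have anti: "antimono \<mu>" and N: "\<mu> N = 0" using assms by (auto simp: shape_def)
  have L: "\<mu> L = 0" "L \<le> N"
    unfolding L_def using N by (auto intro: LeastI[of "\<lambda>i. \<mu> i = 0"] Least_le)
  have pos: "\<mu> i > 0" if "i < L" for i using not_less_Least that unfolding L_def by blast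
  have zero: "\<mu> i = 0" if "i \<ge> L" for i using antimonoD[OF anti that] L by simp
  show thesis
  proof
    show "is_partition (map \<mu> [0..<L])"
      using pos anti
      by (force simp: is_partition_def sorted_wrt_iff_nth_less intro: antimonoD)
    show "part (map \<mu> [0..<L]) = \<mu>" using zero by (auto simp: part_def fun_eq_iff)
  qed (use L in simp)
qed

lemma diagram_part: "diagram l = {(r, c). c < part l r}"
  by (auto simp: diagram_def part_def split: if_splits)

text \<open>A discrete intermediate value argument: a path that starts in a row up to
  \<open>i\<close> and ends beyond it must cross from row \<open>i\<close> to row
  \<open>Suc i\<close>, and the crossing step keeps its column.\<close>

lemma connected_cells_step:
  assumes "connected_cells z" "x \<in> z" "y \<in> z" "fst x \<le> i" "i < fst y"
  shows "\<exists>c. (i, c) \<in> z \<and> (Suc i, c) \<in> z"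
proof -
  let ?R = "{(a, b). a \<in> z \<and> b \<in> z \<and> adjacent a b}"
  have "(x, y) \<in> ?R\<^sup>*" using assms by (auto simp: connected_cells_def)
  then show ?thesis using assms(5)
  proof (induction rule: rtrancl_induct)
    case base
    then show ?case using assms(4) by simp
  next
    case (step a b)
    show ?case
    proof (cases "i < fst a")
      case False
      with step have "adjacent a b" "a \<in> z" "b \<in> z" "fst a \<le> i" "i < fst b" by auto
      then have "fst a = i" "fst b = Suc i" "snd b = snd a" by (auto simp: adjacent_def)
      then have "(i, snd a) \<in> z" "(Suc i, snd a) \<in> z"
        using \<open>a \<in> z\<close> \<open>b \<in> z\<close> by (metis prod.collapse)+
      then show ?thesis by blast
    qed (use step in auto)
  qed
qed

text \<open>Rows \<open>p\<close> and \<open>q\<close> are the extreme rows of the strip. An overlap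
  of neighbouring rows in two columns would contain a square at column \<open>\<mu> i\<close>; an
  empty overlap would block every path from row \<open>p\<close> to row \<open>q\<close>.\<close>

lemma border_strip_imp_strip:
  assumes l: "is_partition l" and bs: "border_strip l m z"
  shows "\<exists>p q. strip (part l) (part m) p q"
proof -
  define \<nu> where "\<nu> = part l"
  define \<mu> where "\<mu> = part m"
  have m: "is_partition m" and sub: "diagram m \<subseteq> diagram l" and z: "z = diagram l - diagram m"
    and conn: "connected_cells z"
    and no: "\<nexists>r c. {(r, c), (Suc r, c), (r, Suc c), (Suc r, Suc c)} \<subseteq> z"
    using bs by (auto simp: border_strip_def)
  have anti\<nu>: "antimono \<nu>" and anti\<mu>: "antimono \<mu>"
    using part_antimono l m by (auto simp: \<nu>_def \<mu>_def)
  have le: "\<mu> i \<le> \<nu> i" for i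
  proof (rule ccontr)
    assume "\<not> \<mu> i \<le> \<nu> i"
    then have "(i, \<nu> i) \<in> diagram m" by (simp add: diagram_part \<mu>_def)
    then have "(i, \<nu> i) \<in> diagram l" using sub by blast
    then show False by (simp add: diagram_part \<nu>_def)
  qed
  have zmem: "(r, c) \<in> z \<longleftrightarrow> \<mu> r \<le> c \<and> c < \<nu> r" for r c
    by (auto simp: z diagram_part \<mu>_def \<nu>_def)
  have row: "i \<in> fst ` z \<longleftrightarrow> \<mu> i < \<nu> i" for i
    using zmem[of i "\<mu> i"] zmem by (force simp: image_iff)
  have a\<nu>: "\<nu> (Suc i) \<le> \<nu> i" and a\<mu>: "\<mu> (Suc i) \<le> \<mu> i" for i
    using anti\<nu> anti\<mu> by (auto simp: antimono_iff_le_Suc)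
  have le1: "\<nu> (Suc i) \<le> Suc (\<mu> i)" for i
  proof (rule ccontr)
    assume "\<not> \<nu> (Suc i) \<le> Suc (\<mu> i)"
    then have "{(i, \<mu> i), (Suc i, \<mu> i), (i, Suc (\<mu> i)), (Suc i, Suc (\<mu> i))} \<subseteq> z"
      using a\<nu>[of i] a\<mu>[of i] by (auto simp: zmem)
    with no show False by blast
  qed
  have ne: "z \<noteq> {}" using conn by (simp add: connected_cells_def)
  have "fst ` z \<subseteq> {..<length l}" by (auto simp: z diagram_def)
  then have fin: "finite (fst ` z)" by (rule finite_subset) simp
  define p where "p = Min (fst ` z)"
  define q where "q = Max (fst ` z)"
  have p: "p \<in> fst ` z" "\<And>i. \<mu> i < \<nu> i \<Longrightarrow> p \<le> i"
    using fin ne row by (auto simp: p_def intro!: Min_in Min_le)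
  have q: "q \<in> fst ` z" "\<And>i. \<mu> i < \<nu> i \<Longrightarrow> i \<le> q"
    using fin ne row by (auto simp: q_def intro!: Max_in Max_ge)
  have mid: "Suc (\<mu> i) = \<nu> (Suc i)" if "p \<le> i" "i < q" for i
  proof -
    obtain x y where "x \<in> z" "y \<in> z" "fst x = p" "fst y = q" using p(1) q(1) by auto
    then obtain c where "(i, c) \<in> z" "(Suc i, c) \<in> z"
      using connected_cells_step[OF conn, of x y i] \<open>p \<le> i\<close> \<open>i < q\<close> by auto
    then show ?thesis using le1[of i] by (auto simp: zmem)
  qed
  have "strip \<nu> \<mu> p q"
    unfolding strip_def
  proof (intro conjI allI impI)
    show "p \<le> q" using p q row by auto
    show "\<mu> q < \<nu> q" using q row by auto
    show "\<nu> (Suc q) \<le> \<mu> q"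
    proof (rule ccontr)
      assume "\<not> \<nu> (Suc q) \<le> \<mu> q"
      then have "\<mu> (Suc q) < \<nu> (Suc q)" using a\<mu>[of q] by simp
      then show False using q(2) by fastforce
    qed
    show "\<mu> i = \<nu> i" if "i < p \<or> q < i" for i
      using that p(2)[of i] q(2)[of i] le[of i] by fastforce
  qed (use mid in auto)
  then show ?thesis by (auto simp: \<nu>_def \<mu>_def)
qed

context
  fixes l m p q
  assumes l: "is_partition l" and m: "is_partition m" and strip: "strip (part l) (part m) p q"
begin

lemma strip_cells: "diagram l - diagram m = (SIGMA r:{p..q}. {part m r..<part l r})"
  using strip_row[OF strip part_antimono[OF l]] by (force simp: diagram_part)

lemma strip_rows: "fst ` (diagram l - diagram m) = {p..q}"
proof -
  have "r \<in> fst ` (SIGMA r:{p..q}. {part m r..<part l r})" if "r \<in> {p..q}" for r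
    using strip_row[OF strip part_antimono[OF l], of r] that
    by (auto intro!: image_eqI[of _ _ "(r, part m r)"])
  then show ?thesis unfolding strip_cells by auto
qed

lemma strip_Min_Max:
  "Min (fst ` (diagram l - diagram m)) = p" "Max (fst ` (diagram l - diagram m)) = q"
  unfolding strip_rows using strip by (auto simp: strip_def intro!: Min_eqI Max_eqI)

lemma strip_ht: "ht (diagram l - diagram m) = q - p"
  unfolding ht_def strip_rows by simp

text \<open>For \<open>p \<le> r < q\<close> the new entry of row \<open>r\<close> is the old entry
  of row \<open>Suc r\<close>, so the sum of the row lengths telescopes up to the last row.\<close>

lemma strip_card: "int (card (diagram l - diagram m)) = beta (part l) p - beta (part m) q"
proof -
  have le: "part m r \<le> part l r" for r by (rule strip_le[OF strip part_antimono[OF l]])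
  have "card (diagram l - diagram m) = (\<Sum>r\<in>{p..q}. part l r - part m r)"
    unfolding strip_cells by (simp add: card_SigmaI)
  then have "int (card (diagram l - diagram m)) = (\<Sum>r\<in>{p..q}. beta (part l) r - beta (part m) r)"
    using le by (simp add: of_nat_diff beta_def)
  also have "{p..q} = insert q {p..<q}" using strip by (auto simp: strip_def)
  also have "(\<Sum>r\<in>insert q {p..<q}. beta (part l) r - beta (part m) r)
      = (beta (part l) q - beta (part m) q) + (\<Sum>r\<in>{p..<q}. beta (part l) r - beta (part m) r)"
    by simp
  also have "(\<Sum>r\<in>{p..<q}. beta (part l) r - beta (part m) r)
      = (\<Sum>r\<in>{p..<q}. beta (part l) r - beta (part l) (Suc r))"
  proof (intro sum.cong refl)
    fix r assume "r \<in> {p..<q}"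
    then have "Suc (part m r) = part l (Suc r)" using strip by (auto simp: strip_def)
    then have "int (part l (Suc r)) = 1 + int (part m r)" by simp
    then show "beta (part l) r - beta (part m) r = beta (part l) r - beta (part l) (Suc r)"
      by (simp add: beta_def)
  qed
  also have "\<dots> = beta (part l) p - beta (part l) q"
    using sum_Suc_diff'[of p q "\<lambda>i. - beta (part l) i"] strip by (simp add: strip_def)
  finally show ?thesis by simp
qed

text \<open>Every cell is joined to the first cell of row \<open>q\<close>: walk to the first cell
  of the row, then step to the next row, and repeat. The step lands on the last cell of the next
  row, since \<open>\<mu> r = \<nu> (Suc r) - 1\<close>.\<close>

lemma strip_imp_border_strip: "border_strip l m (diagram l - diagram m)"
proof -
  define \<nu> where "\<nu> = part l"
  define \<mu> where "\<mu> = part m"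
  define z where "z = diagram l - diagram m"
  let ?R = "{(a, b). a \<in> z \<and> b \<in> z \<and> adjacent a b}"
  note s = strip[folded \<nu>_def \<mu>_def]
  have anti: "antimono \<nu>" "antimono \<mu>" using part_antimono l m by (auto simp: \<nu>_def \<mu>_def)
  have zmem: "(r, c) \<in> z \<longleftrightarrow> \<mu> r \<le> c \<and> c < \<nu> r" for r c
    by (auto simp: z_def diagram_part \<mu>_def \<nu>_def)
  have rowconn: "((r, \<mu> r + d), (r, \<mu> r)) \<in> ?R\<^sup>*" if "(r, \<mu> r + d) \<in> z" for r d
    using that
  proof (induction d)
    case (Suc d)
    then have "((r, \<mu> r + Suc d), (r, \<mu> r + d)) \<in> ?R" by (auto simp: zmem adjacent_def)
    moreover have "((r, \<mu> r + d), (r, \<mu> r)) \<in> ?R\<^sup>*" using Suc by (auto simp: zmem)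
    ultimately show ?case by (rule converse_rtrancl_into_rtrancl)
  qed simp
  have rowconn': "((r, c), (r, \<mu> r)) \<in> ?R\<^sup>*" if "(r, c) \<in> z" for r c
    using rowconn[of r "c - \<mu> r"] that by (simp add: zmem)
  have start: "((r, \<mu> r), (q, \<mu> q)) \<in> ?R\<^sup>*" if "p \<le> r" "r \<le> q" for r
    using \<open>r \<le> q\<close> \<open>p \<le> r\<close>
  proof (induction r rule: inc_induct)
    case (step r)
    then have eq: "Suc (\<mu> r) = \<nu> (Suc r)" using s by (auto simp: strip_def)
    moreover have "\<nu> (Suc r) \<le> \<nu> r" "\<mu> (Suc r) \<le> \<mu> r"
      using anti by (auto simp: antimono_iff_le_Suc)
    ultimately have c: "(r, \<mu> r) \<in> z" "(Suc r, \<mu> r) \<in> z" by (auto simp: zmem)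
    then have "((r, \<mu> r), (Suc r, \<mu> r)) \<in> ?R" by (auto simp: adjacent_def)
    also have "((Suc r, \<mu> r), (Suc r, \<mu> (Suc r))) \<in> ?R\<^sup>*" by (rule rowconn'[OF c(2)])
    also have "((Suc r, \<mu> (Suc r)), (q, \<mu> q)) \<in> ?R\<^sup>*" using step by simp
    finally show ?case .
  qed simp
  have to_q: "(x, (q, \<mu> q)) \<in> ?R\<^sup>*" if "x \<in> z" for x
  proof (cases x)
    case (Pair r c)
    then have "\<mu> r < \<nu> r" using that zmem by auto
    then have "p \<le> r" "r \<le> q" using strip_row[OF s anti(1)] by auto
    then show ?thesis using rowconn'[of r c] start[of r] that Pair by (auto intro: rtrancl_trans)
  qed
  have "sym ?R" by (auto simp: sym_def adjacent_def)
  then have "sym (?R\<^sup>*)" by (rule sym_rtrancl)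
  then have "(x, y) \<in> ?R\<^sup>*" if "x \<in> z" "y \<in> z" for x y
    using to_q[OF that(1)] to_q[OF that(2)] by (meson rtrancl_trans symD)
  moreover have "(q, \<mu> q) \<in> z" using s by (auto simp: zmem strip_def)
  ultimately have "connected_cells z" by (auto simp: connected_cells_def)
  moreover have "\<nexists>r c. {(r, c), (Suc r, c), (r, Suc c), (Suc r, Suc c)} \<subseteq> z"
  proof
    assume "\<exists>r c. {(r, c), (Suc r, c), (r, Suc c), (Suc r, Suc c)} \<subseteq> z"
    then obtain r c where *: "\<mu> r \<le> c" "Suc c < \<nu> (Suc r)" "\<mu> r < \<nu> r" "\<mu> (Suc r) < \<nu> (Suc r)"
      by (auto simp: zmem)
    then have "p \<le> r" "r < q" using strip_row[OF s anti(1)] by (auto simp: Suc_le_eq)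
    then have "Suc (\<mu> r) = \<nu> (Suc r)" using s by (auto simp: strip_def)
    then show False using * by simp
  qed
  moreover have "diagram m \<subseteq> diagram l"
    using strip_le[OF s anti(1)] by (auto simp: diagram_part \<mu>_def \<nu>_def intro: less_le_trans)
  ultimately show ?thesis using m by (auto simp: border_strip_def z_def)
qed

end

definition strip_removals :: "nat list \<Rightarrow> nat \<Rightarrow> nat list set" where
  "strip_removals l a = {m. border_strip l m (diagram l - diagram m) \<and> card (diagram l - diagram m) = a}"

text \<open>Translates between removing cells, as in the definition of the character, and lowering
  an entry; the end rows of a strip are recovered as the extreme rows of its cells.\<close>

lemma strip_removals_bij:
  assumes l: "is_partition l" "length l \<le> N"
  shows "bij_betw (\<lambda>m. (part m, Min (fst ` (diagram l - diagram m)), Max (fst ` (diagram l - diagram m))))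
    (strip_removals l a) (strips N (part l) a)"
proof -
  let ?h = "\<lambda>m. (part m, Min (fst ` (diagram l - diagram m)), Max (fst ` (diagram l - diagram m)))"
  have h: "?h m = (part m, p, q)" if "is_partition m" "strip (part l) (part m) p q" for m p q
    using strip_Min_Max[OF l(1) that] by simp
  show ?thesis
  proof (intro bij_betw_imageI inj_onI equalityI subsetI)
    fix m m' assume "m \<in> strip_removals l a" "m' \<in> strip_removals l a" "?h m = ?h m'"
    then show "m = m'" by (intro part_inject) (auto simp: strip_removals_def border_strip_def)
  next
    fix x assume "x \<in> ?h ` strip_removals l a"
    then obtain m where m: "border_strip l m (diagram l - diagram m)"
        "card (diagram l - diagram m) = a" and x: "x = ?h m"
      by (auto simp: strip_removals_def)
    obtain p q where pq: "strip (part l) (part m) p q"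
      using border_strip_imp_strip[OF l(1) m(1)] by auto
    have mp: "is_partition m" using m(1) by (simp add: border_strip_def)
    have "part l q > 0" using pq by (auto simp: strip_def)
    then have "q < N" using part_pos[OF l(1)] l(2) by fastforce
    then show "x \<in> strips N (part l) a"
      using pq strip_card[OF l(1) mp pq] m(2) h[OF mp pq] by (simp add: x strips_def)
  next
    fix x assume "x \<in> strips N (part l) a"
    then obtain \<mu> p q where x: "x = (\<mu>, p, q)" and s: "strip (part l) \<mu> p q" "q < N"
        "beta (part l) p - beta \<mu> q = int a"
      by (auto simp: strips_def)
    have "shape N (part l)" using shape_part l by auto
    then have "shape N \<mu>"
      using strip_antimono[OF s(1)] s by (auto simp: shape_def strip_def)
    then obtain m where m: "is_partition m" "part m = \<mu>" by (rule ex_part)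
    then have s': "strip (part l) (part m) p q" using s by simp
    have "m \<in> strip_removals l a"
      using strip_imp_border_strip[OF l(1) m(1) s'] strip_card[OF l(1) m(1) s'] s(3) m(2)
      by (simp add: strip_removals_def)
    moreover have "x = ?h m" using h[OF m(1) s'] m(2) x by simp
    ultimately show "x \<in> ?h ` strip_removals l a" by blast
  qed
qed

lemma finite_strip_removals:
  assumes "is_partition l"
  shows "finite (strip_removals l a)"
  using bij_betw_finite[OF strip_removals_bij[OF assms order_refl]]
    finite_strips[OF part_antimono[OF assms]] by blast

lemma murnaghan_nakayama:
  assumes alt: "alternating N \<Phi>" and l: "is_partition l" "length l \<le> N" and a: "a > 0"
  shows "(\<Sum>i<N. \<Phi> ((beta (part l))(i := beta (part l) i - int a)))
    = (\<Sum>m\<in>strip_removals l a. (-1) ^ ht (diagram l - diagram m) * \<Phi> (beta (part m)))"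
proof -
  have "(\<Sum>(\<mu>, p, q)\<in>strips N (part l) a. (-1) ^ (q - p) * \<Phi> (beta \<mu>))
      = (\<Sum>m\<in>strip_removals l a. (-1) ^ ht (diagram l - diagram m) * \<Phi> (beta (part m)))"
    unfolding sum.reindex_bij_betw[OF strip_removals_bij[OF l], symmetric]
  proof (intro sum.cong refl)
    fix m assume "m \<in> strip_removals l a"
    then have m: "border_strip l m (diagram l - diagram m)" "is_partition m"
      by (auto simp: strip_removals_def border_strip_def)
    obtain p q where pq: "strip (part l) (part m) p q"
      using border_strip_imp_strip[OF l(1) m(1)] by auto
    then have "p \<le> q" by (simp add: strip_def)
    then show "(case (part m, Min (fst ` (diagram l - diagram m)), Max (fst ` (diagram l - diagram m))) of
        (\<mu>, p, q) \<Rightarrow> (-1) ^ (q - p) * \<Phi> (beta \<mu>))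
      = (-1) ^ ht (diagram l - diagram m) * \<Phi> (beta (part m))"
      using strip_Min_Max[OF l(1) m(2) pq] strip_ht[OF l(1) m(2) pq] by simp
  qed
  then show ?thesis
    using murnaghan_nakayama_strips[OF alt shape_part[OF l] a] by simp
qed

section \<open>Frobenius' formula\<close>

definition malternating :: "nat \<Rightarrow> nat \<Rightarrow> ((nat \<Rightarrow> nat \<Rightarrow> int) \<Rightarrow> complex) \<Rightarrow> bool" where
  "malternating k N \<Psi> \<longleftrightarrow> (\<forall>w. \<forall>j<k. alternating N (\<lambda>x. \<Psi> (w(j := x))))"

definition meps :: "nat \<Rightarrow> nat \<Rightarrow> (nat \<Rightarrow> nat \<Rightarrow> int) \<Rightarrow> complex" where
  "meps k N w = (\<Prod>j<k. eps N (w j))"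

text \<open>The rule for the character with every border strip replaced by one lowered entry. All
  rows take part, so the recursion also runs through sequences that come from no partition.\<close>

fun mn :: "nat \<Rightarrow> nat \<Rightarrow> (nat \<times> complex) list \<Rightarrow> (nat \<Rightarrow> nat \<Rightarrow> int) \<Rightarrow> complex" where
  "mn k N [] w = meps k N w"
| "mn k N ((a, u) # as) w =
     (\<Sum>j<k. \<Sum>i<N. u ^ j * mn k N as (w(j := (w j)(i := w j i - int a))))"

lemma malternating_meps: "malternating k N (meps k N)"
  unfolding malternating_def
proof (intro allI impI)
  fix w :: "nat \<Rightarrow> nat \<Rightarrow> int" and j assume j: "j < k"
  have "meps k N (w(j := x)) = (\<Prod>i\<in>{..<k} - {j}. eps N (w i)) * eps N x" for x
    using j by (simp add: meps_def prod.remove[of "{..<k}" j] mult.commute)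
  then show "alternating N (\<lambda>x. meps k N (w(j := x)))"
    by (simp add: alternating_scale alternating_eps)
qed

text \<open>The removal of one strip is evaluated against the functional that carries out all later
  removals, so alternation is needed for every tail of the recursion. Lowering the tested component
  is \<open>alternating_shift\<close>; lowering another one commutes with the update.\<close>

lemma malternating_mn: "malternating k N (mn k N as)"
proof (induction as)
  case Nil
  then show ?case using malternating_meps by (simp add: malternating_def)
next
  case (Cons au as)
  obtain a u where au: "au = (a, u)" by (cases au)
  show ?case
    unfolding malternating_def
  proof (intro allI impI)
    fix w :: "nat \<Rightarrow> nat \<Rightarrow> int" and j assume j: "j < k"
    have alt: "alternating N (\<lambda>x. mn k N as (w'(j := x)))" for w'
      using Cons j by (simp add: malternating_def)
    show "alternating N (\<lambda>x. mn k N (au # as) (w(j := x)))"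
      unfolding au mn.simps
    proof (rule alternating_sum)
      fix j' assume j': "j' \<in> {..<k}"
      show "alternating N (\<lambda>x. \<Sum>i<N. u ^ j' * mn k N as ((w(j := x))(j' :=
          ((w(j := x)) j')(i := (w(j := x)) j' i - int a))))"
      proof (cases "j' = j")
        case True
        then show ?thesis
          using alternating_scale[OF alternating_shift[OF alt[of w], of a], of "u ^ j"]
          by (simp add: sum_distrib_left)
      next
        case False
        have "alternating N (\<lambda>x. \<Sum>i<N. u ^ j' * mn k N as
            ((w(j' := (w j')(i := w j' i - int a)))(j := x)))"
          by (intro alternating_sum alternating_scale alt)
        then show ?thesis using False by (simp add: fun_upd_twist)
      qed
    qed
  qed
qed

lemma part_eq_0: "is_partition l \<Longrightarrow> part l = (\<lambda>_. 0) \<longleftrightarrow> l = []"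
proof -
  have "part [] = (\<lambda>_. 0)" "is_partition []" by (auto simp: part_def is_partition_def)
  then show "is_partition l \<Longrightarrow> ?thesis" using part_inject[of l "[]"] by metis
qed

lemma removal_seqs_Cons:
  "removal_seqs \<gamma> (a # as) =
     (\<lambda>((j, m), zs). (j, diagram (\<gamma> ! j) - diagram m) # zs) `
       (SIGMA (j, m) : (SIGMA j : {..<length \<gamma>}. strip_removals (\<gamma> ! j) a).
          removal_seqs (\<gamma>[j := m]) as)"
  (is "?L = ?R")
proof
  show "?L \<subseteq> ?R"
  proof
    fix x assume "x \<in> ?L"
    then obtain j z zs m where *: "x = (j, z) # zs" "j < length \<gamma>" "border_strip (\<gamma> ! j) m z"
        "card z = a" "zs \<in> removal_seqs (\<gamma>[j := m]) as" by auto
    then have "z = diagram (\<gamma> ! j) - diagram m" by (auto simp: border_strip_def)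
    with * show "x \<in> ?R"
      by (auto simp: strip_removals_def intro!: image_eqI[of _ _ "((j, m), zs)"])
  qed
  show "?R \<subseteq> ?L" by (force simp: strip_removals_def)
qed

text \<open>The removed cells determine what is left of the component, because the remaining diagram
  lies inside the old one.\<close>

lemma removal_seqs_Cons_inj:
  assumes "\<And>l. l \<in> set \<gamma> \<Longrightarrow> is_partition l"
  shows "inj_on (\<lambda>((j, m), zs). (j, diagram (\<gamma> ! j) - diagram m) # zs)
     (SIGMA (j, m) : (SIGMA j : {..<length \<gamma>}. strip_removals (\<gamma> ! j) a).
          removal_seqs (\<gamma>[j := m]) as)"
proof -
  have "m = m'" if "m \<in> strip_removals l a" "m' \<in> strip_removals l a"
      "diagram l - diagram m = diagram l - diagram m'" for l m m'
  proof (rule part_inject)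
    show "is_partition m" "is_partition m'" using that by (auto simp: strip_removals_def border_strip_def)
    have "diagram m \<subseteq> diagram l" "diagram m' \<subseteq> diagram l"
      using that by (auto simp: strip_removals_def border_strip_def)
    then have d: "diagram m = diagram m'" using that(3) by blast
    show "part m = part m'"
    proof
      fix i
      have "c < part m i \<longleftrightarrow> c < part m' i" for c
        using d by (auto simp: diagram_part set_eq_iff)
      then show "part m i = part m' i" by (metis nat_neq_iff)
    qed
  qed
  then show ?thesis by (auto simp: inj_on_def)
qed

lemma strip_removals_partition:
  assumes "m \<in> strip_removals l a" "is_partition l"
  shows "is_partition m" "length m \<le> length l"
proof -
  show m: "is_partition m" using assms by (simp add: strip_removals_def border_strip_def)
  obtain p q where "strip (part l) (part m) p q"
    using border_strip_imp_strip[OF assms(2), of m] assms(1) unfolding strip_removals_def by blast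
  then have le: "part m i \<le> part l i" for i using strip_le part_antimono assms(2) by blast
  show "length m \<le> length l"
  proof (rule ccontr)
    assume "\<not> length m \<le> length l"
    then have "part m (length l) > 0" using part_pos[OF m] by simp
    then show False using le[of "length l"] by (simp add: part_def)
  qed
qed

text \<open>The identity for one strip is applied in component \<open>j\<close> with the others held
  fixed. Finiteness is part of the induction, because splitting off the first removal as an outer
  sum relies on it.\<close>

lemma murnaghan_nakayama_removal:
  assumes "\<And>l. l \<in> set \<gamma> \<Longrightarrow> is_partition l \<and> length l \<le> N" "\<And>a. a \<in> fst ` set au \<Longrightarrow> a > 0"
  shows "finite (removal_seqs \<gamma> (map fst au)) \<and>
    (\<Sum>zs\<in>removal_seqs \<gamma> (map fst au).
       \<Prod>s<length au. snd (au ! s) ^ fst (zs ! s) * (-1) ^ ht (snd (zs ! s)))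
    = mn (length \<gamma>) N au (\<lambda>j. beta (part (\<gamma> ! j)))"
  using assms
proof (induction au arbitrary: \<gamma>)
  case Nil
  have "eps N (beta (part (\<gamma> ! j))) = (if \<gamma> ! j = [] then 1 else 0)" if "j < length \<gamma>" for j
    using Nil(1)[OF nth_mem[OF that]]
    by (simp add: eps_beta shape_part part_eq_0)
  then have "mn (length \<gamma>) N [] (\<lambda>j. beta (part (\<gamma> ! j)))
      = (\<Prod>j<length \<gamma>. if \<gamma> ! j = [] then 1 else 0)"
    by (auto simp: meps_def intro!: prod.cong)
  also have "\<dots> = (if \<forall>l\<in>set \<gamma>. l = [] then 1 else 0)"
    by (auto simp: all_set_conv_all_nth intro!: prod.neutral)
  finally show ?case by simp
next
  case (Cons x au)
  obtain a u where x: "x = (a, u)" by (cases x)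
  let ?k = "length \<gamma>"
  let ?P = "SIGMA j : {..<?k}. strip_removals (\<gamma> ! j) a"
  let ?W = "\<lambda>au zs. \<Prod>s<length au. snd (au ! s) ^ fst (zs ! s) * (-1 :: complex) ^ ht (snd (zs ! s))"
  let ?B = "\<lambda>\<gamma> j. beta (part (\<gamma> ! j))"
  have part: "is_partition (\<gamma> ! j)" "length (\<gamma> ! j) \<le> N" if "j < ?k" for j
    using Cons.prems(1)[OF nth_mem[OF that]] by auto
  have IH: "finite (removal_seqs (\<gamma>[j := m]) (map fst au)) \<and>
      (\<Sum>zs\<in>removal_seqs (\<gamma>[j := m]) (map fst au). ?W au zs) = mn ?k N au (?B (\<gamma>[j := m]))"
    if "j < ?k" "m \<in> strip_removals (\<gamma> ! j) a" for j m
  proof -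
    have "is_partition l \<and> length l \<le> N" if "l \<in> set (\<gamma>[j := m])" for l
      using set_update_subset_insert[of \<gamma> j m] that Cons.prems(1) \<open>m \<in> _\<close>
        strip_removals_partition[of m "\<gamma> ! j" a] part[OF \<open>j < ?k\<close>] by force
    then show ?thesis using Cons.IH[of "\<gamma>[j := m]"] Cons.prems(2) by simp
  qed
  have finP: "finite ?P" using part finite_strip_removals by (intro finite_SigmaI) auto
  have fin: "finite (SIGMA (j, m) : ?P. removal_seqs (\<gamma>[j := m]) (map fst au))"
    using IH by (intro finite_SigmaI[OF finP]) auto
  have upd: "?B (\<gamma>[j := m]) = (?B \<gamma>)(j := beta (part m))" if "j < ?k" for j m
    using that by (auto simp: fun_eq_iff nth_list_update)
  have "(\<Sum>zs\<in>removal_seqs \<gamma> (map fst (x # au)). ?W (x # au) zs)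
      = (\<Sum>((j, m), zs)\<in>(SIGMA (j, m) : ?P. removal_seqs (\<gamma>[j := m]) (map fst au)).
          ?W (x # au) ((j, diagram (\<gamma> ! j) - diagram m) # zs))"
    unfolding x list.map fst_conv removal_seqs_Cons
    using Cons.prems(1) by (subst sum.reindex[OF removal_seqs_Cons_inj]) (auto intro!: sum.cong)
  also have "\<dots> = (\<Sum>((j, m), zs)\<in>(SIGMA (j, m) : ?P. removal_seqs (\<gamma>[j := m]) (map fst au)).
          u ^ j * (-1) ^ ht (diagram (\<gamma> ! j) - diagram m) * ?W au zs)"
    by (intro sum.cong refl) (auto simp: x lessThan_Suc_eq_insert_0 prod.reindex simp del: removal_seqs.simps)
  also have "\<dots> = (\<Sum>y\<in>?P. \<Sum>zs\<in>removal_seqs (\<gamma>[fst y := snd y]) (map fst au).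
          u ^ fst y * (-1) ^ ht (diagram (\<gamma> ! fst y) - diagram (snd y)) * ?W au zs)"
    using finP IH by (subst sum.Sigma) (auto intro!: sum.cong simp: case_prod_unfold)
  also have "\<dots> = (\<Sum>(j, m)\<in>?P. u ^ j * ((-1) ^ ht (diagram (\<gamma> ! j) - diagram m)
      * mn ?k N au (?B (\<gamma>[j := m]))))"
    using IH by (intro sum.cong refl) (auto simp flip: sum_distrib_left)
  also have "\<dots> = (\<Sum>j<?k. \<Sum>m\<in>strip_removals (\<gamma> ! j) a. u ^ j *
      ((-1) ^ ht (diagram (\<gamma> ! j) - diagram m) * mn ?k N au (?B (\<gamma>[j := m]))))"
    using part finite_strip_removals by (subst sum.Sigma) auto
  also have "\<dots> = (\<Sum>j<?k. u ^ j * (\<Sum>m\<in>strip_removals (\<gamma> ! j) a.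
      (-1) ^ ht (diagram (\<gamma> ! j) - diagram m) * mn ?k N au ((?B \<gamma>)(j := beta (part m)))))"
    by (intro sum.cong refl) (simp add: sum_distrib_left upd)
  also have "\<dots> = (\<Sum>j<?k. u ^ j *
      (\<Sum>i<N. mn ?k N au ((?B \<gamma>)(j := (?B \<gamma> j)(i := ?B \<gamma> j i - int a)))))"
  proof (intro sum.cong refl)
    fix j assume "j \<in> {..<?k}"
    then have j: "j < ?k" by simp
    have alt: "alternating N (\<lambda>y. mn ?k N au ((?B \<gamma>)(j := y)))"
      using malternating_mn j by (simp add: malternating_def)
    have "a > 0" using Cons.prems(2) x by auto
    then show "u ^ j * (\<Sum>m\<in>strip_removals (\<gamma> ! j) a.
        (-1) ^ ht (diagram (\<gamma> ! j) - diagram m) * mn ?k N au ((?B \<gamma>)(j := beta (part m))))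
      = u ^ j * (\<Sum>i<N. mn ?k N au ((?B \<gamma>)(j := (?B \<gamma> j)(i := ?B \<gamma> j i - int a))))"
      using murnaghan_nakayama[OF alt part[OF j], of a] by simp
  qed
  also have "\<dots> = mn ?k N (x # au) (?B \<gamma>)" by (simp add: x sum_distrib_left)
  finally have "(\<Sum>zs\<in>removal_seqs \<gamma> (map fst (x # au)). ?W (x # au) zs) = mn ?k N (x # au) (?B \<gamma>)" .
  moreover have "finite (removal_seqs \<gamma> (map fst (x # au)))"
    unfolding x list.map fst_conv removal_seqs_Cons by (intro finite_imageI fin)
  ultimately show ?case by blast
qed

definition labelings :: "nat \<Rightarrow> nat \<Rightarrow> nat set set \<Rightarrow> (nat \<Rightarrow> nat \<times> nat) set" where
  "labelings k N C = {g \<in> \<Union>C \<rightarrow>\<^sub>E {..<k} \<times> {..<N}. \<forall>c\<in>C. \<forall>s\<in>c. \<forall>t\<in>c. g s = g t}"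

text \<open>Expanding the recursion distributes every cycle to one row.\<close>

lemma mn_cycles:
  assumes "distinct cs" "pairwise disjnt (set cs)" "\<And>c. c \<in> set cs \<Longrightarrow> finite c \<and> c \<noteq> {}"
  shows "mn k N (map (\<lambda>c. (card c, \<Prod>i\<in>c. u i)) cs) w =
    (\<Sum>g\<in>labelings k N (set cs). (\<Prod>i\<in>\<Union>(set cs). u i ^ fst (g i)) *
       meps k N (\<lambda>j i. w j i - int (card {t \<in> \<Union>(set cs). g t = (j, i)})))"
  using assms
proof (induction cs arbitrary: w)
  case Nil
  then show ?case by (simp add: labelings_def)
next
  case (Cons c cs)
  define U where "U = \<Union>(set cs)"
  define I where "I = {..<k} \<times> {..<N}"
  define K where "K g \<longleftrightarrow> (\<forall>d\<in>set cs. \<forall>s\<in>d. \<forall>t\<in>d. g s = g t)" for g :: "nat \<Rightarrow> nat \<times> nat"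
  let ?sh = "\<lambda>w x. w(fst x := (w (fst x))(snd x := w (fst x) (snd x) - int (card c)))"
  let ?F = "\<lambda>U w g. (\<Prod>i\<in>U. u i ^ fst (g i)) * meps k N (\<lambda>j i. w j i - int (card {t \<in> U. g t = (j, i)}))"
  have fc: "finite c" "c \<noteq> {}" and fU: "finite U" using Cons.prems(3) by (auto simp: U_def)
  have disj: "c \<inter> U = {}"
    using Cons.prems(1,2) by (auto simp: pairwise_insert disjnt_def U_def)
  obtain t0 where t0: "t0 \<in> c" using fc by auto
  have lab: "labelings k N (set cs) = {g \<in> U \<rightarrow>\<^sub>E I. K g}"
    by (simp add: labelings_def U_def I_def K_def)
  have lab': "labelings k N (set (c # cs)) =
      {g \<in> c \<union> U \<rightarrow>\<^sub>E I. (\<forall>s\<in>c. \<forall>t\<in>c. g s = g t) \<and> K g}"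
    by (simp add: labelings_def U_def I_def K_def)
  have K_cong: "K g \<longleftrightarrow> K h" if "\<And>t. t \<in> U \<Longrightarrow> g t = h t" for g h
  proof -
    have "g s = g t \<longleftrightarrow> h s = h t" if "d \<in> set cs" "s \<in> d" "t \<in> d" for d s t
      using \<open>\<And>t. t \<in> U \<Longrightarrow> g t = h t\<close>[of s] \<open>\<And>t. t \<in> U \<Longrightarrow> g t = h t\<close>[of t] that
      by (simp add: U_def) (metis UnionI)
    then show ?thesis unfolding K_def by blast
  qed
  have IH: "mn k N (map (\<lambda>c. (card c, \<Prod>i\<in>c. u i)) cs) w =
      (\<Sum>g\<in>labelings k N (set cs). ?F U w g)" for w
    unfolding U_def using Cons.prems by (intro Cons.IH) (auto simp: pairwise_insert)
  have "mn k N (map (\<lambda>c. (card c, \<Prod>i\<in>c. u i)) (c # cs)) w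
      = (\<Sum>x\<in>I. (\<Prod>i\<in>c. u i) ^ fst x * (\<Sum>g\<in>labelings k N (set cs). ?F U (?sh w x) g))"
    by (simp add: IH sum.cartesian_product case_prod_unfold I_def)
  also have "\<dots> = (\<Sum>(x, g)\<in>I \<times> labelings k N (set cs).
      (\<Prod>i\<in>c. u i) ^ fst x * ?F U (?sh w x) g)"
    by (simp add: sum_distrib_left sum.cartesian_product)
  also have "\<dots> = (\<Sum>g\<in>labelings k N (set (c # cs)). ?F (c \<union> U) w g)"
    unfolding lab lab'
  \<comment> \<open>A labeling of all cycles is a label \<open>x\<close> for the cycle
    \<open>c\<close> together with a labeling of the remaining cycles; \<open>t0\<close> serves to
    read \<open>x\<close> off. The power of the C-type becomes one factor per index of
    \<open>c\<close>, and lowering by the length of \<open>c\<close> becomes the count of its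
    indices.\<close>
  proof (rule sum.reindex_bij_witness[where
        j = "\<lambda>(x, g) t. if t \<in> c then x else g t" and i = "\<lambda>g. (g t0, restrict g U)"])
    fix g assume g: "g \<in> {g \<in> c \<union> U \<rightarrow>\<^sub>E I. (\<forall>s\<in>c. \<forall>t\<in>c. g s = g t) \<and> K g}"
    have ext: "g t = undefined" if "t \<notin> c \<union> U" for t
      using g that by (auto simp: PiE_def extensional_def)
    have const: "g t = g t0" if "t \<in> c" for t using g that t0 by blast
    have mem: "g t \<in> I" if "t \<in> c \<union> U" for t using g that by (auto simp: PiE_def Pi_def)
    show "(\<lambda>(x, g) t. if t \<in> c then x else g t) (g t0, restrict g U) = g"
      using ext const by (auto simp: fun_eq_iff)
    have "K (restrict g U)" using g K_cong[of "restrict g U" g] by simp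
    then show "(g t0, restrict g U) \<in> I \<times> {g \<in> U \<rightarrow>\<^sub>E I. K g}"
      using mem t0 by (simp add: restrict_PiE_iff)
  next
    fix y assume y: "y \<in> I \<times> {g \<in> U \<rightarrow>\<^sub>E I. K g}"
    obtain x g where xg: "y = (x, g)" by (cases y)
    have x: "x \<in> I" and g: "g \<in> U \<rightarrow>\<^sub>E I" "K g" using y xg by auto
    let ?h = "\<lambda>t. if t \<in> c then x else g t"
    have hU: "?h t = g t" if "t \<in> U" for t using disj that by auto
    have "restrict ?h U = g"
      using hU g(1) by (auto simp: PiE_def extensional_def fun_eq_iff)
    then show "(((\<lambda>(x, g) t. if t \<in> c then x else g t) y) t0,
        restrict ((\<lambda>(x, g) t. if t \<in> c then x else g t) y) U) = y"
      using t0 xg by simp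
    have "K ?h" using g(2) K_cong[of ?h g] hU by blast
    moreover have "?h \<in> c \<union> U \<rightarrow>\<^sub>E I"
      using x g(1) by (auto simp: PiE_def extensional_def Pi_def)
    ultimately show "(\<lambda>(x, g) t. if t \<in> c then x else g t) y
        \<in> {g \<in> c \<union> U \<rightarrow>\<^sub>E I. (\<forall>s\<in>c. \<forall>t\<in>c. g s = g t) \<and> K g}"
      by (simp add: xg)
    have "(\<Prod>i\<in>c. u i ^ fst (?h i)) = (\<Prod>i\<in>c. u i) ^ fst x"
      by (simp add: prod_power_distrib)
    moreover have "(\<Prod>i\<in>U. u i ^ fst (?h i)) = (\<Prod>i\<in>U. u i ^ fst (g i))"
      by (intro prod.cong refl) (simp only: hU)
    ultimately have "(\<Prod>i\<in>c \<union> U. u i ^ fst (?h i)) = (\<Prod>i\<in>c. u i) ^ fst x * (\<Prod>i\<in>U. u i ^ fst (g i))"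
      unfolding prod.union_disjoint[OF fc(1) fU disj] by (simp only:)
    moreover have "int (card {t \<in> c \<union> U. ?h t = (j, i)})
        = (if (j, i) = x then int (card c) else 0) + int (card {t \<in> U. g t = (j, i)})" for j i
    proof -
      have "{t \<in> c \<union> U. ?h t = (j, i)} = (if (j, i) = x then c else {}) \<union> {t \<in> U. g t = (j, i)}"
        using disj by auto
      also have "card \<dots> = card (if (j, i) = x then c else {}) + card {t \<in> U. g t = (j, i)}"
        using disj fc fU by (intro card_Un_disjoint) auto
      finally show ?thesis by auto
    qed
    then have "(\<lambda>j i. w j i - int (card {t \<in> c \<union> U. ?h t = (j, i)}))
        = (\<lambda>j i. ?sh w x j i - int (card {t \<in> U. g t = (j, i)}))"
      by (cases x) (auto simp: fun_eq_iff)
    ultimately show "?F (c \<union> U) w ((\<lambda>(x, g) t. if t \<in> c then x else g t) y)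
        = (case y of (x, g) \<Rightarrow> (\<Prod>i\<in>c. u i) ^ fst x * ?F U (?sh w x) g)"
      by (simp add: xg mult.assoc)
  qed
  also have "c \<union> U = \<Union>(set (c # cs))" by (simp add: U_def)
  finally show ?case .
qed

section \<open>Colored sums\<close>

text \<open>The left side of the Pieri rule in component \<open>r\<close>; each application disposes
  of one color.\<close>

definition hop :: "nat \<Rightarrow> nat \<Rightarrow> nat \<Rightarrow> ((nat \<Rightarrow> nat \<Rightarrow> int) \<Rightarrow> complex) \<Rightarrow> (nat \<Rightarrow> nat \<Rightarrow> int) \<Rightarrow> complex" where
  "hop N r m \<Psi> w = (\<Sum>x\<in>lower N (w r) m. \<Psi> (w(r := x)))"

lemma lower_transpose:
  assumes "i < N" "j < N" "w \<in> lower N v m"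
  shows "w \<circ> transpose i j \<in> lower N (v \<circ> transpose i j) m"
proof -
  have t: "transpose i j permutes {..<N}" using assms by (intro permutes_swap_id) auto
  have "(\<Sum>x<N. f (transpose i j x)) = (\<Sum>x<N. f x)" for f :: "nat \<Rightarrow> int"
    using sum.permute[OF t, of f] by (simp add: o_def)
  moreover have "transpose i j x = x" if "x \<ge> N" for x
    using assms that by (auto simp: transpose_def)
  ultimately show ?thesis using assms(3) by (auto simp: lower_def)
qed

lemma alternating_lower:
  assumes alt: "alternating N \<Phi>"
  shows "alternating N (\<lambda>v. \<Sum>x\<in>lower N v m. \<Phi> x)"
  unfolding alternating_def
proof (intro conjI allI impI)
  fix v :: "nat \<Rightarrow> int" and i j assume ij: "i < N" "j < N" "i \<noteq> j"
  let ?t = "transpose i j"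
  have "(\<Sum>x\<in>lower N (v \<circ> ?t) m. \<Phi> x) = (\<Sum>x\<in>lower N v m. \<Phi> (x \<circ> ?t))"
    by (rule sum.reindex_bij_witness[where i = "\<lambda>x. x \<circ> ?t" and j = "\<lambda>x. x \<circ> ?t"])
      (use lower_transpose[OF ij(1,2), of _ _ m] in \<open>force simp: o_assoc[symmetric]\<close>)+
  then show "(\<Sum>x\<in>lower N (v \<circ> ?t) m. \<Phi> x) = - (\<Sum>x\<in>lower N v m. \<Phi> x)"
    using alternating_transpose[OF alt ij] by (simp add: sum_negf)
next
  fix v :: "nat \<Rightarrow> int" and i assume i: "i < N" "v i < - int N"
  then show "(\<Sum>x\<in>lower N v m. \<Phi> x) = 0"
    by (intro sum.neutral ballI alternating_low[OF alt i(1)]) (auto simp: lower_def intro: le_less_trans)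
qed

lemma malternating_hop:
  assumes "malternating k N \<Psi>"
  shows "malternating k N (hop N r m \<Psi>)"
  unfolding malternating_def hop_def
proof (intro allI impI)
  fix w :: "nat \<Rightarrow> nat \<Rightarrow> int" and j assume j: "j < k"
  have alt: "alternating N (\<lambda>x. \<Psi> (w'(j := x)))" for w'
    using assms j by (simp add: malternating_def)
  show "alternating N (\<lambda>x. \<Sum>y\<in>lower N ((w(j := x)) r) m. \<Psi> (w(j := x, r := y)))"
  proof (cases "r = j")
    case True
    then show ?thesis using alternating_lower[OF alt[of w]] by simp
  next
    case False
    have "alternating N (\<lambda>x. \<Sum>y\<in>lower N (w r) m. \<Psi> (w(r := y, j := x)))"
      by (intro alternating_sum alt)
    then show ?thesis using False by (simp add: fun_upd_twist)
  qed
qed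

lemma hop_beta:
  assumes "malternating k N \<Psi>" "r < k" "shape N (\<Lambda> r)"
  shows "hop N r m \<Psi> (\<lambda>j. beta (\<Lambda> j))
    = (\<Sum>\<mu>\<in>hstrips N (\<Lambda> r) m. \<Psi> (\<lambda>j. beta ((\<Lambda>(r := \<mu>)) j)))"
proof -
  have "alternating N (\<lambda>x. \<Psi> ((\<lambda>j. beta (\<Lambda> j))(r := x)))"
    using assms by (simp add: malternating_def)
  moreover have "(\<lambda>j. beta (\<Lambda> j))(r := beta \<mu>) = (\<lambda>j. beta ((\<Lambda>(r := \<mu>)) j))" for \<mu>
    by (auto simp: fun_eq_iff)
  ultimately show ?thesis using pieri[of N _ "\<Lambda> r" m] assms(3) by (simp only: hop_def)
qed

text \<open>What remains of a coloring and a compatible labeling when the indices are forgotten. The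
  residue of \<open>p\<close> dictates the component, so only the row of each copy of a color is
  free.\<close>

definition pairings ::
  "nat \<Rightarrow> nat \<Rightarrow> ('c \<Rightarrow> int) \<Rightarrow> 'c multiset \<Rightarrow> ('c \<times> nat \<times> nat) multiset set" where
  "pairings k N p M = {A. image_mset fst A = M \<and>
     (\<forall>(c, j, i)\<in>set_mset A. i < N \<and> int j = p c mod int k)}"

definition mdrop :: "(nat \<Rightarrow> nat \<Rightarrow> int) \<Rightarrow> (nat \<times> nat) multiset \<Rightarrow> nat \<Rightarrow> nat \<Rightarrow> int" where
  "mdrop w X j i = w j i - int (count X (j, i))"

text \<open>A product of Kostka numbers in signed form, defined for all sequences \<open>w\<close>
  so that colors can be split off one at a time.\<close>

definition colored_sum ::
  "nat \<Rightarrow> nat \<Rightarrow> ('c \<Rightarrow> int) \<Rightarrow> 'c multiset \<Rightarrow> (nat \<Rightarrow> nat \<Rightarrow> int) \<Rightarrow> complex" where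
  "colored_sum k N p M w = (\<Sum>A\<in>pairings k N p M. meps k N (mdrop w (image_mset snd A)))"

lemma finite_multisets_of_size:
  assumes "finite S"
  shows "finite {A. set_mset A \<subseteq> S \<and> size A = n}"
proof (rule finite_subset)
  show "{A. set_mset A \<subseteq> S \<and> size A = n} \<subseteq> mset ` {xs. set xs \<subseteq> S \<and> length xs = n}"
    by (auto, metis (mono_tags, lifting) ex_mset image_eqI mem_Collect_eq set_mset_mset size_mset)
qed (use assms finite_lists_length_eq in auto)

lemma finite_pairings:
  assumes "k > 0"
  shows "finite (pairings k N p M)"
proof (rule finite_subset)
  show "pairings k N p M \<subseteq> {A. set_mset A \<subseteq> set_mset M \<times> {..<k} \<times> {..<N} \<and> size A = size M}"
  proof (intro subsetI CollectI conjI)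
    fix A z assume A: "A \<in> pairings k N p M" "z \<in># A"
    obtain c j i where z: "z = (c, j, i)" by (cases z)
    have "image_mset fst A = M" "i < N" "int j = p c mod int k" using A z by (auto simp: pairings_def)
    moreover have "c \<in># image_mset fst A" using A(2) z by force
    moreover have "p c mod int k < int k" using assms by simp
    ultimately show "z \<in> set_mset M \<times> {..<k} \<times> {..<N}" using z by auto
  qed (auto simp: pairings_def)
qed (intro finite_multisets_of_size, auto)

lemma colored_sum_empty: "colored_sum k N p {#} = meps k N"
proof
  fix w
  have "pairings k N p {#} = {{#}}" by (auto simp: pairings_def)
  moreover have "mdrop w {#} = w" by (auto simp: fun_eq_iff mdrop_def)
  ultimately show "colored_sum k N p {#} w = meps k N w" by (simp add: colored_sum_def)
qed

text \<open>All copies of \<open>b\<close> have their labels in component \<open>r\<close>, so they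
  are described by their number in each row, that is, by a way of lowering the rows of
  \<open>w r\<close> by \<open>m\<close> in total.\<close>

lemma colored_sum_add:
  fixes b :: 'c and r k :: nat
  assumes "k > 0" "b \<notin># M" and r: "int r = p b mod int k"
  shows "colored_sum k N p (replicate_mset m b + M) = hop N r m (colored_sum k N p M)"
proof
  fix w
  define rows :: "(nat \<Rightarrow> int) \<Rightarrow> ('c \<times> nat \<times> nat) multiset" where
    "rows x = (\<Sum>i<N. replicate_mset (nat (w r i - x i)) (b, r, i))" for x
  have count_rows: "count (rows x) (c, j, i) =
      (if c = b \<and> j = r \<and> i < N then nat (w r i - x i) else 0)" for x c j i
  proof -
    have "count (rows x) (c, j, i)
        = (\<Sum>i'<N. if i' = i then (if c = b \<and> j = r then nat (w r i - x i) else 0) else 0)"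
      unfolding rows_def count_sum by (intro sum.cong) auto
    then show ?thesis by simp
  qed
  have fst_rows: "image_mset fst (rows x) = replicate_mset m b" if x: "x \<in> lower N (w r) m" for x
  proof -
    have "image_mset fst (rows x) = (\<Sum>i<N. replicate_mset (nat (w r i - x i)) b)"
      unfolding rows_def by (induction N) auto
    also have "\<dots> = replicate_mset (\<Sum>i<N. nat (w r i - x i)) b"
      by (induction N) (auto simp: multiset_eq_iff)
    also have "(\<Sum>i<N. nat (w r i - x i)) = m"
    proof -
      have "int (\<Sum>i<N. nat (w r i - x i)) = (\<Sum>i<N. w r i - x i)"
        using x by (auto simp: lower_def intro!: sum.cong)
      also have "\<dots> = int m" using x by (simp add: lower_def sum_subtractf)
      finally show ?thesis by (simp only: of_nat_eq_iff)
    qed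
    finally show ?thesis .
  qed
  \<comment> \<open>Only the colors that occur are summed over, since the type of colors may be
    infinite.\<close>
  have snd_count: "count (image_mset snd A) y = (\<Sum>c\<in>set_mset (image_mset fst A). count A (c, y))"
    for A :: "('c \<times> nat \<times> nat) multiset" and y
  proof (induction A)
    case (add z A)
    have "(\<Sum>c\<in>set_mset (image_mset fst (add_mset z A)). count (add_mset z A) (c, y))
        = (\<Sum>c\<in>insert (fst z) (fst ` set_mset A). count A (c, y))
          + (\<Sum>c\<in>insert (fst z) (fst ` set_mset A). if z = (c, y) then 1 else 0)"
      unfolding sum.distrib[symmetric] by (intro sum.cong) auto
    also have "(\<Sum>c\<in>insert (fst z) (fst ` set_mset A). count A (c, y))
        = (\<Sum>c\<in>fst ` set_mset A. count A (c, y))"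
    proof (cases "fst z \<in> fst ` set_mset A")
      case False
      then have "count A (fst z, y) = 0" by (metis count_eq_zero_iff fst_conv image_eqI)
      then show ?thesis using False by simp
    qed (simp add: insert_absorb)
    also have "(\<Sum>c\<in>insert (fst z) (fst ` set_mset A). if z = (c, y) then 1 else 0)
        = (if snd z = y then 1 else (0::nat))"
      by (cases z) (auto simp: sum.delta' if_distrib cong: if_cong)
    finally show ?case using add by simp
  qed simp
  have "hop N r m (colored_sum k N p M) w
      = (\<Sum>(x, A)\<in>lower N (w r) m \<times> pairings k N p M.
          meps k N (mdrop (w(r := x)) (image_mset snd A)))"
    by (simp add: hop_def colored_sum_def sum.cartesian_product)
  also have "\<dots> = (\<Sum>A\<in>pairings k N p (replicate_mset m b + M). meps k N (mdrop w (image_mset snd A)))"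
  proof (rule sum.reindex_bij_witness[where j = "\<lambda>(x, A). rows x + A" and
        i = "\<lambda>A. (\<lambda>i. w r i - int (count A (b, r, i)), filter_mset (\<lambda>z. fst z \<noteq> b) A)"])
    fix A assume A: "A \<in> pairings k N p (replicate_mset m b + M)"
    let ?x = "\<lambda>i. w r i - int (count A (b, r, i))"
    have fstA: "image_mset fst A = replicate_mset m b + M"
      and memA: "\<And>c j i. (c, j, i) \<in># A \<Longrightarrow> i < N \<and> int j = p c mod int k"
      using A by (auto simp: pairings_def)
    have b0: "count A (b, j, i) = 0" if "j \<noteq> r \<or> i \<ge> N" for j i
      using memA[of b j i] r that by (auto simp: not_in_iff[symmetric])
    have "rows ?x + filter_mset (\<lambda>z. fst z \<noteq> b) A = A"
    proof (rule multiset_eqI)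
      fix z show "count (rows ?x + filter_mset (\<lambda>z. fst z \<noteq> b) A) z = count A z"
        using b0 by (cases z) (auto simp: count_rows)
    qed
    then show "(\<lambda>(x, A). rows x + A) (?x, filter_mset (\<lambda>z. fst z \<noteq> b) A) = A" by simp
    have "filter_mset (\<lambda>z. fst z = b) A = rows ?x"
    proof (rule multiset_eqI)
      fix z show "count (filter_mset (\<lambda>z. fst z = b) A) z = count (rows ?x) z"
        using b0 by (cases z) (auto simp: count_rows)
    qed
    moreover have "size (filter_mset (\<lambda>z. fst z = b) A) = m"
    proof -
      have "size (filter_mset (\<lambda>z. fst z = b) A) = count (image_mset fst A) b"
        by (induction A) auto
      moreover have "count M b = 0" using \<open>b \<notin># M\<close> by (metis count_eq_zero_iff)
      ultimately show ?thesis using fstA by simp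
    qed
    moreover have "size (rows ?x) = (\<Sum>i<N. count A (b, r, i))"
      unfolding rows_def by (simp add: size_multiset_sum)
    ultimately have "(\<Sum>i<N. count A (b, r, i)) = m" by simp
    then have "?x \<in> lower N (w r) m"
      using b0 by (auto simp: lower_def sum_subtractf simp flip: of_nat_sum)
    moreover have "image_mset fst (filter_mset (\<lambda>z. fst z \<noteq> b) A) = M"
    proof -
      have "image_mset fst (filter_mset (\<lambda>z. fst z \<noteq> b) A) = filter_mset (\<lambda>c. c \<noteq> b) (image_mset fst A)"
        by (induction A) auto
      also have "\<dots> = M"
      proof (rule multiset_eqI)
        have "count M b = 0" using \<open>b \<notin># M\<close> by (metis count_eq_zero_iff)
        then show "count (filter_mset (\<lambda>c. c \<noteq> b) (image_mset fst A)) c = count M c" for c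
          by (auto simp: fstA)
      qed
      finally show ?thesis .
    qed
    ultimately show "(?x, filter_mset (\<lambda>z. fst z \<noteq> b) A) \<in> lower N (w r) m \<times> pairings k N p M"
      using memA by (auto simp: pairings_def)
  next
    fix y assume y: "y \<in> lower N (w r) m \<times> pairings k N p M"
    obtain x A where xA: "y = (x, A)" by (cases y)
    have x: "x \<in> lower N (w r) m" and A: "A \<in> pairings k N p M" using y xA by auto
    have fstA: "image_mset fst A = M" using A by (simp add: pairings_def)
    have bA: "count A (b, z) = 0" for z
    proof -
      have "b \<notin> fst ` set_mset A" using fstA \<open>b \<notin># M\<close> by (metis set_image_mset)
      then show ?thesis by (metis count_eq_zero_iff fst_conv image_eqI)
    qed
    have le: "x i \<le> w r i" "i \<ge> N \<Longrightarrow> x i = w r i" for i using x by (auto simp: lower_def)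
    have "(\<lambda>i. w r i - int (count (rows x + A) (b, r, i))) = x"
      using le bA by (auto simp: fun_eq_iff count_rows)
    moreover have "filter_mset (\<lambda>z. fst z \<noteq> b) (rows x + A) = A"
    proof (rule multiset_eqI)
      fix z show "count (filter_mset (\<lambda>z. fst z \<noteq> b) (rows x + A)) z = count A z"
        using bA by (cases z) (auto simp: count_rows)
    qed
    ultimately show "(\<lambda>A. (\<lambda>i. w r i - int (count A (b, r, i)), filter_mset (\<lambda>z. fst z \<noteq> b) A))
        ((\<lambda>(x, A). rows x + A) y) = y" by (simp add: xA)
    have "i < N \<and> int j = p c mod int k" if "(c, j, i) \<in># rows x" for c j i
      using that r by (auto simp: count_rows count_greater_zero_iff[symmetric] simp del: count_greater_zero_iff split: if_splits)
    then show "(\<lambda>(x, A). rows x + A) y \<in> pairings k N p (replicate_mset m b + M)"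
      using A fst_rows[OF x] by (auto simp: xA pairings_def)
    have "count (image_mset snd (rows x)) (j, i) = (if j = r \<and> i < N then nat (w r i - x i) else 0)" for j i
    proof -
      have "count (image_mset snd (rows x)) (j, i) = (\<Sum>c\<in>(if m = 0 then {} else {b}). count (rows x) (c, j, i))"
        unfolding snd_count fst_rows[OF x] by (intro sum.cong) (auto split: if_splits)
      moreover have "count (rows x) (b, j, i) = 0" if "m = 0"
        using fst_rows[OF x] that by simp
      ultimately show ?thesis by (auto simp: count_rows split: if_splits)
    qed
    then have "mdrop w (image_mset snd (rows x + A)) = mdrop (w(r := x)) (image_mset snd A)"
      using le by (auto simp: mdrop_def fun_eq_iff)
    then show "meps k N (mdrop w (image_mset snd ((\<lambda>(x, A). rows x + A) y)))
        = (case y of (x, A) \<Rightarrow> meps k N (mdrop (w(r := x)) (image_mset snd A)))"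
      by (simp add: xA)
  qed
  finally show "colored_sum k N p (replicate_mset m b + M) w = hop N r m (colored_sum k N p M) w"
    by (simp add: colored_sum_def)
qed

section \<open>Semistandard fillings\<close>

definition row_filling :: "(nat \<Rightarrow> nat) \<Rightarrow> (nat \<Rightarrow> 'c::linorder list) \<Rightarrow> bool" where
  "row_filling \<nu> t \<longleftrightarrow> (\<forall>i. length (t i) = \<nu> i \<and> sorted (t i)) \<and>
     (\<forall>i c. c < \<nu> (Suc i) \<longrightarrow> t i ! c < t (Suc i) ! c)"

text \<open>Rows are functions of the row index, as the shapes are, because the shape changes with
  every color removed. The value \<open>[]\<close> outside the \<open>k\<close> components makes the
  representation unique.\<close>

definition row_tableaux :: "nat \<Rightarrow> nat \<Rightarrow> ('c \<Rightarrow> int) \<Rightarrow> (nat \<Rightarrow> nat \<Rightarrow> nat) \<Rightarrow> 'c::linorder multiset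
    \<Rightarrow> (nat \<Rightarrow> nat \<Rightarrow> 'c list) set" where
  "row_tableaux k N p \<Lambda> M = {t.
     (\<forall>j<k. row_filling (\<Lambda> j) (t j) \<and> (\<forall>i. \<forall>c\<in>set (t j i). p c mod int k = int j)) \<and>
     (\<forall>j\<ge>k. t j = (\<lambda>_. [])) \<and> (\<Sum>j<k. \<Sum>i<N. mset (t j i)) = M}"

lemma sorted_split_max:
  assumes "sorted xs" "\<And>x. x \<in> set xs \<Longrightarrow> x \<le> b"
  shows "xs = filter (\<lambda>x. x \<noteq> b) xs @ replicate (length xs - length (filter (\<lambda>x. x \<noteq> b) xs)) b"
  using assms
proof (induction xs)
  case (Cons x xs)
  show ?case
  proof (cases "x = b")
    case True
    then have "\<forall>y\<in>set xs. y = b" using Cons.prems by (auto intro: antisym)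
    then have "xs = replicate (length xs) b" "filter (\<lambda>x. x \<noteq> b) xs = []"
      by (auto simp: replicate_length_same filter_empty_conv)
    then show ?thesis using True by simp
  next
    case False
    then show ?thesis using Cons by (simp add: Suc_diff_le length_filter_le)
  qed
qed simp

text \<open>Columns increase strictly, so a maximal entry has no cell above it. Hence the part of
  row \<open>i\<close> before its first \<open>b\<close> is at least as long as row
  \<open>Suc i\<close>: the cells of \<open>b\<close> form a horizontal strip.\<close>

lemma row_filling_remove_max:
  assumes t: "row_filling \<nu> t" and anti: "antimono \<nu>"
    and max: "\<And>i x. x \<in> set (t i) \<Longrightarrow> x \<le> b"
    and \<mu>: "\<mu> = (\<lambda>i. length (filter (\<lambda>x. x \<noteq> b) (t i)))"
  shows "row_filling \<mu> (\<lambda>i. filter (\<lambda>x. x \<noteq> b) (t i))"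
    and "\<And>i. \<nu> (Suc i) \<le> \<mu> i" and "\<And>i. \<mu> i \<le> \<nu> i"
    and "\<And>i. t i = filter (\<lambda>x. x \<noteq> b) (t i) @ replicate (\<nu> i - \<mu> i) b"
proof -
  let ?s = "\<lambda>i. filter (\<lambda>x. x \<noteq> b) (t i)"
  have len: "length (t i) = \<nu> i" and sorted: "sorted (t i)" for i
    using t by (auto simp: row_filling_def)
  have col: "t i ! c < t (Suc i) ! c" if "c < \<nu> (Suc i)" for i c
    using t that by (auto simp: row_filling_def)
  show split: "t i = ?s i @ replicate (\<nu> i - \<mu> i) b" for i
    using sorted_split_max[OF sorted, of i b] max by (simp add: \<mu> len)
  show le: "\<mu> i \<le> \<nu> i" for i unfolding \<mu> len[symmetric] by (rule length_filter_le)
  show Suc_le: "\<nu> (Suc i) \<le> \<mu> i" for i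
  proof (rule ccontr)
    assume "\<not> \<nu> (Suc i) \<le> \<mu> i"
    then have lt: "\<mu> i < \<nu> (Suc i)" by simp
    then have "\<mu> i < \<nu> i" using anti by (auto simp: antimono_iff_le_Suc intro: less_le_trans)
    have mem: "t (Suc i) ! \<mu> i \<in> set (t (Suc i))" using lt by (simp add: len)
    have "t i ! \<mu> i = (?s i @ replicate (\<nu> i - \<mu> i) b) ! \<mu> i" using split[of i] by simp
    also have "\<dots> = b" using \<open>\<mu> i < \<nu> i\<close> by (simp add: nth_append \<mu>)
    finally show False using col[OF lt] max[OF mem] by simp
  qed
  have nth: "?s i ! c = t i ! c" if "c < \<mu> i" for i c
  proof -
    have "t i ! c = (?s i @ replicate (\<nu> i - \<mu> i) b) ! c" using split[of i] by simp
    also have "\<dots> = ?s i ! c" using that by (simp add: nth_append \<mu>)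
    finally show ?thesis by simp
  qed
  show "row_filling \<mu> ?s"
    unfolding row_filling_def
  proof (intro conjI allI impI)
    fix i c assume c: "c < \<mu> (Suc i)"
    then have "c < \<nu> (Suc i)" "c < \<mu> i" using le[of "Suc i"] Suc_le[of i] by auto
    then show "?s i ! c < ?s (Suc i) ! c" using nth[OF c] nth[of c i] col by simp
  qed (use sorted in \<open>auto simp: \<mu> intro: sorted_wrt_filter\<close>)
qed

text \<open>By the interlacing, every cell that has a cell above it is an old one, so its entry is
  less than \<open>b\<close>; a new \<open>b\<close> therefore never breaks a column.\<close>

lemma row_filling_add_max:
  assumes s: "row_filling \<mu> s" and max: "\<And>i x. x \<in> set (s i) \<Longrightarrow> x < b"
    and le: "\<And>i. \<nu> (Suc i) \<le> \<mu> i" "\<And>i. \<mu> i \<le> \<nu> i"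
  shows "row_filling \<nu> (\<lambda>i. s i @ replicate (\<nu> i - \<mu> i) b)"
proof -
  have len: "length (s i) = \<mu> i" and sorted: "sorted (s i)" for i
    using s by (auto simp: row_filling_def)
  show ?thesis
    unfolding row_filling_def
  proof (intro conjI allI impI)
    fix i c assume c: "c < \<nu> (Suc i)"
    then have ci: "c < \<mu> i" using le(1)[of i] by simp
    show "(s i @ replicate (\<nu> i - \<mu> i) b) ! c < (s (Suc i) @ replicate (\<nu> (Suc i) - \<mu> (Suc i)) b) ! c"
    proof (cases "c < \<mu> (Suc i)")
      case True
      then show ?thesis using s ci by (simp add: nth_append len row_filling_def)
    next
      case False
      have "s i ! c < b" using max[of "s i ! c" i] ci by (simp add: len)
      then show ?thesis using False ci c by (simp add: nth_append len)
    qed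
  qed (use sorted max le in \<open>auto simp: len sorted_append intro: less_imp_le\<close>)
qed

lemma filter_mset_sum: "filter_mset P (\<Sum>x\<in>X. f x) = (\<Sum>x\<in>X. filter_mset P (f x))"
  by (induction X rule: infinite_finite_induct) auto

lemma in_mset_sum: "finite X \<Longrightarrow> x \<in># (\<Sum>y\<in>X. f y) \<longleftrightarrow> (\<exists>y\<in>X. x \<in># f y)"
  by (induction X rule: finite_induct) auto

lemma length_filter_neq: "length (filter (\<lambda>x. x \<noteq> b) xs) + count (mset xs) b = length xs"
  by (induction xs) auto

text \<open>The residue of \<open>p\<close> at \<open>b\<close> confines \<open>b\<close> to
  component \<open>r\<close>, so deleting it changes the shape there only. All other entries are
  smaller, so it can be put back in just one way: at the ends of the rows.\<close>

lemma row_tableaux_bij: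
  fixes b :: "'c::linorder"
  assumes r: "r < k" "int r = p b mod int k" and shape: "\<And>j. j < k \<Longrightarrow> shape N (\<Lambda> j)"
    and max: "\<And>c. c \<in># M \<Longrightarrow> c < b"
  shows "bij_betw (\<lambda>t. (\<lambda>i. length (filter (\<lambda>x. x \<noteq> b) (t r i)), \<lambda>j i. filter (\<lambda>x. x \<noteq> b) (t j i)))
    (row_tableaux k N p \<Lambda> (replicate_mset m b + M))
    (SIGMA \<mu> : hstrips N (\<Lambda> r) m. row_tableaux k N p (\<Lambda>(r := \<mu>)) M)"
proof (rule bij_betw_byWitness[where
      f' = "\<lambda>(\<mu>, s). s(r := \<lambda>i. s r i @ replicate (\<Lambda> r i - \<mu> i) b)"], safe)
  let ?s = "\<lambda>t j i. filter (\<lambda>x. x \<noteq> b) (t j i)"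
  let ?mu = "\<lambda>t i. length (?s t r i)"
  {
    fix t assume t: "t \<in> row_tableaux k N p \<Lambda> (replicate_mset m b + M)"
    have fill: "\<And>j. j < k \<Longrightarrow> row_filling (\<Lambda> j) (t j)"
      and res: "\<And>j i c. j < k \<Longrightarrow> c \<in> set (t j i) \<Longrightarrow> p c mod int k = int j"
      and empty: "\<And>j. j \<ge> k \<Longrightarrow> t j = (\<lambda>_. [])"
      and content: "(\<Sum>j<k. \<Sum>i<N. mset (t j i)) = replicate_mset m b + M"
      using t by (auto simp: row_tableaux_def)
    have same: "?s t j i = t j i" if "j \<noteq> r" for j i
    proof (cases "j < k")
      case True
      then show ?thesis using res[OF True] r(2) that by (auto simp: filter_id_conv)
    qed (simp add: empty)
    have le_b: "x \<le> b" if x: "x \<in> set (t r i)" for x i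
    proof (cases "i < N")
      case True
      have "x \<in># (\<Sum>j<k. \<Sum>i<N. mset (t j i))"
        using x True r(1) by (auto simp: in_mset_sum)
      then show ?thesis using max by (auto simp: content less_imp_le split: if_splits)
    next
      case False
      then have "length (t r i) = 0"
        using fill[OF r(1)] shape[OF r(1)] by (simp add: row_filling_def shape_def)
      then show ?thesis using x by simp
    qed
    note rm = row_filling_remove_max[OF fill[OF r(1)] _ le_b refl]
    have anti: "antimono (\<Lambda> r)" using shape[OF r(1)] by (simp add: shape_def)
    show "(\<lambda>j i. ?s t j i)(r := \<lambda>i. ?s t r i @ replicate (\<Lambda> r i - ?mu t i) b) = t"
      using rm(4)[OF anti, symmetric] same by (auto simp: fun_eq_iff)
    have "(\<Sum>j<k. \<Sum>i<N. count (mset (t j i)) b) = m + count M b"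
      using arg_cong[OF content, of "\<lambda>X. count X b"] by (simp add: count_sum)
    moreover have "count M b = 0" using max by (metis count_eq_zero_iff less_irrefl)
    moreover have "(\<Sum>j<k. \<Sum>i<N. count (mset (t j i)) b) = (\<Sum>i<N. count (mset (t r i)) b)"
    proof -
      have "count (mset (t j i)) b = 0" if "j \<noteq> r" for j i
        using same[OF that, of i] by (metis (mono_tags, lifting) count_mset_0_iff filter_id_conv)
      then have "(\<Sum>j<k. \<Sum>i<N. count (mset (t j i)) b)
          = (\<Sum>j<k. if j = r then \<Sum>i<N. count (mset (t r i)) b else 0)"
        by (intro sum.cong) auto
      then show ?thesis using r(1) by simp
    qed
    ultimately have "(\<Sum>i<N. count (mset (t r i)) b) = m" by simp
    moreover have "\<Lambda> r i = ?mu t i + count (mset (t r i)) b" for i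
      using fill[OF r(1)] length_filter_neq[of b "t r i"] by (simp add: row_filling_def)
    ultimately have "(\<Sum>i<N. \<Lambda> r i) = m + (\<Sum>i<N. ?mu t i)" by (simp add: sum.distrib)
    then show "?mu t \<in> hstrips N (\<Lambda> r) m"
      using rm(2,3)[OF anti] by (simp add: hstrips_def)
    have "(\<Sum>j<k. \<Sum>i<N. mset (?s t j i)) = filter_mset (\<lambda>x. x \<noteq> b) (replicate_mset m b + M)"
      unfolding content[symmetric] by (simp add: filter_mset_sum)
    also have "\<dots> = M"
      using \<open>count M b = 0\<close> by (auto intro!: multiset_eqI)
    finally show "(\<lambda>j i. ?s t j i) \<in> row_tableaux k N p (\<Lambda>(r := ?mu t)) M"
      using rm(1)[OF anti] fill res empty same by (auto simp: row_tableaux_def)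
  }
  {
    fix \<mu> s assume \<mu>: "\<mu> \<in> hstrips N (\<Lambda> r) m" and s: "s \<in> row_tableaux k N p (\<Lambda>(r := \<mu>)) M"
    let ?t = "s(r := \<lambda>i. s r i @ replicate (\<Lambda> r i - \<mu> i) b)"
    have fill: "\<And>j. j < k \<Longrightarrow> row_filling ((\<Lambda>(r := \<mu>)) j) (s j)"
      and res: "\<And>j i c. j < k \<Longrightarrow> c \<in> set (s j i) \<Longrightarrow> p c mod int k = int j"
      and empty: "\<And>j. j \<ge> k \<Longrightarrow> s j = (\<lambda>_. [])"
      and content: "(\<Sum>j<k. \<Sum>i<N. mset (s j i)) = M"
      using s by (auto simp: row_tableaux_def)
    have le: "\<And>i. \<Lambda> r (Suc i) \<le> \<mu> i" "\<And>i. \<mu> i \<le> \<Lambda> r i" using \<mu> by (auto simp: hstrips_def)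
    have fr: "row_filling \<mu> (s r)" using fill[OF r(1)] by simp
    have lt_b: "x < b" if x: "x \<in> set (s j i)" for x j i
    proof (cases "j < k \<and> i < N")
      case True
      have "x \<in># (\<Sum>j<k. \<Sum>i<N. mset (s j i))"
        using x True by (auto simp: in_mset_sum)
      then show ?thesis using max by (simp add: content)
    next
      case False
      have "length (s j i) = 0"
      proof (cases "j < k")
        case True
        with False have "i \<ge> N" by simp
        then have "(\<Lambda>(r := \<mu>)) j i = 0"
          using shape[OF True] le(2)[of i] by (auto simp: shape_def)
        then show ?thesis using fill[OF True] by (simp add: row_filling_def)
      qed (simp add: empty)
      then show ?thesis using x by simp
    qed
    have filt: "?s s j i = s j i" for j i using lt_b by (auto simp: filter_id_conv)
    have filt': "?s ?t j i = s j i" for j i using filt by auto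
    then show "(\<lambda>j i. ?s ?t j i) = s" by auto
    show "(\<lambda>i. length (?s ?t r i)) = \<mu>" unfolding filt' using fr by (auto simp: row_filling_def)
    have "(\<Sum>i<N. \<Lambda> r i - \<mu> i) + (\<Sum>i<N. \<mu> i) = (\<Sum>i<N. \<Lambda> r i)"
      unfolding sum.distrib[symmetric] using le by (intro sum.cong) auto
    then have m: "(\<Sum>i<N. \<Lambda> r i - \<mu> i) = m" using \<mu> by (simp add: hstrips_def)
    have "(\<Sum>j<k. \<Sum>i<N. mset (?t j i))
        = (\<Sum>j<k. (\<Sum>i<N. mset (s j i)) + (if j = r then \<Sum>i<N. replicate_mset (\<Lambda> r i - \<mu> i) b else {#}))"
      by (intro sum.cong) (auto simp: sum.distrib)
    also have "\<dots> = M + (\<Sum>i<N. replicate_mset (\<Lambda> r i - \<mu> i) b)"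
      using r(1) by (simp add: sum.distrib content)
    also have "(\<Sum>i<N. replicate_mset (\<Lambda> r i - \<mu> i) b) = replicate_mset m b"
      unfolding m[symmetric] by (rule multiset_eqI) (auto simp: count_sum)
    finally have "(\<Sum>j<k. \<Sum>i<N. mset (?t j i)) = replicate_mset m b + M" by simp
    moreover have "row_filling (\<Lambda> r) (\<lambda>i. s r i @ replicate (\<Lambda> r i - \<mu> i) b)"
      using fr lt_b le by (rule row_filling_add_max)
    moreover have "row_filling (\<Lambda> j) (s j)" if "j < k" "j \<noteq> r" for j
      using fill[OF that(1)] that(2) by simp
    ultimately show "?t \<in> row_tableaux k N p \<Lambda> (replicate_mset m b + M)"
      using res empty r by (auto simp: row_tableaux_def split: if_splits)
  }
qed

lemma hstrips_shape: "\<mu> \<in> hstrips N \<nu> m \<Longrightarrow> shape N \<nu> \<Longrightarrow> shape N \<mu>"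
  unfolding hstrips_def shape_def antimono_iff_le_Suc by (auto intro: order_trans) (metis le_zero_eq)

lemma finite_hstrips:
  assumes "shape N \<nu>"
  shows "finite (hstrips N \<nu> m)"
proof (rule finite_imageD[where f = beta], rule finite_subset[OF _ finite_lower])
  show "beta ` hstrips N \<nu> m \<subseteq> lower N (beta \<nu>) m"
  proof
    fix w assume "w \<in> beta ` hstrips N \<nu> m"
    then obtain \<mu> where \<mu>: "\<mu> \<in> hstrips N \<nu> m" and w: "w = beta \<mu>" by auto
    have "\<mu> i = \<nu> i" if "i \<ge> N" for i
      using hstrips_shape[OF \<mu> assms] assms that by (simp add: shape_def)
    moreover have "(\<Sum>i<N. beta \<nu> i) = int m + (\<Sum>i<N. beta \<mu> i)"
      using \<mu> by (simp add: hstrips_def beta_def sum_subtractf flip: of_nat_sum)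
    ultimately show "w \<in> lower N (beta \<nu>) m"
      using \<mu> by (auto simp: w lower_def hstrips_def beta_def)
  qed
qed (auto simp: inj_on_def beta_inj)

text \<open>The largest color fills the outermost strip, so it is the one split off, and the smaller
  colors form the functional to which the Pieri rule is applied. This is why alternation of
  \<open>colored_sum\<close> is carried along in the induction.\<close>

lemma colored_sum_tableaux:
  fixes M :: "'c::linorder multiset"
  assumes "k > 0" and "\<And>j. j < k \<Longrightarrow> shape N (\<Lambda> j)"
  shows "finite (row_tableaux k N p \<Lambda> M) \<and>
    colored_sum k N p M (\<lambda>j. beta (\<Lambda> j)) = of_nat (card (row_tableaux k N p \<Lambda> M))"
proof -
  have "malternating k N (colored_sum k N p M) \<and> (\<forall>\<Lambda>. (\<forall>j<k. shape N (\<Lambda> j)) \<longrightarrow>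
      finite (row_tableaux k N p \<Lambda> M) \<and>
      colored_sum k N p M (\<lambda>j. beta (\<Lambda> j)) = of_nat (card (row_tableaux k N p \<Lambda> M)))"
    if "finite S" "set_mset M \<subseteq> S" for S and M :: "'c multiset"
    using that
  proof (induction S arbitrary: M rule: finite_linorder_max_induct)
    case empty
    then have M: "M = {#}" by simp
    have "finite (row_tableaux k N p \<Lambda> {#}) \<and>
        meps k N (\<lambda>j. beta (\<Lambda> j)) = of_nat (card (row_tableaux k N p \<Lambda> {#}))"
      if shape: "\<forall>j<k. shape N (\<Lambda> j)" for \<Lambda>
    proof -
      let ?z = "\<forall>j<k. \<Lambda> j = (\<lambda>_. 0)"
      have "t = (\<lambda>_ _. []) \<and> ?z" if t: "t \<in> row_tableaux k N p \<Lambda> {#}" for t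
      proof -
        have len: "length (t j i) = \<Lambda> j i" if "j < k" for i j
          using t that by (auto simp: row_tableaux_def row_filling_def)
        have "t j i = []" for j i
        proof (cases "j < k \<and> i < N")
          case True
          have "x \<notin> set (t j i)" for x
          proof
            assume "x \<in> set (t j i)"
            then have "x \<in># (\<Sum>j<k. \<Sum>i<N. mset (t j i))"
              using True by (auto simp: in_mset_sum)
            then show False using t by (simp add: row_tableaux_def)
          qed
          then show ?thesis by (metis last_in_set)
        next
          case False
          then show ?thesis
            using t len[of j i] shape by (cases "j < k") (auto simp: row_tableaux_def shape_def)
        qed
        then show ?thesis using len by (auto simp: fun_eq_iff)
      qed
      moreover have "(\<lambda>_ _. []) \<in> row_tableaux k N p \<Lambda> {#}" if ?z
        using that by (auto simp: row_tableaux_def row_filling_def)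
      ultimately have "row_tableaux k N p \<Lambda> {#} = (if ?z then {\<lambda>_ _. []} else {})" by auto
      moreover have "meps k N (\<lambda>j. beta (\<Lambda> j)) = (\<Prod>j<k. if \<Lambda> j = (\<lambda>_. 0) then 1 else 0)"
        unfolding meps_def using shape by (intro prod.cong) (auto simp: eps_beta)
      ultimately show ?thesis by (auto intro: prod.neutral)
    qed
    then show ?case using M by (simp add: colored_sum_empty malternating_meps)
  next
    case (insert b S)
    \<comment> \<open>\<open>b\<close> may be absent from \<open>M\<close>; then
      \<open>m = 0\<close> and the strip removed is empty.\<close>
    define M' where "M' = filter_mset (\<lambda>c. c \<noteq> b) M"
    define m where "m = count M b"
    have M: "M = replicate_mset m b + M'" by (auto simp: M'_def m_def intro!: multiset_eqI)
    have M'S: "set_mset M' \<subseteq> S" using insert.prems by (auto simp: M'_def)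
    have max: "c < b" if "c \<in># M'" for c using M'S insert.hyps that by auto
    define r where "r = nat (p b mod int k)"
    have r: "r < k" "int r = p b mod int k" using assms(1) by (auto simp: r_def nat_less_iff)
    have "b \<notin># M'" by (simp add: M'_def)
    note step = colored_sum_add[where p = p, OF assms(1) this r(2), of N m]
    note IH = insert.IH[OF M'S]
    have "finite (row_tableaux k N p \<Lambda> M) \<and>
        colored_sum k N p M (\<lambda>j. beta (\<Lambda> j)) = of_nat (card (row_tableaux k N p \<Lambda> M))"
      if shape: "\<forall>j<k. shape N (\<Lambda> j)" for \<Lambda>
    proof -
      have IH': "finite (row_tableaux k N p (\<Lambda>(r := \<mu>)) M') \<and>
          colored_sum k N p M' (\<lambda>j. beta ((\<Lambda>(r := \<mu>)) j))
            = of_nat (card (row_tableaux k N p (\<Lambda>(r := \<mu>)) M'))"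
        if "\<mu> \<in> hstrips N (\<Lambda> r) m" for \<mu>
      proof -
        have "\<forall>j<k. shape N ((\<Lambda>(r := \<mu>)) j)" using shape hstrips_shape[OF that] r(1) by simp
        then show ?thesis using IH by blast
      qed
      let ?X = "SIGMA \<mu> : hstrips N (\<Lambda> r) m. row_tableaux k N p (\<Lambda>(r := \<mu>)) M'"
      have fin: "finite (hstrips N (\<Lambda> r) m)" using finite_hstrips shape r(1) by blast
      have finX: "finite ?X" using IH' by (intro finite_SigmaI[OF fin]) auto
      have bij: "bij_betw (\<lambda>t. (\<lambda>i. length (filter (\<lambda>x. x \<noteq> b) (t r i)), \<lambda>j i. filter (\<lambda>x. x \<noteq> b) (t j i)))
          (row_tableaux k N p \<Lambda> M) ?X"
        unfolding M using shape max by (intro row_tableaux_bij r) auto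
      have "colored_sum k N p M (\<lambda>j. beta (\<Lambda> j))
          = (\<Sum>\<mu>\<in>hstrips N (\<Lambda> r) m. of_nat (card (row_tableaux k N p (\<Lambda>(r := \<mu>)) M')))"
      proof -
        have "colored_sum k N p M (\<lambda>j. beta (\<Lambda> j))
            = (\<Sum>\<mu>\<in>hstrips N (\<Lambda> r) m. colored_sum k N p M' (\<lambda>j. beta ((\<Lambda>(r := \<mu>)) j)))"
          unfolding M step using IH shape r(1) by (intro hop_beta) auto
        then show ?thesis using IH' by (simp cong: sum.cong)
      qed
      also have "\<dots> = of_nat (card ?X)" using fin IH' by (subst card_SigmaI) auto
      also have "card ?X = card (row_tableaux k N p \<Lambda> M)" using bij_betw_same_card[OF bij] by simp
      finally show ?thesis using bij_betw_finite[OF bij] finX by simp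
    qed
    moreover have "malternating k N (colored_sum k N p M)"
      unfolding M step using IH by (intro malternating_hop) simp
    ultimately show ?case by blast
  qed
  from this[of "set_mset M" M] show ?thesis using assms(2) by simp
qed

section \<open>Summation over the group\<close>

definition unity_roots :: "nat \<Rightarrow> complex set" where
  "unity_roots k = root_u k ` {..<k}"

lemma root_u_cis: "root_u k j = cis (2 * pi * real j / real k)"
  by (simp add: root_u_def cis_conv_exp mult_ac)

lemma unity_roots_eq: "k > 0 \<Longrightarrow> unity_roots k = {z. z ^ k = 1}"
  using bij_betw_roots_unity[of k] by (auto simp: unity_roots_def root_u_cis bij_betw_def)

lemma unity_roots_norm: "z \<in> unity_roots k \<Longrightarrow> norm z = 1"
  by (auto simp: unity_roots_def root_u_cis)

lemma unity_roots_nonzero: "z \<in> unity_roots k \<Longrightarrow> z \<noteq> 0"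
  using unity_roots_norm by fastforce

lemma unity_roots_powi_mod:
  assumes "k > 0" "z \<in> unity_roots k"
  shows "z powi e = z powi (e mod int k)"
proof -
  have z: "z ^ k = 1" "z \<noteq> 0" using assms unity_roots_eq unity_roots_nonzero by auto
  have "z powi e = z powi (int k * (e div int k) + e mod int k)" by simp
  also have "\<dots> = (z powi int k) powi (e div int k) * z powi (e mod int k)"
    using z(2) by (simp only: power_int_add power_int_mult simp_thms)
  also have "z powi int k = 1" using z(1) by simp
  finally show ?thesis by simp
qed

text \<open>If \<open>k\<close> does not divide \<open>e\<close>, multiplication by
  \<open>\<omega>\<close> permutes the roots and multiplies the sum by
  \<open>\<omega> powi e\<close>, which is not 1, so the sum is 0.\<close>

lemma sum_unity_roots:
  assumes k: "k > 0"
  shows "(\<Sum>z\<in>unity_roots k. z powi e) = (if int k dvd e then of_nat k else 0)"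
proof (cases "int k dvd e")
  case True
  then have "z powi e = 1" if "z \<in> unity_roots k" for z
    using unity_roots_powi_mod[OF k that, of e] by simp
  then have "(\<Sum>z\<in>unity_roots k. z powi e) = of_nat (card (unity_roots k))" by simp
  then show ?thesis using True k by (simp add: unity_roots_eq card_roots_unity_eq)
next
  case False
  define r where "r = nat (e mod int k)"
  have r: "0 < r" "r < k" "int r = e mod int k"
  proof -
    have "e mod int k \<noteq> 0" "0 \<le> e mod int k" "e mod int k < int k"
      using False k by (simp_all add: dvd_eq_mod_eq_0)
    then show "0 < r" "r < k" "int r = e mod int k" by (auto simp: r_def)
  qed
  define \<omega> where "\<omega> = root_u k 1"
  have \<omega>: "\<omega> \<in> unity_roots k" using r unfolding unity_roots_def \<omega>_def by auto
  have "\<omega> powi e = \<omega> ^ r" using unity_roots_powi_mod[OF k \<omega>, of e] unfolding r(3)[symmetric] by simp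
  also have "\<omega> ^ r = cis (2 * pi * real r / real k)"
    by (simp add: \<omega>_def root_u_cis DeMoivre mult_ac)
  also have "\<dots> \<noteq> cis (2 * pi * real 0 / real k)"
    using inj_onD[OF bij_betw_imp_inj_on[OF bij_betw_roots_unity[OF k]], of r 0] r k by auto
  finally have ne: "\<omega> powi e \<noteq> 1" by simp
  have nz: "\<omega> \<noteq> 0" using \<omega> by (rule unity_roots_nonzero)
  have "(\<Sum>z\<in>unity_roots k. z powi e) = (\<Sum>z\<in>unity_roots k. (\<omega> * z) powi e)"
    by (rule sum.reindex_bij_witness[where i = "\<lambda>z. \<omega> * z" and j = "\<lambda>z. z / \<omega>"])
      (use \<omega> nz in \<open>auto simp: unity_roots_eq[OF k] power_mult_distrib power_divide\<close>)
  also have "\<dots> = \<omega> powi e * (\<Sum>z\<in>unity_roots k. z powi e)"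
    by (simp add: power_int_mult_distrib sum_distrib_left)
  finally have "(\<omega> powi e - 1) * (\<Sum>z\<in>unity_roots k. z powi e) = 0"
    by (simp add: algebra_simps)
  then show ?thesis using ne False by simp
qed

text \<open>Orthogonality of the characters of the cyclic group: on the roots of unity conjugation
  is inversion. The bound \<open>a < k\<close> turns the congruence modulo \<open>k\<close> into
  equality with the remainder.\<close>

lemma sum_unity_roots_character:
  assumes "k > 0" "a < k"
  shows "(\<Sum>z\<in>unity_roots k. cnj z ^ a * z powi b)
    = (if int a = b mod int k then of_nat k else 0)"
proof -
  have "cnj z ^ a * z powi b = z powi (b - int a)" if "z \<in> unity_roots k" for z
  proof -
    have nz: "z \<noteq> 0" using that by (rule unity_roots_nonzero)
    have "cnj z * z = 1" using unity_roots_norm[OF that]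
      using complex_norm_square[of z] by (simp add: mult.commute)
    then have "cnj z = inverse z" using nz by (simp add: field_simps)
    then show ?thesis using nz
      by (simp add: power_int_diff power_inverse divide_inverse mult.commute)
  qed
  then have "(\<Sum>z\<in>unity_roots k. cnj z ^ a * z powi b)
      = (if int k dvd b - int a then of_nat k else 0)"
    using sum_unity_roots[OF assms(1)] by simp
  also have "int k dvd b - int a \<longleftrightarrow> int a = b mod int k"
    using assms mod_eq_dvd_iff[of b "int k" "int a"] by auto
  finally show ?thesis .
qed

section \<open>Group elements as permutations with entries\<close>

definition wmat :: "nat \<Rightarrow> (nat \<Rightarrow> nat) \<Rightarrow> (nat \<Rightarrow> complex) \<Rightarrow> complex mat" where
  "wmat n \<pi> u = mat n n (\<lambda>(i, j). if j = \<pi> i then u i else 0)"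

lemma wmat_props:
  assumes \<pi>: "\<pi> permutes {..<n}" and u: "\<And>i. i < n \<Longrightarrow> u i \<in> unity_roots k"
  shows "wmat n \<pi> u \<in> wreath k n" "i < n \<Longrightarrow> col_of (wmat n \<pi> u) i = \<pi> i"
    "i < n \<Longrightarrow> entry_of (wmat n \<pi> u) i = u i"
proof -
  have in_n: "\<pi> i < n \<longleftrightarrow> i < n" for i using permutes_in_image[OF \<pi>, of i] by simp
  have nz: "i < n \<Longrightarrow> u i \<noteq> 0" for i using u unity_roots_nonzero by blast
  have entry: "wmat n \<pi> u $$ (i, j) = (if j = \<pi> i then u i else 0)" if "i < n" "j < n" for i j
    using that by (simp add: wmat_def)
  have dim: "wmat n \<pi> u \<in> carrier_mat n n" "dim_col (wmat n \<pi> u) = n" by (auto simp: wmat_def)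
  have surj: "\<exists>!i. i < n \<and> \<pi> i = j" if "j < n" for j
    using that in_n[of "inv_into UNIV \<pi> j"] permutes_inverses[OF \<pi>] by (intro ex1I[of _ "inv_into UNIV \<pi> j"]) auto
  have ne: "wmat n \<pi> u $$ (i, j) \<noteq> 0 \<longleftrightarrow> \<pi> i = j" if "i < n" "j < n" for i j
    using entry[OF that] nz[OF that(1)] by auto
  show "wmat n \<pi> u \<in> wreath k n"
    unfolding wreath_def unity_roots_def[symmetric]
  proof (intro CollectI conjI allI impI dim)
    fix i assume i: "i < n"
    show "\<exists>!j. j < n \<and> wmat n \<pi> u $$ (i, j) \<noteq> 0"
      using i in_n[of i] by (intro ex1I[of _ "\<pi> i"]) (auto simp: ne)
  next
    fix j assume j: "j < n"
    show "\<exists>!i. i < n \<and> wmat n \<pi> u $$ (i, j) \<noteq> 0"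
      using surj[OF j] by (simp add: ne[OF _ j] cong: conj_cong)
  qed (use u in \<open>auto simp: entry split: if_splits\<close>)
  show col: "col_of (wmat n \<pi> u) i = \<pi> i" if "i < n" for i
    unfolding col_of_def dim(2)
    using that in_n[of i] by (intro the_equality) (auto simp: ne)
  show "i < n \<Longrightarrow> entry_of (wmat n \<pi> u) i = u i"
    using in_n[of i] by (simp add: entry_of_def col entry)
qed

text \<open>Makes a sum over the group a sum over permutations and, independently, over the entries
  of the \<open>n\<close> rows.\<close>

lemma wreath_bij:
  "bij_betw (\<lambda>(\<pi>, u). wmat n \<pi> u)
    ({\<pi>. \<pi> permutes {..<n}} \<times> ({..<n} \<rightarrow>\<^sub>E unity_roots k)) (wreath k n)"
\<comment> \<open>Outside \<open>{..<n}\<close> the permutation must be the identity and the entry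
  function \<open>undefined\<close>, as \<open>permutes\<close> and
  \<open>\<rightarrow>\<^sub>E\<close> prescribe.\<close>
proof (rule bij_betw_byWitness[where
      f' = "\<lambda>\<sigma>. (\<lambda>i. if i < n then col_of \<sigma> i else i, \<lambda>i\<in>{..<n}. entry_of \<sigma> i)"])
  show "\<forall>x\<in>{\<pi>. \<pi> permutes {..<n}} \<times> ({..<n} \<rightarrow>\<^sub>E unity_roots k).
      (\<lambda>i. if i < n then col_of (case x of (\<pi>, u) \<Rightarrow> wmat n \<pi> u) i else i,
       \<lambda>i\<in>{..<n}. entry_of (case x of (\<pi>, u) \<Rightarrow> wmat n \<pi> u) i) = x"
  proof
    fix x assume x: "x \<in> {\<pi>. \<pi> permutes {..<n}} \<times> ({..<n} \<rightarrow>\<^sub>E unity_roots k)"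
    obtain \<pi> u where xp: "x = (\<pi>, u)" by (cases x)
    have *: "\<pi> permutes {..<n}" "u \<in> {..<n} \<rightarrow>\<^sub>E unity_roots k" using x xp by auto
    have u: "u i \<in> unity_roots k" if "i < n" for i using * that by (auto simp: PiE_def Pi_def)
    have "(\<lambda>i. if i < n then col_of (wmat n \<pi> u) i else i) = \<pi>"
      using wmat_props(2)[OF *(1) u] permutes_not_in[OF *(1)] by (auto simp: fun_eq_iff)
    moreover have "(\<lambda>i\<in>{..<n}. entry_of (wmat n \<pi> u) i) = u"
      using wmat_props(3)[OF *(1) u] *(2)
      by (auto simp: fun_eq_iff restrict_def PiE_def extensional_def)
    ultimately show "(\<lambda>i. if i < n then col_of (case x of (\<pi>, u) \<Rightarrow> wmat n \<pi> u) i else i,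
       \<lambda>i\<in>{..<n}. entry_of (case x of (\<pi>, u) \<Rightarrow> wmat n \<pi> u) i) = x"
      unfolding xp prod.case by simp
  qed
  show "(\<lambda>(\<pi>, u). wmat n \<pi> u) ` ({\<pi>. \<pi> permutes {..<n}} \<times> ({..<n} \<rightarrow>\<^sub>E unity_roots k)) \<subseteq> wreath k n"
  proof clarify
    fix \<pi> u assume *: "\<pi> permutes {..<n}" "u \<in> {..<n} \<rightarrow>\<^sub>E unity_roots k"
    then show "wmat n \<pi> u \<in> wreath k n"
      by (intro wmat_props(1)) (auto simp: PiE_def Pi_def)
  qed
  have main: "(\<lambda>i. if i < n then col_of \<sigma> i else i) permutes {..<n} \<and>
      (\<lambda>i\<in>{..<n}. entry_of \<sigma> i) \<in> {..<n} \<rightarrow>\<^sub>E unity_roots k \<and>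
      wmat n (\<lambda>i. if i < n then col_of \<sigma> i else i) (\<lambda>i\<in>{..<n}. entry_of \<sigma> i) = \<sigma>"
    if \<sigma>: "\<sigma> \<in> wreath k n" for \<sigma>
  proof -
    let ?\<pi> = "\<lambda>i. if i < n then col_of \<sigma> i else i"
    have dim: "\<sigma> \<in> carrier_mat n n" "dim_col \<sigma> = n" "dim_row \<sigma> = n"
      and row: "\<And>i. i < n \<Longrightarrow> \<exists>!j. j < n \<and> \<sigma> $$ (i, j) \<noteq> 0"
      and column: "\<And>j. j < n \<Longrightarrow> \<exists>!i. i < n \<and> \<sigma> $$ (i, j) \<noteq> 0"
      and val: "\<And>i j. i < n \<Longrightarrow> j < n \<Longrightarrow> \<sigma> $$ (i, j) \<noteq> 0 \<Longrightarrow> \<sigma> $$ (i, j) \<in> unity_roots k"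
      using \<sigma> by (auto simp: wreath_def unity_roots_def)
    have col: "col_of \<sigma> i < n" "\<sigma> $$ (i, col_of \<sigma> i) \<noteq> 0" if "i < n" for i
      using theI'[OF row[OF that]] unfolding col_of_def dim by auto
    have uniq: "j = col_of \<sigma> i" if "i < n" "j < n" "\<sigma> $$ (i, j) \<noteq> 0" for i j
      using row[OF that(1)] col[OF that(1)] that by blast
    have inj: "inj_on ?\<pi> {..<n}"
    proof (rule inj_onI)
      fix i i' assume i: "i \<in> {..<n}" "i' \<in> {..<n}" "?\<pi> i = ?\<pi> i'"
      then show "i = i'" using column[of "col_of \<sigma> i"] col[of i] col[of i'] by auto
    qed
    have "?\<pi> ` {..<n} \<subseteq> {..<n}" using col by auto
    then have "bij_betw ?\<pi> {..<n} {..<n}"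
      using inj endo_inj_surj[OF finite_lessThan _ inj] by (simp only: bij_betw_def simp_thms)
    then have "?\<pi> permutes {..<n}" by (rule bij_imp_permutes) auto
    moreover have "(\<lambda>i\<in>{..<n}. entry_of \<sigma> i) \<in> {..<n} \<rightarrow>\<^sub>E unity_roots k"
      using col val by (auto simp: entry_of_def)
    moreover have "wmat n ?\<pi> (\<lambda>i\<in>{..<n}. entry_of \<sigma> i) = \<sigma>"
      using dim uniq by (intro eq_matI) (auto simp: wmat_def entry_of_def)
    ultimately show ?thesis by blast
  qed
  show "\<forall>\<sigma>\<in>wreath k n. (case (\<lambda>i. if i < n then col_of \<sigma> i else i, \<lambda>i\<in>{..<n}. entry_of \<sigma> i) of
      (\<pi>, u) \<Rightarrow> wmat n \<pi> u) = \<sigma>"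
    using main by simp
  show "(\<lambda>\<sigma>. (\<lambda>i. if i < n then col_of \<sigma> i else i, \<lambda>i\<in>{..<n}. entry_of \<sigma> i)) ` wreath k n
      \<subseteq> {\<pi>. \<pi> permutes {..<n}} \<times> ({..<n} \<rightarrow>\<^sub>E unity_roots k)"
    using main by blast
qed

text \<open>The last claim replaces constancy on cycles by invariance under \<open>\<pi>\<close>.
  For a fixed word this is a condition on \<open>\<pi>\<close> that defines a stabilizer, which can
  be counted.\<close>

lemma orbits_partition:
  fixes n :: nat
  assumes \<pi>: "\<pi> permutes {..<n}"
  shows "pairwise disjnt (orbit \<pi> ` {..<n})" "\<Union>(orbit \<pi> ` {..<n}) = {..<n}"
    "(\<forall>c\<in>orbit \<pi> ` {..<n}. \<forall>s\<in>c. \<forall>t\<in>c. f s = f t) \<longleftrightarrow> (\<forall>i<n. f (\<pi> i) = f i)"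
proof -
  have perm: "permutation \<pi>" by (rule permutes_imp_permutation[OF finite_lessThan \<pi>])
  have self: "i \<in> orbit \<pi> i" for i by (rule permutation_self_in_orbit[OF perm])
  have sub: "orbit \<pi> i \<subseteq> {..<n}" if "i < n" for i using permutes_orbit_subset[OF \<pi>] that by blast
  show "\<Union>(orbit \<pi> ` {..<n}) = {..<n}" using self sub by blast
  have "orbit \<pi> i = orbit \<pi> j" if "x \<in> orbit \<pi> i" "x \<in> orbit \<pi> j" for x i j
    using that orbit_cyclic_eq3[OF cyclic_on_orbit'[OF perm]] by metis
  then show "pairwise disjnt (orbit \<pi> ` {..<n})"
    unfolding pairwise_def disjnt_def by blast
  show "(\<forall>c\<in>orbit \<pi> ` {..<n}. \<forall>s\<in>c. \<forall>t\<in>c. f s = f t) \<longleftrightarrow> (\<forall>i<n. f (\<pi> i) = f i)" (is "?L \<longleftrightarrow> ?R")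
  proof
    assume ?L
    then have "f (\<pi> i) = f i" if "i < n" for i
      using that self[of i] orbit.base[of \<pi> i] by (meson imageI lessThan_iff)
    then show ?R by blast
  next
    assume R: ?R
    have "f x = f i" if "x \<in> orbit \<pi> i" "i < n" for x i
      using that
    proof (induction rule: orbit.induct)
      case (step y)
      then have "y < n" using sub by auto
      then show ?case using R step by simp
    qed (use R in simp)
    then show ?L by auto
  qed
qed

lemma cycles_of_wmat:
  assumes \<pi>: "\<pi> permutes {..<n}" and u: "\<And>i. i < n \<Longrightarrow> u i \<in> unity_roots k"
  shows "cycles_of (wmat n \<pi> u) = orbit \<pi> ` {..<n}"
proof -
  have "orbit (col_of (wmat n \<pi> u)) i = orbit \<pi> i" if "i < n" for i
  proof (rule orbit_cong)
    have "permutation \<pi>" by (rule permutes_imp_permutation[OF finite_lessThan \<pi>])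
    then show "i \<in> orbit \<pi> i" by (rule permutation_self_in_orbit)
    show "col_of (wmat n \<pi> u) s = \<pi> s" if "s \<in> orbit \<pi> i" for s
      using permutes_orbit_subset[OF \<pi>, of i] that \<open>i < n\<close> by (intro wmat_props(2)[OF \<pi> u]) auto
  qed
  then show ?thesis by (simp add: cycles_of_def wmat_def)
qed

definition content :: "nat \<Rightarrow> (nat \<Rightarrow> 'a) \<Rightarrow> 'a multiset" where
  "content n g = image_mset g (mset_set {..<n})"

text \<open>Positive parts with sum at most \<open>n\<close> fill at most \<open>n\<close> rows, so
  \<open>N = n\<close> serves all components at once.\<close>

lemma multipartition_component:
  assumes \<gamma>: "is_multipartition k n \<gamma>" and l: "l \<in> set \<gamma>"
  shows "is_partition l \<and> length l \<le> n"
proof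
  show p: "is_partition l" using \<gamma> l by (simp add: is_multipartition_def)
  have "length l \<le> sum_list l"
  proof -
    have "\<forall>x\<in>set l. 1 \<le> x" using p by (auto simp: is_partition_def Suc_le_eq intro: gr0I)
    then have "sum_list (map (\<lambda>_. 1) l) \<le> sum_list (map (\<lambda>x. x) l)" by (intro sum_list_mono) auto
    then show ?thesis by (simp add: sum_list_triv)
  qed
  also have "sum_list l \<le> (\<Sum>l\<leftarrow>\<gamma>. sum_list l)" using l by (intro member_le_sum_list) auto
  finally show "length l \<le> n" using \<gamma> by (simp add: is_multipartition_def)
qed

lemma wreath_char_frobenius:
  assumes cs: "cycle_enumeration k n cs" and \<gamma>: "is_multipartition k n \<gamma>"
    and \<pi>: "\<pi> permutes {..<n}" and u: "\<And>i. i < n \<Longrightarrow> u i \<in> unity_roots k"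
  shows "wreath_char cs \<gamma> (wmat n \<pi> u) =
    (\<Sum>g | g \<in> {..<n} \<rightarrow>\<^sub>E {..<k} \<times> {..<n} \<and> (\<forall>i<n. g (\<pi> i) = g i).
       (\<Prod>i<n. u i ^ fst (g i)) * meps k n (mdrop (\<lambda>j. beta (part (\<gamma> ! j))) (content n g)))"
proof -
  define \<sigma> where "\<sigma> = wmat n \<pi> u"
  let ?B = "\<lambda>j. beta (part (\<gamma> ! j))"
  let ?au = "map (\<lambda>c. (card c, \<Prod>i\<in>c. u i)) (cs \<sigma>)"
  have "\<sigma> \<in> wreath k n" unfolding \<sigma>_def by (rule wmat_props(1)[OF \<pi> u])
  then have cs': "distinct (cs \<sigma>)" "set (cs \<sigma>) = orbit \<pi> ` {..<n}"
    using cs cycles_of_wmat[OF \<pi> u] by (auto simp: cycle_enumeration_def \<sigma>_def)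
  note orb = orbits_partition[OF \<pi>]
  have sub: "c \<subseteq> {..<n}" if "c \<in> set (cs \<sigma>)" for c using that cs'(2) orb(2) by auto
  have fin: "finite c \<and> c \<noteq> {}" if "c \<in> set (cs \<sigma>)" for c
    using finite_subset[OF sub[OF that]] that orbit_nonempty[of \<pi>] unfolding cs'(2) by blast
  have C: "C_type \<sigma> c = (\<Prod>i\<in>c. u i)" if "c \<in> set (cs \<sigma>)" for c
    unfolding C_type_def \<sigma>_def using sub[OF that] by (intro prod.cong refl wmat_props(3)[OF \<pi> u]) auto
  have len: "length \<gamma> = k" using \<gamma> by (simp add: is_multipartition_def)
  note part = multipartition_component[OF \<gamma>]
  have "wreath_char cs \<gamma> \<sigma> = (\<Sum>zs\<in>removal_seqs \<gamma> (map fst ?au).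
       \<Prod>s<length ?au. snd (?au ! s) ^ fst (zs ! s) * (-1) ^ ht (snd (zs ! s)))"
    unfolding wreath_char_def using C by (auto simp: comp_def intro!: sum.cong prod.cong)
  also have "\<dots> = mn k n ?au ?B"
  proof -
    have "a > 0" if "a \<in> fst ` set ?au" for a using that fin by (auto simp: card_gt_0_iff)
    then show ?thesis
      using murnaghan_nakayama_removal[of \<gamma> n ?au] part unfolding len by blast
  qed
  also have "\<dots> = (\<Sum>g\<in>labelings k n (set (cs \<sigma>)). (\<Prod>i\<in>\<Union>(set (cs \<sigma>)). u i ^ fst (g i)) *
       meps k n (\<lambda>j i. ?B j i - int (card {t \<in> \<Union>(set (cs \<sigma>)). g t = (j, i)})))"
    by (rule mn_cycles[OF cs'(1) _ fin]) (simp add: cs' orb)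
  also have "labelings k n (set (cs \<sigma>)) =
      {g. g \<in> {..<n} \<rightarrow>\<^sub>E {..<k} \<times> {..<n} \<and> (\<forall>i<n. g (\<pi> i) = g i)}"
    unfolding labelings_def cs' orb(2,3) by simp
  also have "\<Union>(set (cs \<sigma>)) = {..<n}" by (simp only: cs' orb(2))
  finally have "wreath_char cs \<gamma> \<sigma> =
    (\<Sum>g | g \<in> {..<n} \<rightarrow>\<^sub>E {..<k} \<times> {..<n} \<and> (\<forall>i<n. g (\<pi> i) = g i).
       (\<Prod>i<n. u i ^ fst (g i)) * meps k n (\<lambda>j i. ?B j i - int (card {t \<in> {..<n}. g t = (j, i)})))" .
  \<comment> \<open>Only the number of indices with each label enters, so this factor is the same
    for all rearrangements of a labeling.\<close>
  moreover have "(\<lambda>j i. ?B j i - int (card {t \<in> {..<n}. g t = (j, i)})) = mdrop ?B (content n g)" for g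
    by (auto simp: fun_eq_iff mdrop_def content_def count_image_mset' count_mset_set
        intro!: arg_cong[where f = card])
  ultimately show ?thesis by (simp add: \<sigma>_def)
qed

text \<open>Orbit and stabilizer: all rearrangements of \<open>h0\<close> arise as
  \<open>permute_list \<pi> h0\<close>, and the permutations leading to the same \<open>h\<close>
  form a coset of its stabilizer, so the stabilizers add up to the whole symmetric group.\<close>

lemma sum_card_stabilizers:
  fixes A :: "'a multiset"
  assumes A: "size A = n"
  shows "(\<Sum>h | mset h = A. card {\<pi>. \<pi> permutes {..<n} \<and> (\<forall>i<n. h ! \<pi> i = h ! i)}) = fact n"
proof -
  let ?P = "{\<pi>. \<pi> permutes {..<n}}"
  obtain h0 where h0: "mset h0 = A" using ex_mset by blast
  have len: "length h = n" if "mset h = A" for h using that A by (metis size_mset)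
  have finP: "finite ?P" by (simp add: finite_permutations)
  have img: "(\<lambda>\<pi>. permute_list \<pi> h0) ` ?P = {h. mset h = A}"
  proof (intro equalityI subsetI)
    fix h assume "h \<in> {h. mset h = A}"
    then obtain \<pi> where "\<pi> permutes {..<length h0}" "permute_list \<pi> h0 = h"
      using mset_eq_permutation[of h h0] h0 by auto
    then show "h \<in> (\<lambda>\<pi>. permute_list \<pi> h0) ` ?P" using len[OF h0] by auto
  qed (use h0 len in auto)
  have fiber: "card {\<pi> \<in> ?P. permute_list \<pi> h0 = h}
      = card {\<pi>. \<pi> permutes {..<n} \<and> (\<forall>i<n. h ! \<pi> i = h ! i)}" if h: "mset h = A" for h
  proof -
    obtain \<pi>0 where \<pi>0: "\<pi>0 permutes {..<n}" "permute_list \<pi>0 h0 = h" using img h by force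
    have nth: "permute_list \<pi> h0 ! i = h0 ! \<pi> i" if "\<pi> permutes {..<n}" "i < n" for \<pi> i
      using permute_list_nth[of \<pi> h0 i] that len[OF h0] by simp
    have bnd: "\<pi> i < n" if "\<pi> permutes {..<n}" "i < n" for \<pi> i
      using permutes_in_image[OF that(1), of i] that(2) by simp
    have inv: "inv_into UNIV \<pi>0 permutes {..<n}" using \<pi>0(1) by (rule permutes_inv)
    \<comment> \<open>Composition with one fixed \<open>\<pi>0\<close> that leads to
      \<open>h\<close> carries the stabilizer of \<open>h\<close> onto the fiber.\<close>
    have "bij_betw (\<lambda>\<tau>. \<pi>0 \<circ> \<tau>) {\<pi>. \<pi> permutes {..<n} \<and> (\<forall>i<n. h ! \<pi> i = h ! i)}
        {\<pi> \<in> ?P. permute_list \<pi> h0 = h}"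
    proof (rule bij_betw_byWitness[where f' = "\<lambda>\<pi>. inv_into UNIV \<pi>0 \<circ> \<pi>"], safe)
      fix \<tau> assume \<tau>: "\<tau> permutes {..<n}"
      show "inv_into UNIV \<pi>0 \<circ> (\<pi>0 \<circ> \<tau>) = \<tau>" "\<pi>0 \<circ> (inv_into UNIV \<pi>0 \<circ> \<tau>) = \<tau>"
        using permutes_inv_o[OF \<pi>0(1)] by (simp_all add: o_assoc)
      show c: "\<pi>0 \<circ> \<tau> permutes {..<n}" "inv_into UNIV \<pi>0 \<circ> \<tau> permutes {..<n}"
        using \<tau> \<pi>0(1) inv by (auto intro: permutes_compose)
      show "permute_list (\<pi>0 \<circ> \<tau>) h0 = h" if "\<forall>i<n. h ! \<tau> i = h ! i"
      proof (rule nth_equalityI)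
        fix i assume "i < length (permute_list (\<pi>0 \<circ> \<tau>) h0)"
        then have i: "i < n" using len[OF h0] by simp
        have "permute_list (\<pi>0 \<circ> \<tau>) h0 ! i = h0 ! \<pi>0 (\<tau> i)" using nth[OF c(1) i] by simp
        also have "\<dots> = h ! \<tau> i" using nth[OF \<pi>0(1) bnd[OF \<tau> i]] \<pi>0(2) by simp
        finally show "permute_list (\<pi>0 \<circ> \<tau>) h0 ! i = h ! i" using that i by simp
      qed (simp add: len[OF h] len[OF h0])
      show "permute_list \<tau> h0 ! ((inv_into UNIV \<pi>0 \<circ> \<tau>) i) = permute_list \<tau> h0 ! i"
        if "i < n" "h = permute_list \<tau> h0" for i
      proof -
        have "permute_list \<tau> h0 ! ((inv_into UNIV \<pi>0 \<circ> \<tau>) i) = h0 ! \<pi>0 (inv_into UNIV \<pi>0 (\<tau> i))"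
          using nth[OF \<pi>0(1) bnd[OF c(2) that(1)]] \<pi>0(2) that(2) by simp
        also have "\<pi>0 (inv_into UNIV \<pi>0 (\<tau> i)) = \<tau> i" using permutes_inverses(1)[OF \<pi>0(1)] by simp
        finally show ?thesis using nth[OF \<tau> that(1)] by simp
      qed
    qed
    then show ?thesis by (simp add: bij_betw_same_card)
  qed
  have "fact n = card ?P" by (simp add: card_permutations)
  also have "\<dots> = (\<Sum>h\<in>(\<lambda>\<pi>. permute_list \<pi> h0) ` ?P. card {\<pi> \<in> ?P. permute_list \<pi> h0 = h})"
    using sum.image_gen[OF finP, of "\<lambda>_. 1::nat" "\<lambda>\<pi>. permute_list \<pi> h0"] by simp
  also have "\<dots> = (\<Sum>h | mset h = A. card {\<pi>. \<pi> permutes {..<n} \<and> (\<forall>i<n. h ! \<pi> i = h ! i)})"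
    unfolding img using fiber by (intro sum.cong) auto
  finally show ?thesis by simp
qed

text \<open>Signs are real, so the conjugation in the inner product affects only the powers of the
  entries.\<close>

lemma cnj_meps: "cnj (meps k N w) = meps k N w"
  unfolding meps_def eps_def by (auto simp: if_distrib intro!: prod.cong sum.cong)

lemma finite_mset_eq: "finite {h. mset h = A}"
proof (rule finite_subset)
  show "{h. mset h = A} \<subseteq> {xs. set xs \<subseteq> set_mset A \<and> length xs = size A}" by auto
qed (simp add: finite_lists_length_eq)

text \<open>The coefficient with which the word \<open>f\<close> enters the inner product before
  normalization, obtained by taking the finite sum over the group inside the sum over colorings. The
  value 0 for words that are not constant on the cycles gives all group elements the same set of
  words.\<close>

definition coloring_coeff :: "nat \<Rightarrow> nat \<Rightarrow> ('c \<Rightarrow> int) \<Rightarrow> (complex mat \<Rightarrow> complex) \<Rightarrow> 'c list \<Rightarrow> complex" where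
  "coloring_coeff k n p \<psi> f = (\<Sum>\<sigma>\<in>wreath k n. cnj (\<psi> \<sigma>) *
     (if \<forall>c\<in>cycles_of \<sigma>. \<forall>i\<in>c. \<forall>j\<in>c. f ! i = f ! j
      then \<Prod>i<n. entry_of \<sigma> i powi p (f ! i) else 0))"

text \<open>For a fixed permutation and labeling the entries vary independently, so the sum over
  them factors into \<open>n\<close> one-index sums, each \<open>k\<close> or 0. The sum over
  permutations that is left counts the joint stabilizer of \<open>f\<close> and
  \<open>g\<close>.\<close>

lemma coloring_coeff_frobenius:
  fixes f :: "'c list"
  assumes k: "k > 0" and cs: "cycle_enumeration k n cs" and \<gamma>: "is_multipartition k n \<gamma>"
  shows "coloring_coeff k n p (wreath_char cs \<gamma>) f =
    (\<Sum>g | g \<in> {..<n} \<rightarrow>\<^sub>E {..<k} \<times> {..<n} \<and> (\<forall>i<n. int (fst (g i)) = p (f ! i) mod int k).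
       of_nat k ^ n * (meps k n (mdrop (\<lambda>j. beta (part (\<gamma> ! j))) (content n g)) *
         of_nat (card {\<pi>. \<pi> permutes {..<n} \<and> (\<forall>i<n. f ! \<pi> i = f ! i \<and> g (\<pi> i) = g i)})))"
proof -
  let ?P = "{\<pi>. \<pi> permutes {..<n}}" and ?U = "{..<n} \<rightarrow>\<^sub>E unity_roots k"
    and ?G = "{..<n} \<rightarrow>\<^sub>E {..<k} \<times> {..<n}"
  define E where "E g = meps k n (mdrop (\<lambda>j. beta (part (\<gamma> ! j))) (content n g))" for g
  define fix\<^sub>f where "fix\<^sub>f \<pi> \<longleftrightarrow> (\<forall>i<n. f ! \<pi> i = f ! i)" for \<pi>
  define fix\<^sub>g where "fix\<^sub>g \<pi> g \<longleftrightarrow> (\<forall>i<n. g (\<pi> i) = g i)" for \<pi> and g :: "nat \<Rightarrow> nat \<times> nat"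
  have finP: "finite ?P" by (simp add: finite_permutations)
  have finG: "finite ?G" by (intro finite_PiE) auto
  have finU: "finite ?U" by (intro finite_PiE) (auto simp: unity_roots_def)
  have summand: "cnj (wreath_char cs \<gamma> (wmat n \<pi> u)) *
      (if \<forall>c\<in>cycles_of (wmat n \<pi> u). \<forall>i\<in>c. \<forall>j\<in>c. f ! i = f ! j
       then \<Prod>i<n. entry_of (wmat n \<pi> u) i powi p (f ! i) else 0)
      = (\<Sum>g\<in>?G. if fix\<^sub>f \<pi> \<and> fix\<^sub>g \<pi> g
           then E g * (\<Prod>i<n. cnj (u i) ^ fst (g i) * u i powi p (f ! i)) else 0)"
    if \<pi>: "\<pi> permutes {..<n}" and u': "u \<in> ?U" for \<pi> u
  proof -
    have u: "u i \<in> unity_roots k" if "i < n" for i using u' that by (auto simp: PiE_def Pi_def)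
    have cyc: "cycles_of (wmat n \<pi> u) = orbit \<pi> ` {..<n}"
      by (rule cycles_of_wmat[OF \<pi>]) (rule u)
    have frob: "wreath_char cs \<gamma> (wmat n \<pi> u) =
        (\<Sum>g | g \<in> ?G \<and> fix\<^sub>g \<pi> g. (\<Prod>i<n. u i ^ fst (g i)) * E g)"
      unfolding fix\<^sub>g_def E_def by (rule wreath_char_frobenius[OF cs \<gamma> \<pi>]) (rule u)
    have "(\<forall>c\<in>cycles_of (wmat n \<pi> u). \<forall>i\<in>c. \<forall>j\<in>c. f ! i = f ! j) \<longleftrightarrow> fix\<^sub>f \<pi>"
      unfolding fix\<^sub>f_def cyc by (rule orbits_partition(3)[OF \<pi>, of "\<lambda>i. f ! i"])
    moreover have "(\<Prod>i<n. entry_of (wmat n \<pi> u) i powi p (f ! i)) = (\<Prod>i<n. u i powi p (f ! i))"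
      by (intro prod.cong refl) (use wmat_props(3)[OF \<pi> u] in auto)
    moreover have "cnj (wreath_char cs \<gamma> (wmat n \<pi> u))
        = (\<Sum>g\<in>?G. if fix\<^sub>g \<pi> g then E g * (\<Prod>i<n. cnj (u i) ^ fst (g i)) else 0)"
    proof -
      have "cnj (wreath_char cs \<gamma> (wmat n \<pi> u))
          = (\<Sum>g | g \<in> ?G \<and> fix\<^sub>g \<pi> g. E g * (\<Prod>i<n. cnj (u i) ^ fst (g i)))"
        unfolding frob by (simp add: cnj_meps E_def mult.commute)
      also have "\<dots> = (\<Sum>g\<in>?G. if fix\<^sub>g \<pi> g then E g * (\<Prod>i<n. cnj (u i) ^ fst (g i)) else 0)"
        using finG by (rule sum.inter_filter)
      finally show ?thesis .
    qed
    ultimately show ?thesis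
      by (auto simp: sum_distrib_right prod.distrib intro!: sum.cong)
  qed
  define compat where "compat g \<longleftrightarrow> (\<forall>i<n. int (fst (g i)) = p (f ! i) mod int k)"
    for g :: "nat \<Rightarrow> nat \<times> nat"
  have usum: "(\<Sum>u\<in>?U. \<Prod>i<n. cnj (u i) ^ fst (g i) * u i powi p (f ! i))
      = (if compat g then of_nat k ^ n else 0)"
    if g: "g \<in> ?G" for g
  proof -
    have "(\<Sum>u\<in>?U. \<Prod>i<n. cnj (u i) ^ fst (g i) * u i powi p (f ! i))
        = (\<Prod>i<n. \<Sum>z\<in>unity_roots k. cnj z ^ fst (g i) * z powi p (f ! i))"
      by (rule prod_sum_PiE[symmetric]) (auto simp: unity_roots_def)
    also have "\<dots> = (\<Prod>i<n. if int (fst (g i)) = p (f ! i) mod int k then of_nat k else 0)"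
    proof (intro prod.cong refl sum_unity_roots_character k)
      fix i assume "i \<in> {..<n}"
      then have "g i \<in> {..<k} \<times> {..<n}" using g by (auto simp: PiE_def Pi_def)
      then show "fst (g i) < k" by auto
    qed
    also have "\<dots> = (if compat g then of_nat k ^ n else 0)"
      by (auto simp: compat_def prod_zero_iff)
    finally show ?thesis .
  qed
  have "coloring_coeff k n p (wreath_char cs \<gamma>) f
      = (\<Sum>(\<pi>, u)\<in>?P \<times> ?U. cnj (wreath_char cs \<gamma> (wmat n \<pi> u)) *
          (if \<forall>c\<in>cycles_of (wmat n \<pi> u). \<forall>i\<in>c. \<forall>j\<in>c. f ! i = f ! j
           then \<Prod>i<n. entry_of (wmat n \<pi> u) i powi p (f ! i) else 0))"
    unfolding coloring_coeff_def
    by (subst sum.reindex_bij_betw[OF wreath_bij, symmetric]) (unfold case_prod_unfold, rule refl)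
  also have "\<dots> = (\<Sum>\<pi>\<in>?P. \<Sum>u\<in>?U. \<Sum>g\<in>?G. if fix\<^sub>f \<pi> \<and> fix\<^sub>g \<pi> g
           then E g * (\<Prod>i<n. cnj (u i) ^ fst (g i) * u i powi p (f ! i)) else 0)"
    unfolding sum.cartesian_product[symmetric] using summand by (intro sum.cong refl) auto
  also have "\<dots> = (\<Sum>\<pi>\<in>?P. \<Sum>g\<in>?G. if fix\<^sub>f \<pi> \<and> fix\<^sub>g \<pi> g
           then E g * (\<Sum>u\<in>?U. \<Prod>i<n. cnj (u i) ^ fst (g i) * u i powi p (f ! i)) else 0)"
  proof (intro sum.cong refl)
    fix \<pi>
    show "(\<Sum>u\<in>?U. \<Sum>g\<in>?G. if fix\<^sub>f \<pi> \<and> fix\<^sub>g \<pi> g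
           then E g * (\<Prod>i<n. cnj (u i) ^ fst (g i) * u i powi p (f ! i)) else 0)
      = (\<Sum>g\<in>?G. if fix\<^sub>f \<pi> \<and> fix\<^sub>g \<pi> g
           then E g * (\<Sum>u\<in>?U. \<Prod>i<n. cnj (u i) ^ fst (g i) * u i powi p (f ! i)) else 0)"
      (is "?l = _")
    proof -
      have "?l = (\<Sum>g\<in>?G. \<Sum>u\<in>?U. if fix\<^sub>f \<pi> \<and> fix\<^sub>g \<pi> g
           then E g * (\<Prod>i<n. cnj (u i) ^ fst (g i) * u i powi p (f ! i)) else 0)"
        by (rule sum.swap)
      also have "\<dots> = (\<Sum>g\<in>?G. if fix\<^sub>f \<pi> \<and> fix\<^sub>g \<pi> g
           then E g * (\<Sum>u\<in>?U. \<Prod>i<n. cnj (u i) ^ fst (g i) * u i powi p (f ! i)) else 0)"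
      proof (intro sum.cong refl)
        fix g
        show "(\<Sum>u\<in>?U. if fix\<^sub>f \<pi> \<and> fix\<^sub>g \<pi> g
            then E g * (\<Prod>i<n. cnj (u i) ^ fst (g i) * u i powi p (f ! i)) else 0)
          = (if fix\<^sub>f \<pi> \<and> fix\<^sub>g \<pi> g
            then E g * (\<Sum>u\<in>?U. \<Prod>i<n. cnj (u i) ^ fst (g i) * u i powi p (f ! i)) else 0)"
          by (cases "fix\<^sub>f \<pi> \<and> fix\<^sub>g \<pi> g")
            (simp_all only: if_True if_False sum_distrib_left sum.neutral_const simp_thms)
      qed
      finally show ?thesis .
    qed
  qed
  also have "\<dots> = (\<Sum>g\<in>?G. \<Sum>\<pi>\<in>?P. if fix\<^sub>f \<pi> \<and> fix\<^sub>g \<pi> g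
           then E g * (if compat g then of_nat k ^ n else 0) else 0)"
    by (subst sum.swap, intro sum.cong refl) (simp add: usum)
  also have "\<dots> = (\<Sum>g\<in>?G. if compat g
      then of_nat k ^ n * (E g * of_nat (card {\<pi> \<in> ?P. fix\<^sub>f \<pi> \<and> fix\<^sub>g \<pi> g})) else 0)"
  proof (intro sum.cong refl)
    fix g
    have "(\<Sum>\<pi>\<in>?P. if fix\<^sub>f \<pi> \<and> fix\<^sub>g \<pi> g then c else 0) = c * of_nat (card {\<pi> \<in> ?P. fix\<^sub>f \<pi> \<and> fix\<^sub>g \<pi> g})"
      for c :: complex
      by (subst sum.inter_filter[OF finP, symmetric]) simp
    then show "(\<Sum>\<pi>\<in>?P. if fix\<^sub>f \<pi> \<and> fix\<^sub>g \<pi> g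
           then E g * (if compat g then of_nat k ^ n else 0) else 0)
      = (if compat g
      then of_nat k ^ n * (E g * of_nat (card {\<pi> \<in> ?P. fix\<^sub>f \<pi> \<and> fix\<^sub>g \<pi> g})) else 0)"
      by (simp add: mult_ac)
  qed
  also have "\<dots> = (\<Sum>g | g \<in> ?G \<and> compat g.
      of_nat k ^ n * (E g * of_nat (card {\<pi> \<in> ?P. fix\<^sub>f \<pi> \<and> fix\<^sub>g \<pi> g})))"
    using finG by (rule sum.inter_filter[symmetric])
  finally have "coloring_coeff k n p (wreath_char cs \<gamma>) f = (\<Sum>g | g \<in> ?G \<and> compat g.
      of_nat k ^ n * (E g * of_nat (card {\<pi> \<in> ?P. fix\<^sub>f \<pi> \<and> fix\<^sub>g \<pi> g})))" .
  moreover have "{\<pi> \<in> ?P. fix\<^sub>f \<pi> \<and> fix\<^sub>g \<pi> g} =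
      {\<pi>. \<pi> permutes {..<n} \<and> (\<forall>i<n. f ! \<pi> i = f ! i \<and> g (\<pi> i) = g i)}" for g
    by (auto simp: fix\<^sub>f_def fix\<^sub>g_def)
  ultimately show ?thesis by (simp only: E_def compat_def)
qed

text \<open>Zipped together, \<open>f\<close> and \<open>g\<close> form one word of pairs, and their
  joint stabilizer is the stabilizer of that word. Everything else in the summand depends only on
  the multiset of the pairs, and by \<open>sum_card_stabilizers\<close> each multiset counts
  \<open>n!\<close> times.\<close>

lemma sum_coloring_coeff:
  fixes M :: "'c multiset"
  assumes k: "k > 0" and cs: "cycle_enumeration k n cs" and \<gamma>: "is_multipartition k n \<gamma>"
    and M: "size M = n"
  shows "(\<Sum>f | mset f = M. coloring_coeff k n p (wreath_char cs \<gamma>) f)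
    = of_nat k ^ n * fact n * colored_sum k n p M (\<lambda>j. beta (part (\<gamma> ! j)))"
proof -
  define Q where "Q A = meps k n (mdrop (\<lambda>j. beta (part (\<gamma> ! j))) (image_mset snd A))"
    for A :: "('c \<times> nat \<times> nat) multiset"
  define stab where "stab h = card {\<pi>. \<pi> permutes {..<n} \<and> (\<forall>i<n. h ! \<pi> i = h ! i)}"
    for h :: "('c \<times> nat \<times> nat) list"
  let ?G = "\<lambda>f. {g. g \<in> {..<n} \<rightarrow>\<^sub>E {..<k} \<times> {..<n} \<and> (\<forall>i<n. int (fst (g i)) = p (f ! i) mod int k)}"
  let ?H = "{h. mset h \<in> pairings k n p M}"
  let ?zip = "\<lambda>(f, g). map (\<lambda>i. (f ! i, g i)) [0..<n]"
  have finG: "finite (?G f)" for f :: "'c list"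
    by (rule finite_subset[OF _ finite_PiE[of "{..<n}" "\<lambda>_. {..<k} \<times> {..<n}"]]) auto
  have len: "length f = n" if "mset f = M" for f using that M by (metis size_mset)
  have lenH: "length h = n" if "h \<in> ?H" for h
  proof -
    have "size (image_mset fst (mset h)) = size M" using that by (simp add: pairings_def)
    then show ?thesis using M by simp
  qed
  have finH: "finite ?H"
  proof -
    have "?H = (\<Union>A\<in>pairings k n p M. {h. mset h = A})" by auto
    then show ?thesis using finite_pairings[OF k, of n p M] finite_mset_eq by auto
  qed
  have "(\<Sum>f | mset f = M. coloring_coeff k n p (wreath_char cs \<gamma>) f)
      = (\<Sum>(f, g)\<in>(SIGMA f : {f. mset f = M}. ?G f).
          of_nat k ^ n * (meps k n (mdrop (\<lambda>j. beta (part (\<gamma> ! j))) (content n g)) *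
            of_nat (card {\<pi>. \<pi> permutes {..<n} \<and> (\<forall>i<n. f ! \<pi> i = f ! i \<and> g (\<pi> i) = g i)})))"
    unfolding coloring_coeff_frobenius[OF k cs \<gamma>]
    using finG by (intro sum.Sigma finite_mset_eq) auto
  also have "\<dots> = (\<Sum>h\<in>?H. of_nat k ^ n * (Q (mset h) * of_nat (stab h)))"
  proof (rule sum.reindex_bij_witness[where j = ?zip and
        i = "\<lambda>h. (map fst h, \<lambda>i\<in>{..<n}. snd (h ! i))"])
    fix x assume "x \<in> (SIGMA f : {f. mset f = M}. ?G f)"
    then obtain f g where x: "x = (f, g)" and f: "mset f = M" and g: "g \<in> ?G f" by (cases x) auto
    have gI: "g i \<in> {..<k} \<times> {..<n}" if "i < n" for i using g that by (auto simp: PiE_def Pi_def)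
    have fst_zip: "map fst (?zip (f, g)) = f"
      using len[OF f] by (auto simp: comp_def map_nth intro: nth_equalityI)
    then show "(map fst (?zip x), \<lambda>i\<in>{..<n}. snd (?zip x ! i)) = x"
      using g by (auto simp: x fun_eq_iff PiE_def extensional_def)
    have fst_zip': "image_mset fst (mset (?zip (f, g))) = M" using fst_zip f by (metis mset_map)
    have memH: "i < n \<and> int j = p c mod int k" if "(c, j, i) \<in> set (?zip (f, g))" for c j i
    proof -
      have "(c, j, i) \<in> (\<lambda>s. (f ! s, g s)) ` {..<n}" using that by (simp add: atLeast0LessThan)
      then obtain s where "s < n" "(c, j, i) = (f ! s, g s)" by blast
      then have s: "s < n" "c = f ! s" "g s = (j, i)" by simp_all
      have "int (fst (g s)) = p (f ! s) mod int k" using g s(1) by auto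
      then show ?thesis using gI[OF s(1)] s(2,3) by auto
    qed
    have snd_zip: "snd (snd y) < n \<and> int (fst (snd y)) = p (fst y) mod int k"
      if "y \<in> set (?zip (f, g))" for y
      using memH[of "fst y" "fst (snd y)" "snd (snd y)"] that by (simp only: prod.collapse simp_thms)
    have "mset (?zip (f, g)) \<in> pairings k n p M"
      unfolding pairings_def set_mset_mset mem_Collect_eq
    proof (intro conjI ballI)
      fix y assume "y \<in> set (?zip (f, g))"
      from snd_zip[OF this] show "case y of (c, j, i) \<Rightarrow> i < n \<and> int j = p c mod int k"
        by (simp only: case_prod_unfold)
    qed (rule fst_zip')
    then show "?zip x \<in> ?H" unfolding x by simp
    have "image_mset snd (mset (?zip (f, g))) = content n g"
      by (simp add: content_def comp_def atLeast0LessThan multiset.map_comp)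
    moreover have "stab (?zip (f, g)) =
        card {\<pi>. \<pi> permutes {..<n} \<and> (\<forall>i<n. f ! \<pi> i = f ! i \<and> g (\<pi> i) = g i)}"
    proof -
      have "(\<forall>i<n. ?zip (f, g) ! \<pi> i = ?zip (f, g) ! i) \<longleftrightarrow> (\<forall>i<n. f ! \<pi> i = f ! i \<and> g (\<pi> i) = g i)"
        if "\<pi> permutes {..<n}" for \<pi>
        using permutes_in_image[OF that] by auto
      then show ?thesis unfolding stab_def by (intro arg_cong[where f = card] Collect_cong) blast
    qed
    ultimately show "of_nat k ^ n * (Q (mset (?zip x)) * of_nat (stab (?zip x)))
      = (case x of (f, g) \<Rightarrow>
          of_nat k ^ n * (meps k n (mdrop (\<lambda>j. beta (part (\<gamma> ! j))) (content n g)) *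
            of_nat (card {\<pi>. \<pi> permutes {..<n} \<and> (\<forall>i<n. f ! \<pi> i = f ! i \<and> g (\<pi> i) = g i)})))"
      unfolding x Q_def by simp
  next
    fix h assume h: "h \<in> ?H"
    then have pair: "image_mset fst (mset h) = M"
        "\<And>c j i. (c, j, i) \<in> set h \<Longrightarrow> i < n \<and> int j = p c mod int k"
      by (auto simp: pairings_def)
    have hi: "snd (snd (h ! i)) < n \<and> int (fst (snd (h ! i))) = p (fst (h ! i)) mod int k"
      if "i < n" for i
      using pair(2)[of "fst (h ! i)" "fst (snd (h ! i))" "snd (snd (h ! i))"] that lenH[OF h]
      by simp
    show "?zip (map fst h, \<lambda>i\<in>{..<n}. snd (h ! i)) = h"
      using lenH[OF h] by (auto intro!: nth_equalityI)
    have "mset (map fst h) = M" using pair(1) by simp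
    moreover have "fst (snd (h ! i)) < k" if "i < n" for i
    proof -
      have "int (fst (snd (h ! i))) < int k" using hi[OF that] k by simp
      then show ?thesis by simp
    qed
    ultimately show "(map fst h, \<lambda>i\<in>{..<n}. snd (h ! i)) \<in> (SIGMA f : {f. mset f = M}. ?G f)"
      using hi lenH[OF h] by (auto simp: mem_Times_iff)
  qed
  also have "\<dots> = (\<Sum>A\<in>mset ` ?H. \<Sum>h | h \<in> ?H \<and> mset h = A. of_nat k ^ n * (Q (mset h) * of_nat (stab h)))"
    by (rule sum.image_gen[OF finH])
  also have "mset ` ?H = pairings k n p M"
    by (auto simp: image_iff) (metis ex_mset)
  also have "(\<Sum>A\<in>pairings k n p M. \<Sum>h | h \<in> ?H \<and> mset h = A. of_nat k ^ n * (Q (mset h) * of_nat (stab h)))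
      = (\<Sum>A\<in>pairings k n p M. of_nat k ^ n * fact n * Q A)"
  proof (intro sum.cong refl)
    fix A assume A: "A \<in> pairings k n p M"
    then have "size (image_mset fst A) = size M" by (simp add: pairings_def)
    then have "size A = n" using M by simp
    have "{h. h \<in> ?H \<and> mset h = A} = {h. mset h = A}" using A by auto
    then have "(\<Sum>h | h \<in> ?H \<and> mset h = A. of_nat k ^ n * (Q (mset h) * of_nat (stab h)))
        = (\<Sum>h | mset h = A. of_nat k ^ n * Q A * of_nat (stab h))"
      by (intro sum.cong) (auto simp: mult.assoc)
    also have "\<dots> = of_nat k ^ n * Q A * of_nat (\<Sum>h | mset h = A. stab h)"
      by (simp add: sum_distrib_left)
    also have "(\<Sum>h | mset h = A. stab h) = fact n"
      unfolding stab_def by (rule sum_card_stabilizers) fact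
    finally show "(\<Sum>h | h \<in> ?H \<and> mset h = A. of_nat k ^ n * (Q (mset h) * of_nat (stab h)))
        = of_nat k ^ n * fact n * Q A" by simp
  qed
  finally show ?thesis by (simp add: colored_sum_def Q_def sum_distrib_left)
qed

section \<open>Infinite sums in a complex algebra\<close>

lemma complex_algebra_zero: "complex_algebra \<iota> \<Longrightarrow> \<iota> 0 = 0"
  unfolding complex_algebra_def by (metis add_cancel_right_right)

lemma complex_algebra_sum:
  assumes "complex_algebra \<iota>"
  shows "\<iota> (\<Sum>x\<in>X. f x) = (\<Sum>x\<in>X. \<iota> (f x))"
  using assms complex_algebra_zero[OF assms]
  by (induction X rule: infinite_finite_induct) (auto simp: complex_algebra_def)

lemma complex_algebra_prod:
  assumes "complex_algebra \<iota>"
  shows "\<iota> (\<Prod>x\<in>X. f x) = (\<Prod>x\<in>X. \<iota> (f x))"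
  using assms by (induction X rule: infinite_finite_induct) (auto simp: complex_algebra_def)

lemma has_sum_scale:
  assumes "complex_algebra \<iota>" "(f has_sum s) X"
  shows "((\<lambda>x. \<iota> a * f x) has_sum \<iota> a * s) X"
proof -
  have "isCont (\<lambda>x. \<iota> a * x) s"
    using assms(1) by (auto simp: complex_algebra_def continuous_on_eq_continuous_at)
  then have "((\<lambda>F. \<iota> a * sum f F) \<longlongrightarrow> \<iota> a * s) (finite_subsets_at_top X)"
    using assms(2) by (simp add: has_sum_def isCont_tendsto_compose)
  then show ?thesis by (simp add: has_sum_def sum_distrib_left)
qed

text \<open>Continuity of subtraction at \<open>(s, s)\<close> replaces a metric: the partial sums
  over \<open>A\<close> and \<open>A \<union> B\<close> are both near \<open>s\<close>, so their
  difference, the sum over \<open>B\<close>, is near 0.\<close>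

lemma has_sum_Cauchy:
  fixes r :: "'w \<Rightarrow> 'r::topological_ab_group_add"
  assumes "(r has_sum s) W" "open U" "0 \<in> U"
  obtains A where "finite A" "A \<subseteq> W"
    "\<And>B. finite B \<Longrightarrow> B \<subseteq> W - A \<Longrightarrow> sum r B \<in> U"
proof -
  have "((\<lambda>z. fst z - snd z) \<longlongrightarrow> s - s) (nhds s \<times>\<^sub>F nhds s)"
    by (intro tendsto_diff filterlim_fst filterlim_snd)
  then have "eventually (\<lambda>z. fst z - snd z \<in> U) (nhds s \<times>\<^sub>F nhds s)"
    using assms(2,3) by (simp add: topological_tendstoD)
  then obtain P Q where PQ: "eventually P (nhds s)" "eventually Q (nhds s)"
      "\<And>x y. P x \<Longrightarrow> Q y \<Longrightarrow> x - y \<in> U"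
    unfolding eventually_prod_filter by auto
  have "eventually (\<lambda>F. P (sum r F) \<and> Q (sum r F)) (finite_subsets_at_top W)"
    using assms(1) PQ(1,2) unfolding has_sum_def filterlim_iff
    by (simp add: eventually_conj_iff)
  then obtain A where A: "finite A" "A \<subseteq> W"
      "\<And>F. finite F \<Longrightarrow> A \<subseteq> F \<Longrightarrow> F \<subseteq> W \<Longrightarrow> P (sum r F) \<and> Q (sum r F)"
    unfolding eventually_finite_subsets_at_top by auto
  show thesis
  proof
    fix B assume B: "finite B" "B \<subseteq> W - A"
    have "sum r (A \<union> B) = sum r A + sum r B"
      using A B by (intro sum.union_disjoint) auto
    moreover have "sum r (A \<union> B) - sum r A \<in> U"
      using A(3)[of "A \<union> B"] A(3)[of A] A(1,2) B by (intro PQ(3)) auto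
    ultimately show "sum r B \<in> U" by simp
  qed (use A in auto)
qed

text \<open>Induction on the finite set of scalars. Each fixed scalar acts continuously, so it has
  its own Cauchy condition for \<open>r\<close>; adding a scalar costs one use of the continuity of
  addition at 0.\<close>

lemma has_sum_Cauchy_scaled:
  assumes \<iota>: "complex_algebra (\<iota> :: complex \<Rightarrow> 'r::{comm_ring_1, topological_ab_group_add, t2_space})"
    and r: "(r has_sum s) W" and "finite V" and "open U" "0 \<in> U"
  shows "\<exists>A. finite A \<and> A \<subseteq> W \<and>
    (\<forall>B. finite B \<longrightarrow> B \<subseteq> W - A \<longrightarrow> d ` B \<subseteq> V \<longrightarrow> (\<Sum>x\<in>B. \<iota> (d x) * r x) \<in> U)"
  using assms(3-5)
proof (induction V arbitrary: U)
  case empty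
  then show ?case by (intro exI[of _ "{}"]) auto
next
  case (insert v V)
  have "((\<lambda>z. fst z + snd z) \<longlongrightarrow> 0 + 0) (nhds (0::'r) \<times>\<^sub>F nhds (0::'r))"
    by (intro tendsto_add filterlim_fst filterlim_snd)
  then have "eventually (\<lambda>z. fst z + snd z \<in> U) (nhds (0::'r) \<times>\<^sub>F nhds (0::'r))"
    using insert.prems by (simp add: topological_tendstoD)
  then obtain P Q where PQ: "eventually P (nhds (0::'r))" "eventually Q (nhds (0::'r))"
      "\<And>x y. P x \<Longrightarrow> Q y \<Longrightarrow> x + y \<in> U"
    unfolding eventually_prod_filter by auto
  obtain U1 where U1: "open U1" "0 \<in> U1" "\<And>x. x \<in> U1 \<Longrightarrow> P x"
    using PQ(1) by (auto simp: eventually_nhds)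
  obtain U2 where U2: "open U2" "0 \<in> U2" "\<And>x. x \<in> U2 \<Longrightarrow> Q x"
    using PQ(2) by (auto simp: eventually_nhds)
  obtain A1 where A1: "finite A1" "A1 \<subseteq> W"
    "\<And>B. finite B \<Longrightarrow> B \<subseteq> W - A1 \<Longrightarrow> sum (\<lambda>x. \<iota> v * r x) B \<in> U1"
    using has_sum_Cauchy[OF has_sum_scale[OF \<iota> r] U1(1,2)] by metis
  obtain A2 where A2: "finite A2" "A2 \<subseteq> W"
    "\<And>B. finite B \<Longrightarrow> B \<subseteq> W - A2 \<Longrightarrow> d ` B \<subseteq> V \<Longrightarrow> (\<Sum>x\<in>B. \<iota> (d x) * r x) \<in> U2"
    using insert.IH[OF U2(1,2)] by metis
  show ?case
  proof (intro exI[of _ "A1 \<union> A2"] conjI allI impI)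
    fix B assume B: "finite B" "B \<subseteq> W - (A1 \<union> A2)" "d ` B \<subseteq> insert v V"
    let ?B1 = "{x \<in> B. d x = v}" and ?B2 = "{x \<in> B. d x \<noteq> v}"
    have "(\<Sum>x\<in>?B1 \<union> ?B2. \<iota> (d x) * r x)
        = (\<Sum>x\<in>?B1. \<iota> (d x) * r x) + (\<Sum>x\<in>?B2. \<iota> (d x) * r x)"
      using B(1) by (intro sum.union_disjoint) auto
    moreover have "?B1 \<union> ?B2 = B" by auto
    moreover have "(\<Sum>x\<in>?B1. \<iota> (d x) * r x) = (\<Sum>x\<in>?B1. \<iota> v * r x)"
      by (intro sum.cong) auto
    moreover have "(\<Sum>x\<in>?B1. \<iota> v * r x) \<in> U1" using B by (intro A1(3)) auto
    moreover have "(\<Sum>x\<in>?B2. \<iota> (d x) * r x) \<in> U2" using B by (intro A2(3)) auto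
    ultimately show "(\<Sum>x\<in>B. \<iota> (d x) * r x) \<in> U"
      using PQ(3)[OF U1(3) U2(3)] by simp
  qed (use A1 A2 in auto)
qed

text \<open>The target need not be complete, so subfamilies of a summable family may fail to be summable. The
  Cauchy condition survives, and it is enough because only finitely many scalars occur.\<close>

lemma has_sum_zero_blocks:
  assumes \<iota>: "complex_algebra (\<iota> :: complex \<Rightarrow> 'r::{comm_ring_1, topological_ab_group_add, t2_space})"
    and r: "r summable_on W" and d: "finite (d ` W)"
    and fin: "\<And>x. x \<in> W \<Longrightarrow> finite {y \<in> W. key y = key x}"
    and zero: "\<And>x. x \<in> W \<Longrightarrow> (\<Sum>y | y \<in> W \<and> key y = key x. \<iota> (d y) * r y) = 0"
  shows "((\<lambda>x. \<iota> (d x) * r x) has_sum 0) W"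
  unfolding has_sum_def
proof (rule topological_tendstoI)
  fix U :: "'r set" assume U: "open U" "0 \<in> U"
  obtain s where s: "(r has_sum s) W" using r by (auto simp: summable_on_def)
  obtain A where A: "finite A" "A \<subseteq> W"
    "\<And>B. finite B \<Longrightarrow> B \<subseteq> W - A \<Longrightarrow> d ` B \<subseteq> d ` W \<Longrightarrow> (\<Sum>x\<in>B. \<iota> (d x) * r x) \<in> U"
    using has_sum_Cauchy_scaled[OF \<iota> s d U] by metis
  \<comment> \<open>\<open>A'\<close> is a union of whole blocks, so the sum over it vanishes, while
    everything outside avoids \<open>A\<close> and is controlled by the Cauchy condition.\<close>
  define A' where "A' = (\<Union>x\<in>A. {y \<in> W. key y = key x})"
  have A': "finite A'" "A' \<subseteq> W" "A \<subseteq> A'"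
    using A fin by (auto simp: A'_def)
  have "(\<Sum>y\<in>A'. \<iota> (d y) * r y) = (\<Sum>m\<in>key ` A'. \<Sum>y | y \<in> A' \<and> key y = m. \<iota> (d y) * r y)"
    by (rule sum.image_gen[OF A'(1)])
  also have "\<dots> = 0"
  proof (rule sum.neutral, safe)
    fix x assume x: "x \<in> A'"
    have "{y \<in> A'. key y = key x} = {y \<in> W. key y = key x}"
      using x by (auto simp: A'_def)
    with zero[of x] x A'(2) show "(\<Sum>y | y \<in> A' \<and> key y = key x. \<iota> (d y) * r y) = 0" by auto
  qed
  finally have 0: "(\<Sum>y\<in>A'. \<iota> (d y) * r y) = 0" .
  show "\<forall>\<^sub>F F in finite_subsets_at_top W. (\<Sum>x\<in>F. \<iota> (d x) * r x) \<in> U"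
    unfolding eventually_finite_subsets_at_top
  proof (intro exI[of _ A'] conjI allI impI A'(1,2))
    fix F assume F: "finite F \<and> A' \<subseteq> F \<and> F \<subseteq> W"
    have "(\<Sum>x\<in>F. \<iota> (d x) * r x) = (\<Sum>x\<in>F - A'. \<iota> (d x) * r x)"
      using sum.subset_diff[of A' F "\<lambda>x. \<iota> (d x) * r x"] F 0 by simp
    moreover have "(\<Sum>x\<in>F - A'. \<iota> (d x) * r x) \<in> U"
      using F A'(3) by (intro A(3)) auto
    ultimately show "(\<Sum>x\<in>F. \<iota> (d x) * r x) \<in> U" by simp
  qed
qed

text \<open>Exchanges coefficients spread over a block for the indicator of chosen words
  \<open>D\<close>. The difference \<open>d\<close> of the indicator and \<open>g\<close> takes
  finitely many values and sums to 0 over each block, on which \<open>r\<close> is constant, so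
  \<open>has_sum_zero_blocks\<close> applies.\<close>

lemma has_sum_transfer_blocks:
  assumes \<iota>: "complex_algebra (\<iota> :: complex \<Rightarrow> 'r::{comm_ring_1, topological_ab_group_add, t2_space})"
    and S: "((\<lambda>x. \<iota> (g x) * r x) has_sum S) W"
    and r: "r summable_on W" and g: "finite (g ` W)" and "D \<subseteq> W"
    and fin: "\<And>x. x \<in> W \<Longrightarrow> finite {y \<in> W. key y = key x}"
    and const: "\<And>x y. x \<in> W \<Longrightarrow> y \<in> W \<Longrightarrow> key x = key y \<Longrightarrow> r x = r y"
    and block: "\<And>x. x \<in> W \<Longrightarrow>
      (\<Sum>y | y \<in> W \<and> key y = key x. g y) = of_nat (card {y \<in> D. key y = key x})"
  shows "(r has_sum S) D"
proof -
  define d where "d x = (if x \<in> D then 1 else 0) - g x" for x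
  have "((\<lambda>x. \<iota> (d x) * r x) has_sum 0) W"
  proof (rule has_sum_zero_blocks[OF \<iota> r _ fin])
    have "d ` W \<subseteq> (\<lambda>v. 1 - v) ` g ` W \<union> (\<lambda>v. 0 - v) ` g ` W" by (auto simp: d_def)
    then show "finite (d ` W)" using g by (auto intro: finite_subset)
  next
    fix x assume x: "x \<in> W"
    have eq: "{y \<in> W. key y = key x} \<inter> D = {y \<in> D. key y = key x}" using \<open>D \<subseteq> W\<close> by auto
    have "(\<Sum>y | y \<in> W \<and> key y = key x. \<iota> (d y) * r y)
        = (\<Sum>y | y \<in> W \<and> key y = key x. \<iota> (d y) * r x)"
    proof (intro sum.cong refl)
      fix y assume "y \<in> {y \<in> W. key y = key x}"
      then have "r y = r x" using const[of y x] x by blast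
      then show "\<iota> (d y) * r y = \<iota> (d y) * r x" by (simp only:)
    qed
    also have "\<dots> = \<iota> (\<Sum>y | y \<in> W \<and> key y = key x. d y) * r x"
      by (simp add: complex_algebra_sum[OF \<iota>] sum_distrib_right)
    also have "(\<Sum>y | y \<in> W \<and> key y = key x. d y) = 0"
      unfolding d_def sum_subtractf block[OF x] sum.If_cases[OF fin[OF x]]
      using eq by (simp add: Collect_mem_eq)
    finally show "(\<Sum>y | y \<in> W \<and> key y = key x. \<iota> (d y) * r y) = 0"
      by (simp add: complex_algebra_zero[OF \<iota>])
  qed auto
  from has_sum_add[OF this S]
  have "((\<lambda>x. (\<iota> (d x) + \<iota> (g x)) * r x) has_sum S) W" by (simp add: ring_distribs)
  moreover have "\<iota> (d x) + \<iota> (g x) = (if x \<in> D then 1 else 0)" for x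
  proof -
    have "\<iota> (d x) + \<iota> (g x) = \<iota> (d x + g x)" using \<iota> by (simp add: complex_algebra_def)
    then show ?thesis using \<iota> complex_algebra_zero[OF \<iota>] by (simp add: d_def complex_algebra_def)
  qed
  ultimately have "((\<lambda>x. (if x \<in> D then 1 else 0) * r x) has_sum S) W" by (simp only:)
  moreover have "((\<lambda>x. (if x \<in> D then 1 else 0) * r x) has_sum S) W \<longleftrightarrow> (r has_sum S) D"
    using \<open>D \<subseteq> W\<close> by (intro has_sum_cong_neutral) auto
  ultimately show ?thesis by blast
qed

section \<open>The multiplicities\<close>

lemma list_eq_if_concat_eq:
  assumes "map length xs = map length ys" "concat xs = concat ys"
  shows "xs = ys"
  using assms
proof (induction xs arbitrary: ys)
  case (Cons x xs)
  then obtain y ys' where "ys = y # ys'" "length x = length y" "map length xs = map length ys'"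
    by (cases ys) auto
  then show ?case using Cons by simp
qed simp

lemma mset_concat_sum: "mset (concat xs) = (\<Sum>i<length xs. mset (xs ! i))"
  by (simp add: mset_concat sum_list_sum_nth atLeast0LessThan)

text \<open>A tableau is read as a list of colors, like a coloring, so that tableaux and colorings
  live in one set of words.\<close>

definition word :: "'c list list list \<Rightarrow> 'c list" where
  "word T = concat (concat T)"

lemma mset_word: "mset (word T) = (\<Sum>j<length T. mset (concat (T ! j)))"
proof -
  have "word T = concat (map concat T)" unfolding word_def by (induction T) auto
  then have "mset (word T) = (\<Sum>j<length T. mset (map concat T ! j))"
    using mset_concat_sum[of "map concat T"] by simp
  also have "\<dots> = (\<Sum>j<length T. mset (concat (T ! j)))" by (intro sum.cong) auto
  finally show ?thesis .
qed

lemma prod_list_eq_prod_mset: "(\<Prod>i<length w. \<rho> (w ! i)) = prod_mset (image_mset \<rho> (mset w))"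
proof -
  have "(\<Prod>i<length w. \<rho> (w ! i)) = prod_list (map \<rho> w)"
    by (simp add: prod.list_conv_set_nth atLeast0LessThan)
  then show ?thesis by (simp add: prod_mset_prod_list flip: mset_map)
qed

lemma tableau_weight_word: "tableau_weight \<rho> T = (\<Prod>i<length (word T). \<rho> (word T ! i))"
  unfolding prod_list_eq_prod_mset tableau_weight_def Let_def word_def[symmetric]
  by (simp add: image_prod_mset_multiplicity)

locale multipartition_setting =
  fixes k n :: nat and \<gamma> :: "nat list list" and p :: "'c::linorder \<Rightarrow> int"
  assumes k: "k > 0" and \<gamma>: "is_multipartition k n \<gamma>"
begin

lemma length_\<gamma>: "length \<gamma> = k"
  using \<gamma> by (simp add: is_multipartition_def)

lemma component:
  assumes "j < k"
  shows "is_partition (\<gamma> ! j)" "length (\<gamma> ! j) \<le> n"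
  using multipartition_component[OF \<gamma>, of "\<gamma> ! j"] assms length_\<gamma> by auto

text \<open>The multiplicity bounds of \<open>F\<close> are left out here; they concern only the
  multiset of the entries and return in \<open>SSYT_eq\<close>.\<close>

definition tableaux :: "'c list list list set" where
  "tableaux = {T. length T = k \<and> (\<forall>r<k. semistandard (\<gamma> ! r) (T ! r) \<and>
     (\<forall>c\<in>set (concat (T ! r)). p c mod int k = int r))}"

text \<open>A color can occur only in the component given by its residue, so its count there is its
  count in the whole word, and the bounds for the \<open>k\<close> components amount to a single
  one.\<close>

lemma SSYT_eq: "SSYT k \<gamma> F p = {T \<in> tableaux. contained_in (mset (word T)) F}"
proof (intro equalityI subsetI)
  have comp: "count (mset (concat (T ! r))) c = count (mset (word T)) c"
    if "T \<in> tableaux" "r < k" "p c mod int k = int r" for T r c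
  proof -
    have "count (mset (word T)) c = (\<Sum>j<k. count (mset (concat (T ! j))) c)"
      using that(1) by (simp add: mset_word count_sum tableaux_def)
    also have "\<dots> = (\<Sum>j<k. if j = r then count (mset (concat (T ! r))) c else 0)"
    proof (intro sum.cong refl)
      fix j assume "j \<in> {..<k}"
      moreover have "c \<notin> set (concat (T ! j))" if "j < k" "j \<noteq> r"
        using \<open>T \<in> tableaux\<close> \<open>p c mod int k = int r\<close> that by (fastforce simp: tableaux_def)
      ultimately show "count (mset (concat (T ! j))) c
          = (if j = r then count (mset (concat (T ! r))) c else 0)"
        by (simp add: count_mset_0_iff del: set_concat)
    qed
    finally show ?thesis using that(2) by simp
  qed
  {
    fix T assume T: "T \<in> SSYT k \<gamma> F p"
    have cont: "enat (count (mset (concat (T ! r))) c) \<le> (if p c mod int k = int r then F c else 0)"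
      if "r < k" for r c
      using T that by (auto simp: SSYT_def contained_in_def residue_colors_def)
    have "p c mod int k = int r" if "r < k" "c \<in> set (concat (T ! r))" for r c
    proof (rule ccontr)
      assume "p c mod int k \<noteq> int r"
      then have "count (mset (concat (T ! r))) c = 0"
        using cont[OF that(1), of c] by (simp add: zero_enat_def)
      then have "c \<notin> set (concat (T ! r))" by (simp only: count_mset_0_iff not_False_eq_True)
      then show False using that(2) by blast
    qed
    then have T': "T \<in> tableaux" using T by (auto simp: tableaux_def SSYT_def)
    have "enat (count (mset (word T)) c) \<le> F c" for c
    proof -
      define r where "r = nat (p c mod int k)"
      have r: "r < k" "p c mod int k = int r" using k by (auto simp: r_def nat_less_iff)
      show ?thesis using comp[OF T' r] cont[OF r(1), of c] r(2) by simp
    qed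
    then show "T \<in> {T \<in> tableaux. contained_in (mset (word T)) F}"
      using T' by (simp add: contained_in_def)
  }
  {
    fix T assume "T \<in> {T \<in> tableaux. contained_in (mset (word T)) F}"
    then have T: "T \<in> tableaux" and cont: "\<And>c. enat (count (mset (word T)) c) \<le> F c"
      by (auto simp: contained_in_def)
    have "enat (count (mset (concat (T ! r))) c) \<le> residue_colors k F p r c" if "r < k" for r c
    proof (cases "p c mod int k = int r")
      case True
      then show ?thesis using comp[OF T that True] cont[of c] by (simp add: residue_colors_def)
    next
      case False
      then have "c \<notin> set (concat (T ! r))" using T that by (auto simp: tableaux_def)
      then have zero: "count (mset (concat (T ! r))) c = 0" by (simp only: count_mset_0_iff not_False_eq_True)
      show ?thesis unfolding zero by (simp flip: zero_enat_def)
    qed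
    then show "T \<in> SSYT k \<gamma> F p"
      using T by (auto simp: SSYT_def tableaux_def contained_in_def)
  }
qed

lemma map_length_tableaux:
  assumes "T \<in> tableaux"
  shows "map (map length) T = \<gamma>"
  using assms length_\<gamma> by (intro nth_equalityI) (auto simp: tableaux_def semistandard_def)

lemma length_word:
  assumes "T \<in> tableaux"
  shows "length (word T) = n"
proof -
  have "length (word T) = sum_list (concat (map (map length) T))"
    by (simp add: word_def length_concat map_concat)
  also have "\<dots> = (\<Sum>l\<leftarrow>\<gamma>. sum_list l)"
    unfolding map_length_tableaux[OF assms] by (induction \<gamma>) auto
  finally show ?thesis using \<gamma> by (simp add: is_multipartition_def)
qed

text \<open>The shape is the same for all tableaux, so the row lengths tell where to cut the
  word.\<close>

lemma inj_on_word: "inj_on word tableaux"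
proof (rule inj_onI)
  fix T T' assume T: "T \<in> tableaux" "T' \<in> tableaux" "word T = word T'"
  have eq: "map (map length) T = map (map length) T'"
    using map_length_tableaux T(1,2) by simp
  have "concat T = concat T'"
    using T(3) eq by (intro list_eq_if_concat_eq) (simp_all add: word_def map_concat)
  moreover have "map length T = map length T'"
    using arg_cong[OF eq, of "map length"] by (simp add: comp_def)
  ultimately show "T = T'" by (rule list_eq_if_concat_eq[rotated])
qed

lemma tableaux_bij:
  "bij_betw (\<lambda>T j i. if j < k \<and> i < length (T ! j) then T ! j ! i else [])
    {T \<in> tableaux. mset (word T) = M} (row_tableaux k n p (\<lambda>j. part (\<gamma> ! j)) M)"
proof (rule bij_betw_byWitness[where
      f' = "\<lambda>t. map (\<lambda>j. map (t j) [0..<length (\<gamma> ! j)]) [0..<k]"])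
  let ?f = "\<lambda>(T :: 'c list list list) j i. if j < k \<and> i < length (T ! j) then T ! j ! i else []"
  let ?g = "\<lambda>(t :: nat \<Rightarrow> nat \<Rightarrow> 'c list). map (\<lambda>j. map (t j) [0..<length (\<gamma> ! j)]) [0..<k]"
  have len: "length T = k" "\<And>j. j < k \<Longrightarrow> map length (T ! j) = \<gamma> ! j"
    "\<And>j. j < k \<Longrightarrow> length (T ! j) = length (\<gamma> ! j)" if "T \<in> tableaux" for T
    using that by (auto simp: tableaux_def semistandard_def) (metis length_map)
  have content: "(\<Sum>j<k. \<Sum>i<n. mset (?f T j i)) = mset (word T)" if T: "T \<in> tableaux" for T
  proof -
    have "(\<Sum>i<n. mset (?f T j i)) = mset (concat (T ! j))" if "j < k" for j
    proof -
      \<comment> \<open>No component has more than \<open>n\<close> rows, so summing over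
        \<open>n\<close> rows only adds empty ones.\<close>
      have "(\<Sum>i<n. mset (?f T j i)) = (\<Sum>i<length (T ! j). mset (?f T j i))"
        using len(3)[OF T that] component(2)[OF that] by (intro sum.mono_neutral_right) auto
      then show ?thesis using that by (simp add: mset_concat_sum)
    qed
    then show ?thesis using len(1)[OF T] by (simp add: mset_word)
  qed
  show "\<forall>T\<in>{T \<in> tableaux. mset (word T) = M}. ?g (?f T) = T"
    using len by (auto intro!: nth_equalityI)
  show "?f ` {T \<in> tableaux. mset (word T) = M} \<subseteq> row_tableaux k n p (\<lambda>j. part (\<gamma> ! j)) M"
  proof (clarify)
    fix T assume T: "T \<in> tableaux" "M = mset (word T)"
    have "row_filling (part (\<gamma> ! j)) (?f T j)" if j: "j < k" for j
    proof -
      have ss: "semistandard (\<gamma> ! j) (T ! j)" using T j by (simp add: tableaux_def)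
      have l: "length (T ! j ! i) = \<gamma> ! j ! i" if "i < length (\<gamma> ! j)" for i
        using len(2)[OF T(1) j] len(3)[OF T(1) j] that by (metis nth_map)
      show ?thesis
        unfolding row_filling_def
        using ss j l len(3)[OF T(1) j] by (auto simp: semistandard_def part_def)
    qed
    moreover have "p c mod int k = int j" if "j < k" "c \<in> set (?f T j i)" for j i c
      using T that by (auto simp: tableaux_def split: if_splits) (metis nth_mem)
    ultimately show "?f T \<in> row_tableaux k n p (\<lambda>j. part (\<gamma> ! j)) (mset (word T))"
      unfolding row_tableaux_def using content[OF T(1)] by (auto simp: fun_eq_iff)
  qed
  {
    fix t assume t: "t \<in> row_tableaux k n p (\<lambda>j. part (\<gamma> ! j)) M"
    have fill: "\<And>j. j < k \<Longrightarrow> row_filling (part (\<gamma> ! j)) (t j)"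
      and res: "\<And>j i c. j < k \<Longrightarrow> c \<in> set (t j i) \<Longrightarrow> p c mod int k = int j"
      and empty: "\<And>j. j \<ge> k \<Longrightarrow> t j = (\<lambda>_. [])"
      and cont: "(\<Sum>j<k. \<Sum>i<n. mset (t j i)) = M"
      using t by (auto simp: row_tableaux_def)
    have tl: "length (t j i) = part (\<gamma> ! j) i" if "j < k" for j i
      using fill[OF that] by (simp add: row_filling_def)
    have nil: "t j i = []" if "j < k" "i \<ge> length (\<gamma> ! j)" for j i
      using tl[OF that(1), of i] that(2) by (simp add: part_def)
    have pw: "?f (?g t) j i = t j i" for j i
      using nil empty by (cases "j < k") auto
    then have fg: "?f (?g t) = t" by (simp only: fun_eq_iff simp_thms)
    have "semistandard (\<gamma> ! j) (map (t j) [0..<length (\<gamma> ! j)])" if "j < k" for j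
      using fill[OF that] tl[OF that]
      by (auto simp: semistandard_def row_filling_def part_def intro!: nth_equalityI)
    then have gt: "?g t \<in> tableaux" using res by (auto simp: tableaux_def)
    moreover have "mset (word (?g t)) = M"
      using content[OF gt] unfolding pw cont by simp
    ultimately have "?g t \<in> {T \<in> tableaux. mset (word T) = M}" by simp
    note fg this
  }
  then show "\<forall>t\<in>row_tableaux k n p (\<lambda>j. part (\<gamma> ! j)) M. ?f (?g t) = t"
    "?g ` row_tableaux k n p (\<lambda>j. part (\<gamma> ! j)) M \<subseteq> {T \<in> tableaux. mset (word T) = M}"
    by blast+
qed

lemma sum_coloring_coeff_tableaux:
  assumes cs: "cycle_enumeration k n cs" and M: "size M = n"
  shows "(\<Sum>f | mset f = M. coloring_coeff k n p (wreath_char cs \<gamma>) f)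
    = of_nat k ^ n * fact n * of_nat (card {T \<in> tableaux. mset (word T) = M})"
proof -
  have "colored_sum k n p M (\<lambda>j. beta (part (\<gamma> ! j)))
      = of_nat (card (row_tableaux k n p (\<lambda>j. part (\<gamma> ! j)) M))"
    by (rule colored_sum_tableaux[OF k, THEN conjunct2]) (use component shape_part in blast)
  then show ?thesis
    unfolding sum_coloring_coeff[OF k cs \<gamma> M] by (simp add: bij_betw_same_card[OF tableaux_bij])
qed

end

text \<open>There may be infinitely many words, but each group element contributes a fixed factor
  times 0 or a root of unity. This finiteness of the set of values is what
  \<open>has_sum_transfer_blocks\<close> demands of its coefficients.\<close>

lemma finite_coloring_coeff:
  assumes k: "k > 0"
  shows "finite (range (coloring_coeff k n p \<psi> :: 'c list \<Rightarrow> complex))"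
proof (rule finite_subset)
  let ?t = "\<lambda>f \<sigma>. if \<forall>c\<in>cycles_of \<sigma>. \<forall>i\<in>c. \<forall>j\<in>c. f ! i = f ! j
      then \<Prod>i<n. entry_of \<sigma> i powi p (f ! i) else 0"
  have finW: "finite (wreath k n)"
    using bij_betw_finite[OF wreath_bij, of n k]
    by (simp add: finite_permutations finite_PiE unity_roots_def)
  show "range (coloring_coeff k n p \<psi>) \<subseteq> (\<lambda>t. \<Sum>\<sigma>\<in>wreath k n. cnj (\<psi> \<sigma>) * t \<sigma>) `
      (wreath k n \<rightarrow>\<^sub>E insert 0 (unity_roots k))"
  proof
    fix x assume "x \<in> range (coloring_coeff k n p \<psi>)"
    then obtain f where x: "x = coloring_coeff k n p \<psi> f" by auto
    have "?t f \<sigma> \<in> insert 0 (unity_roots k)" if \<sigma>: "\<sigma> \<in> wreath k n" for \<sigma>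
    proof -
      obtain \<pi> u where pu: "\<pi> permutes {..<n}" "u \<in> {..<n} \<rightarrow>\<^sub>E unity_roots k" "\<sigma> = wmat n \<pi> u"
      proof -
        have "\<sigma> \<in> (\<lambda>(\<pi>, u). wmat n \<pi> u) ` ({\<pi>. \<pi> permutes {..<n}} \<times> ({..<n} \<rightarrow>\<^sub>E unity_roots k))"
          using \<sigma> bij_betw_imp_surj_on[OF wreath_bij, of n k] by simp
        then show thesis using that by auto
      qed
      have u: "u i \<in> unity_roots k" if "i < n" for i using pu(2) that by (auto simp: PiE_def Pi_def)
      have "(entry_of \<sigma> i powi p (f ! i)) ^ k = 1" if "i < n" for i
      proof -
        have "entry_of \<sigma> i = u i" unfolding pu(3) by (rule wmat_props(3)[OF pu(1) u that])
        then have "entry_of \<sigma> i ^ k = 1" using u[OF that] unity_roots_eq[OF k] by simp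
        then show ?thesis by (metis mult.commute power_int_1_left power_int_mult power_int_of_nat)
      qed
      then have "(\<Prod>i<n. entry_of \<sigma> i powi p (f ! i)) ^ k = 1"
        by (simp add: prod_power_distrib)
      then show ?thesis using unity_roots_eq[OF k] by simp
    qed
    then show "x \<in> (\<lambda>t. \<Sum>\<sigma>\<in>wreath k n. cnj (\<psi> \<sigma>) * t \<sigma>) `
      (wreath k n \<rightarrow>\<^sub>E insert 0 (unity_roots k))"
      unfolding x coloring_coeff_def
      by (intro image_eqI[of _ _ "restrict (?t f) (wreath k n)"]) (auto intro!: sum.cong)
  qed
  show "finite ((\<lambda>t. \<Sum>\<sigma>\<in>wreath k n. cnj (\<psi> \<sigma>) * t \<sigma>) `
      (wreath k n \<rightarrow>\<^sub>E insert 0 (unity_roots k)))"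
    using finW by (intro finite_imageI finite_PiE) (auto simp: unity_roots_def)
qed

lemma has_sum_sum:
  fixes f :: "'i \<Rightarrow> 'w \<Rightarrow> 'r::topological_comm_monoid_add"
  assumes "finite I" "\<And>i. i \<in> I \<Longrightarrow> (f i has_sum s i) W"
  shows "((\<lambda>x. \<Sum>i\<in>I. f i x) has_sum (\<Sum>i\<in>I. s i)) W"
  using assms by (induction I rule: finite_induct) (auto intro: has_sum_add)

theorem theorem3p7:
  fixes k n :: nat
    and \<iota> :: "complex \<Rightarrow> 'r::{comm_ring_1, topological_ab_group_add, t2_space}"
    and F :: "'c::linorder \<Rightarrow> enat"
    and p :: "'c \<Rightarrow> int"
    and \<rho> :: "'c \<Rightarrow> 'r"
    and \<chi> :: "complex mat \<Rightarrow> 'r"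
    and cs :: "complex mat \<Rightarrow> nat set list"
    and \<gamma> :: "nat list list"
  assumes "k \<ge> 1" and "n \<ge> 1"
    and "complex_algebra \<iota>"
    and "class_function k n \<chi>"
    and "given_by_color_rule k n \<iota> F p \<rho> \<chi>"
    and "cycle_enumeration k n cs"
    and "is_multipartition k n \<gamma>"
  shows "(tableau_weight \<rho> has_sum char_inner k n \<iota> \<chi> (wreath_char cs \<gamma>)) (SSYT k \<gamma> F p)"
proof -
  have k: "k > 0" using assms(1) by simp
  note \<iota> = assms(3) and rule = assms(5) and cs = assms(6) and \<gamma> = assms(7)
  interpret multipartition_setting k n \<gamma> p by unfold_locales fact+
  have \<iota>_mult: "\<iota> (a * b) = \<iota> a * \<iota> b" for a b using \<iota> by (simp add: complex_algebra_def)
  define \<psi> where "\<psi> = wreath_char cs \<gamma>"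
  define C :: complex where "C = 1 / (fact n * of_nat k ^ n)"
  define W where "W = {f :: 'c list. length f = n \<and> contained_in (mset f) F}"
  define r where "r f = (\<Prod>i<n. \<rho> (f ! i))" for f :: "'c list"
  \<comment> \<open>Normalized so that over each class of rearrangements in \<open>W\<close> the
    values of \<open>g\<close> sum to the number of tableaux with that content.\<close>
  define g where "g f = C * coloring_coeff k n p \<psi> f" for f
  define const where "const \<sigma> f \<longleftrightarrow> (\<forall>c\<in>cycles_of \<sigma>. \<forall>i\<in>c. \<forall>j\<in>c. f ! i = f ! j)"
    for \<sigma> and f :: "'c list"
  let ?e = "\<lambda>\<sigma> f. if const \<sigma> f then \<Prod>i<n. entry_of \<sigma> i powi p (f ! i) else 0"
  have finW: "finite (wreath k n)"
    using bij_betw_finite[OF wreath_bij, of n k]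
    by (simp add: finite_permutations finite_PiE unity_roots_def)
  \<comment> \<open>Extending each sum by zeros to the common index set \<open>W\<close> allows the
    finite sum over the group to be formed termwise.\<close>
  have \<chi>: "((\<lambda>f. \<iota> (?e \<sigma> f) * r f) has_sum \<chi> \<sigma>) W" if "\<sigma> \<in> wreath k n" for \<sigma>
  proof -
    have "((\<lambda>f. \<Prod>i<n. \<iota> (entry_of \<sigma> i powi p (f ! i)) * \<rho> (f ! i)) has_sum \<chi> \<sigma>) (colorings n F \<sigma>)"
      using rule that by (simp add: given_by_color_rule_def)
    moreover have "colorings n F \<sigma> = {f \<in> W. const \<sigma> f}" by (auto simp: colorings_def W_def const_def)
    ultimately have "((\<lambda>f. \<iota> (\<Prod>i<n. entry_of \<sigma> i powi p (f ! i)) * r f) has_sum \<chi> \<sigma>) {f \<in> W. const \<sigma> f}"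
      by (simp add: complex_algebra_prod[OF \<iota>] r_def prod.distrib)
    moreover have "((\<lambda>f. \<iota> (?e \<sigma> f) * r f) has_sum \<chi> \<sigma>) W \<longleftrightarrow>
      ((\<lambda>f. \<iota> (\<Prod>i<n. entry_of \<sigma> i powi p (f ! i)) * r f) has_sum \<chi> \<sigma>) {f \<in> W. const \<sigma> f}"
      by (rule has_sum_cong_neutral) (auto simp: complex_algebra_zero[OF \<iota>])
    ultimately show ?thesis by blast
  qed
  have "((\<lambda>f. \<Sum>\<sigma>\<in>wreath k n. \<iota> (C * cnj (\<psi> \<sigma>)) * (\<iota> (?e \<sigma> f) * r f)) has_sum
      (\<Sum>\<sigma>\<in>wreath k n. \<iota> (C * cnj (\<psi> \<sigma>)) * \<chi> \<sigma>)) W"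
    by (intro has_sum_sum finW has_sum_scale[OF \<iota>] \<chi>)
  moreover have "(\<Sum>\<sigma>\<in>wreath k n. \<iota> (C * cnj (\<psi> \<sigma>)) * \<chi> \<sigma>) = char_inner k n \<iota> \<chi> \<psi>"
    by (simp add: char_inner_def C_def[symmetric] sum_distrib_left \<iota>_mult mult_ac)
  moreover have "(\<Sum>\<sigma>\<in>wreath k n. \<iota> (C * cnj (\<psi> \<sigma>)) * (\<iota> (?e \<sigma> f) * r f)) = \<iota> (g f) * r f" for f
  proof -
    have "\<iota> (g f) = (\<Sum>\<sigma>\<in>wreath k n. \<iota> (C * cnj (\<psi> \<sigma>)) * \<iota> (?e \<sigma> f))"
      unfolding g_def coloring_coeff_def const_def sum_distrib_left complex_algebra_sum[OF \<iota>]
      by (simp only: \<iota>_mult mult.assoc)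
    then show ?thesis by (simp only: sum_distrib_right mult.assoc)
  qed
  ultimately have main: "((\<lambda>f. \<iota> (g f) * r f) has_sum char_inner k n \<iota> \<chi> \<psi>) W" by simp
  have summable: "r summable_on W"
  proof -
    \<comment> \<open>For the identity matrix every word in \<open>W\<close> is a coloring and all
      entries are 1, so its color sum is the plain sum of \<open>r\<close>.\<close>
    let ?\<sigma> = "wmat n id (\<lambda>_. 1)"
    have one: "1 \<in> unity_roots k" using unity_roots_eq[OF k] by simp
    have id: "id permutes {..<n}" by (rule permutes_id)
    have mem: "?\<sigma> \<in> wreath k n" by (rule wmat_props(1)[OF id one])
    have cyc: "cycles_of ?\<sigma> = orbit id ` {..<n}" by (rule cycles_of_wmat[OF id one])
    have "const ?\<sigma> f" for f
      unfolding const_def cyc by (rule orbits_partition(3)[OF id, of "\<lambda>i. f ! i", THEN iffD2]) simp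
    moreover have "(\<Prod>i<n. entry_of ?\<sigma> i powi p (f ! i)) = 1" for f
    proof (rule prod.neutral, rule ballI)
      fix i assume "i \<in> {..<n}"
      then have "entry_of ?\<sigma> i = 1" using wmat_props(3)[OF id one, of i] by simp
      then show "entry_of ?\<sigma> i powi p (f ! i) = 1" by simp
    qed
    ultimately have "\<iota> (?e ?\<sigma> f) * r f = r f" for f
      using \<iota> by (simp add: complex_algebra_def)
    then have "(r has_sum \<chi> ?\<sigma>) W" using \<chi>[OF mem] by simp
    then show ?thesis by (auto simp: summable_on_def)
  qed
  define D where "D = word ` SSYT k \<gamma> F p"
  have D: "D = {f \<in> word ` tableaux. contained_in (mset f) F}"
    unfolding D_def SSYT_eq by auto
  have DW: "D \<subseteq> W" using length_word by (auto simp: D W_def)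
  have rw: "r f = prod_mset (image_mset \<rho> (mset f))" if "f \<in> W" for f
    using that prod_list_eq_prod_mset[of \<rho> f] by (simp add: r_def W_def)
  \<comment> \<open>Containment in \<open>F\<close> depends on the multiset only, so a word in
    \<open>W\<close> has all its rearrangements in \<open>W\<close>.\<close>
  have Wblock: "{y \<in> W. mset y = mset x} = {f. mset f = mset x}" if "x \<in> W" for x
    using that by (auto simp: W_def dest: mset_eq_length)
  have "(r has_sum char_inner k n \<iota> \<chi> \<psi>) D"
  proof (rule has_sum_transfer_blocks[where key = mset, OF \<iota> main summable _ DW])
    show "finite (g ` W)"
    proof (rule finite_subset)
      show "g ` W \<subseteq> (\<lambda>z. C * z) ` range (coloring_coeff k n p \<psi>)" by (auto simp: g_def)
    qed (intro finite_imageI finite_coloring_coeff k)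
    show "finite {y \<in> W. mset y = mset x}" if "x \<in> W" for x
      unfolding Wblock[OF that] by (rule finite_mset_eq)
    show "r x = r y" if "x \<in> W" "y \<in> W" "mset x = mset y" for x y
      using rw that by simp
    fix x assume x: "x \<in> W"
    let ?X = "{T \<in> tableaux. mset (word T) = mset x}"
    have "{y \<in> D. mset y = mset x} = word ` ?X"
    proof (intro equalityI subsetI)
      fix y assume "y \<in> word ` ?X"
      then show "y \<in> {y \<in> D. mset y = mset x}" using x by (auto simp: D W_def)
    qed (auto simp: D)
    then have "card {y \<in> D. mset y = mset x} = card ?X"
      using inj_on_word by (simp add: card_image inj_on_subset)
    moreover have "(\<Sum>y | y \<in> W \<and> mset y = mset x. g y) = of_nat (card ?X)"
    proof -
      have "(\<Sum>y | y \<in> W \<and> mset y = mset x. g y)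
          = C * (\<Sum>f | mset f = mset x. coloring_coeff k n p \<psi> f)"
        unfolding Wblock[OF x] g_def sum_distrib_left by (rule refl)
      also have "\<dots> = C * (of_nat k ^ n * fact n * of_nat (card ?X))"
        unfolding \<psi>_def using x by (subst sum_coloring_coeff_tableaux[OF cs]) (simp_all add: W_def)
      finally show ?thesis using k by (simp add: C_def)
    qed
    ultimately show "(\<Sum>y | y \<in> W \<and> mset y = mset x. g y) = of_nat (card {y \<in> D. mset y = mset x})"
      by simp
  qed
  moreover have "inj_on word (SSYT k \<gamma> F p)"
    using inj_on_word by (rule inj_on_subset) (auto simp: SSYT_eq)
  ultimately have "((r \<circ> word) has_sum char_inner k n \<iota> \<chi> \<psi>) (SSYT k \<gamma> F p)"
    unfolding D_def by (simp add: has_sum_reindex)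
  then show ?thesis
    unfolding \<psi>_def
    by (rule has_sum_cong[THEN iffD1, rotated])
      (simp add: SSYT_eq r_def tableau_weight_word length_word)
qed

end
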